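(* Let $U\subseteq\mathbb{R}^m$ be open and let $P_a(x)(Z)=Z^n+\sum_{j=1}^n a_j(x)Z^{n-j}$, $x\in U$, be a $C^{p-1,1}$-family of hyperbolic polynomials of degree $n$, where $p$ is the maximal multiplicity of the roots of $P_a$. Then any continuous root of $P_a$ is locally Lipschitz. Moreover, if $p=n$, then for any pair of relatively compact subsets $U_0\Subset U_1\Subset U$ and for any continuous root $\lambda$ of $P_a$, its Lipschitz constant can be bounded as follows: $$\operatorname{Lip}_{U_0}(\lambda)\le C(m,n,U_0,U_1)\,\Big(\max_{i}\|a_i\|^{1/i}_{C^{n-1,1}(\overline U_1)}\Big)\le\tilde C(m,n,U_0,U_1)\,\Big(1+\max_{i}\|a_i\|_{C^{n-1,1}(\overline U_1)}\Big),$$ where the constants $C(m,n,U_0,U_1)$ and $\tilde C(m,n,U_0,U_1)$ depend only on $m$, $n$, and the sets $U_0,U_1$.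
   Context: A monic real polynomial is hyperbolic if all its roots are real. $P_a(x)$, $x\in U$, is a $C^{p-1,1}$-family of hyperbolic polynomials if $a_1,\dots,a_n\in C^{p-1,1}(U,\mathbb{R})$ and $P_a(x)$ is hyperbolic for each $x\in U$. The maximal multiplicity of the roots of $P_a$ is the maximum over $x\in U$ of the multiplicities of the roots of $P_a(x)$. A continuous root is a continuous function $\lambda:U\to\mathbb{R}$ with $P_a(x)(\lambda(x))=0$ for all $x\in U$. The maxima over $i$ run over $i=1,\dots,n$. $C^{p-1,1}(U)$ is the space of $f\in C^{p-1}(U)$ all of whose partial derivatives $\partial^\alpha f$ of order $|\alpha|=p-1$ are locally Lipschitz. $\operatorname{Lip}_K(f)=\sup_{x,y\in K,\,x\ne y}|f(x)-f(y)|/\|x-y\|$ with the Euclidean norm, and $\|f\|_{C^{p-1,1}(K)}=\|f\|_{C^{p-1}(K)}+\sup_{|\alpha|=p-1}\operatorname{Lip}_K(\partial^\alpha f)$. $V\Subset W$ means that $V$ is relatively compact in $W$, i.e. the closure $\overline V$ is compact and contained in $W$.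
   Formalization: The set U_1 is assumed to be open; for arbitrary U_1 the bound fails, e.g. U_0=U_1=[0,1] with Z^2-(x+ε) near [0,1] and Z^2 on another component of U, as ε tends to 0. *)

theory Defs
  imports "HOL-Analysis.Analysis" "HOL-Computational_Algebra.Polynomial"
begin

definition partial_diffable_at :: "'m::finite \<Rightarrow> (real^'m \<Rightarrow> real) \<Rightarrow> real^'m \<Rightarrow> bool" where
  "partial_diffable_at i f x \<longleftrightarrow> (\<lambda>t::real. f (x + t *\<^sub>R axis i 1)) field_differentiable (at 0)"

definition pd :: "'m::finite \<Rightarrow> (real^'m \<Rightarrow> real) \<Rightarrow> real^'m \<Rightarrow> real" where
  "pd i f x = deriv (\<lambda>t::real. f (x + t *\<^sub>R axis i 1)) 0"

text \<open>Partial derivatives of order \<open>k\<close> are indexed by words of length \<open>k\<close> in the coordinates. For a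
  function of class \<open>C^k\<close> they commute, so the words of length \<open>k\<close> yield exactly the derivatives
  given by the multi-indices \<open>\<alpha>\<close> with \<open>|\<alpha>| = k\<close>.\<close>

primrec pds :: "'m::finite list \<Rightarrow> (real^'m \<Rightarrow> real) \<Rightarrow> real^'m \<Rightarrow> real" where
  "pds [] f = f"
| "pds (i # js) f = pd i (pds js f)"

text \<open>The notions below are meant for open \<open>U\<close>.\<close>

definition Ck_on :: "nat \<Rightarrow> (real^'m::finite) set \<Rightarrow> (real^'m \<Rightarrow> real) \<Rightarrow> bool" where
  "Ck_on k U f \<longleftrightarrow>
     (\<forall>js. length js < k \<longrightarrow> (\<forall>i. \<forall>x\<in>U. partial_diffable_at i (pds js f) x)) \<and>
     (\<forall>js. length js \<le> k \<longrightarrow> continuous_on U (pds js f))"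

definition locally_lipschitz_on :: "'a::metric_space set \<Rightarrow> ('a \<Rightarrow> 'b::metric_space) \<Rightarrow> bool" where
  "locally_lipschitz_on U f \<longleftrightarrow> (\<forall>x\<in>U. \<exists>u>0. \<exists>L. L-lipschitz_on (cball x u \<inter> U) f)"

definition Ck1_on :: "nat \<Rightarrow> (real^'m::finite) set \<Rightarrow> (real^'m \<Rightarrow> real) \<Rightarrow> bool" where
  "Ck1_on k U f \<longleftrightarrow> Ck_on k U f \<and> (\<forall>js. length js = k \<longrightarrow> locally_lipschitz_on U (pds js f))"

text \<open>Suprema are taken in \<open>ennreal\<close>: they may be infinite, and the supremum over the empty set is \<open>0\<close>.\<close>

definition Lip :: "(real^'m::finite) set \<Rightarrow> (real^'m \<Rightarrow> real) \<Rightarrow> ennreal" where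
  "Lip K f = (SUP (x, y) \<in> {(x, y). x \<in> K \<and> y \<in> K \<and> x \<noteq> y}. ennreal (\<bar>f x - f y\<bar> / norm (x - y)))"

definition Ck_norm :: "nat \<Rightarrow> (real^'m::finite) set \<Rightarrow> (real^'m \<Rightarrow> real) \<Rightarrow> ennreal" where
  "Ck_norm k K f = (SUP js \<in> {js. length js \<le> k}. SUP x \<in> K. ennreal \<bar>pds js f x\<bar>)"

definition Ck1_norm :: "nat \<Rightarrow> (real^'m::finite) set \<Rightarrow> (real^'m \<Rightarrow> real) \<Rightarrow> ennreal" where
  "Ck1_norm k K f = Ck_norm k K f + (SUP js \<in> {js. length js = k}. Lip K (pds js f))"

definition rel_compact_in :: "'a::topological_space set \<Rightarrow> 'a set \<Rightarrow> bool"  (infix "\<Subset>" 50) where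
  "V \<Subset> W \<longleftrightarrow> compact (closure V) \<and> closure V \<subseteq> W"

definition hyperbolic :: "real poly \<Rightarrow> bool" where
  "hyperbolic q \<longleftrightarrow> lead_coeff q = 1 \<and>
     (\<forall>z::complex. poly (map_poly complex_of_real q) z = 0 \<longrightarrow> z \<in> \<real>)"

definition P_fam :: "nat \<Rightarrow> (nat \<Rightarrow> 'x \<Rightarrow> real) \<Rightarrow> 'x \<Rightarrow> real poly" where
  "P_fam n a x = monom 1 n + (\<Sum>j=1..n. monom (a j x) (n - j))"

definition Ck1_hyperbolic_family ::
  "nat \<Rightarrow> nat \<Rightarrow> (real^'m::finite) set \<Rightarrow> (nat \<Rightarrow> real^'m \<Rightarrow> real) \<Rightarrow> bool" where
  "Ck1_hyperbolic_family k n U a \<longleftrightarrow>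
     (\<forall>i\<in>{1..n}. Ck1_on k U (a i)) \<and> (\<forall>x\<in>U. hyperbolic (P_fam n a x))"

text \<open>For a family of hyperbolic polynomials all (complex) roots are real, so real roots suffice.
  The set of multiplicities is nonempty if \<open>U \<noteq> {}\<close> and \<open>n \<ge> 1\<close>.\<close>

definition max_multiplicity :: "nat \<Rightarrow> 'x set \<Rightarrow> (nat \<Rightarrow> 'x \<Rightarrow> real) \<Rightarrow> nat" where
  "max_multiplicity n U a =
     Max {order z (P_fam n a x) | x z. x \<in> U \<and> poly (P_fam n a x) z = 0}"

definition continuous_root ::
  "nat \<Rightarrow> 'x::topological_space set \<Rightarrow> (nat \<Rightarrow> 'x \<Rightarrow> real) \<Rightarrow> ('x \<Rightarrow> real) \<Rightarrow> bool" where
  "continuous_root n U a l \<longleftrightarrow>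
     continuous_on U l \<and> (\<forall>x\<in>U. poly (P_fam n a x) (l x) = 0)"

lemma locally_lipschitz_on_compact_Lip_finite:
  fixes f :: "real^'m::finite \<Rightarrow> real"
  assumes "locally_lipschitz_on U f" "compact K" "K \<subseteq> U"
  shows "Lip K f < \<infinity>"
proof -
  have "local_lipschitz (UNIV :: real set) U (\<lambda>_. f)"
    using assms(1) unfolding locally_lipschitz_on_def local_lipschitz_def
    by (metis (no_types, lifting))
  then have "local_lipschitz {0::real} K (\<lambda>_. f)"
    using local_lipschitz_subset assms(3) by blast
  then obtain L where L: "L-lipschitz_on K f"
    using local_lipschitz_compact_implies_lipschitz[of "{0::real}" K "\<lambda>_. f"] assms(2)
    by auto
  have "Lip K f \<le> ennreal L"
    unfolding Lip_def
    by (rule SUP_least)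
       (use lipschitz_onD[OF L] in \<open>auto simp: dist_norm field_simps intro!: ennreal_leI\<close>)
  then show ?thesis
    using le_less_trans by fastforce
qed

lemma Ck1_norm_finite:
  fixes f :: "real^'m::finite \<Rightarrow> real"
  assumes f: "Ck1_on k U f" and K: "compact K" "K \<subseteq> U"
  shows "Ck1_norm k K f < \<infinity>"
proof -
  have fin: "finite {js::'m list. length js \<le> k}" "finite {js::'m list. length js = k}"
    using finite_lists_length_le[of "UNIV::'m set" k] finite_lists_length_eq[of "UNIV::'m set" k]
    by simp_all
  have bd: "(SUP x\<in>K. ennreal \<bar>pds js f x\<bar>) < \<infinity>" if "length js \<le> k" for js
  proof -
    have "continuous_on K (pds js f)"
      using f K that unfolding Ck1_on_def Ck_on_def by (meson continuous_on_subset)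
    then have "bounded (pds js f ` K)"
      using K compact_continuous_image compact_imp_bounded by blast
    then obtain B where "\<forall>x\<in>K. \<bar>pds js f x\<bar> \<le> B"
      unfolding bounded_iff by auto
    then have "(SUP x\<in>K. ennreal \<bar>pds js f x\<bar>) \<le> ennreal B"
      by (intro SUP_least ennreal_leI) auto
    then show ?thesis
      using le_less_trans by fastforce
  qed
  have SUP_finite: "(SUP j\<in>A. g j) < \<infinity>" if "finite A" "\<And>j. j \<in> A \<Longrightarrow> g j < \<infinity>"
    for A :: "'m list set" and g :: "'m list \<Rightarrow> ennreal"
    using that by (induction A rule: finite_induct) (auto simp: sup_max bot_ennreal)
  have "Ck_norm k K f < \<infinity>"
    unfolding Ck_norm_def by (rule SUP_finite) (use fin bd in auto)
  moreover have "(SUP js\<in>{js. length js = k}. Lip K (pds js f)) < \<infinity>"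
  proof (rule SUP_finite[OF fin(2)])
    fix js :: "'m list" assume "js \<in> {js. length js = k}"
    then show "Lip K (pds js f) < \<infinity>"
      using f K locally_lipschitz_on_compact_Lip_finite[of U "pds js f" K] by (simp add: Ck1_on_def)
  qed
  ultimately show ?thesis
    unfolding Ck1_norm_def by (simp add: less_top[symmetric])
qed

text \<open>The norm as a real number, to be used only when it is finite, as in the lemma above
  (\<open>enn2real \<infinity> = 0\<close>).\<close>

definition Ck1_rnorm :: "nat \<Rightarrow> (real^'m::finite) set \<Rightarrow> (real^'m \<Rightarrow> real) \<Rightarrow> real" where
  "Ck1_rnorm k K f = enn2real (Ck1_norm k K f)"

end

theory Submission
  imports Defs "HOL-Computational_Algebra.Fundamental_Theorem_Algebra"
begin

text \<open>This is Bronshtein's theorem on the roots of hyperbolic polynomials. The proof given here splits no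
  polynomial into factors with fewer roots; it works with a single estimate in one real parameter.

  Fix a point \<open>x\<close>, shift \<open>Z\<close> by the value of the root at \<open>x\<close>, and restrict the coefficients to a segment
  with centre \<open>x\<close>. This gives real-rooted polynomials \<open>P \<tau>\<close>, \<open>\<bar>\<tau>\<bar> \<le> 1\<close>, whose coefficients have Taylor
  expansions of some order \<open>q\<close>, and the coefficient of \<open>Z\<^sup>q\<close> in \<open>P 0\<close> is bounded away from \<open>0\<close>: near a root of
  multiplicity \<open>q\<close> for the local statement, and with \<open>q = n\<close> and coefficient \<open>1\<close> for the uniform one.
  For \<open>0 < s \<le> 1\<close> let \<open>A(s)\<close> be the sum of the \<open>\<bar>coeff (P 0) i\<bar> s\<^sup>i\<close>, the size of \<open>P 0\<close> on the disc of radius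
  \<open>s\<close>. Let \<open>c j k\<close> be the coefficient of \<open>\<tau>\<^sup>k\<close> in the expansion of the coefficient of \<open>Z\<^sup>j\<close>. The heart of the
  matter is the bound \<open>\<bar>c j k\<bar> s\<^bsup>j+k\<^esup> \<le> C A(s)\<close> (lemma \<open>taylor_coeff_bound\<close>), with \<open>C\<close> independent of \<open>s\<close> and
  of the family. It says that a step of length \<open>\<epsilon> s\<close> in \<open>\<tau>\<close> perturbs \<open>P 0\<close>, seen at scale \<open>s\<close>, by a small
  fraction of its size. Since \<open>P 0\<close> is as large as its size at some points \<open>\<plusminus> \<rho> s\<close> with
  \<open>1 \<le> \<rho> \<le> n + 1\<close>, a continuous root that starts at \<open>0\<close> cannot get past them: it moves by at most
  \<open>(n + 1) s\<close> (lemma \<open>root_displacement\<close>). That is the Lipschitz estimate.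

  The bound is proved by induction on \<open>q\<close>. The derivative in \<open>Z\<close> is real-rooted as well, and it accounts
  for all \<open>j \<ge> 1\<close>. There remains the constant coefficient, for which real-rootedness is used
  through inequalities of Newton type between the coefficients \<open>f\<^sub>j\<close> of the rescaled polynomial
  (lemma \<open>real_rooted_newton\<close>). If some \<open>f\<^sub>j\<close> with \<open>j \<ge> 3\<close> is not small, they bound \<open>f\<^sub>0\<close> on an interval, hence
  all its Taylor coefficients. If \<open>f\<^sub>2\<close> is not small, they bound \<open>f\<^sub>0\<close> from one side on an interval about \<open>0\<close>,
  hence its slope, as in Glaeser's inequality. If neither holds at the scale \<open>s\<close>, one goes up to the first
  scale at which it does; until then \<open>A\<close> grows no faster than the square, respectively the first power,
  of the scale, and a Taylor coefficient of order \<open>k \<ge> 2\<close>, respectively \<open>k = 1\<close>, tolerates this loss.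

  In several variables one needs that a function of class \<open>C\<^bsup>q-1,1\<^esup>\<close>, as given by partial derivatives, has
  Taylor expansions of order \<open>q\<close> along segments. The homogeneous form of the uniform bound comes from the
  weighted scaling \<open>a\<^sub>i / s\<^sup>i\<close>, which divides the roots by \<open>s\<close>.\<close>

section \<open>Real-rooted polynomials\<close>

text \<open>Hyperbolicity without the normalisation of the leading coefficient, so that the class is closed
  under differentiation and under rescaling. It excludes the zero polynomial.\<close>

definition real_rooted :: "real poly \<Rightarrow> bool" where
  "real_rooted p \<longleftrightarrow> (\<forall>z::complex. poly (map_poly complex_of_real p) z = 0 \<longrightarrow> z \<in> \<real>)"

lemma map_poly_of_real_pCons:
  "map_poly complex_of_real (pCons a p) = pCons (complex_of_real a) (map_poly complex_of_real p)"
  by (simp add: map_poly_pCons)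

lemma map_poly_of_real_add:
  "map_poly complex_of_real (p + q) = map_poly complex_of_real p + map_poly complex_of_real q"
  by (simp add: poly_eq_iff coeff_map_poly)

lemma map_poly_of_real_smult:
  "map_poly complex_of_real (smult c p) = smult (complex_of_real c) (map_poly complex_of_real p)"
  by (simp add: poly_eq_iff coeff_map_poly)

lemma map_poly_of_real_mult:
  "map_poly complex_of_real (p * q) = map_poly complex_of_real p * map_poly complex_of_real q"
  by (induction p) (simp_all add: map_poly_of_real_pCons map_poly_of_real_add
      map_poly_of_real_smult)

lemma poly_map_poly_of_real:
  "poly (map_poly complex_of_real p) (complex_of_real x) = complex_of_real (poly p x)"
  by (induction p) (simp_all add: map_poly_of_real_pCons)

lemma poly_map_poly_of_real_pcompose:
  "poly (map_poly complex_of_real (pcompose p [:c, d:])) z =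
   poly (map_poly complex_of_real p) (of_real c + of_real d * z)"
  by (induction p) (simp_all add: map_poly_of_real_pCons map_poly_of_real_add
      map_poly_of_real_smult map_poly_of_real_mult pcompose_pCons algebra_simps)

lemma real_rooted_pcompose_linear:
  assumes "real_rooted p" "d \<noteq> 0"
  shows "real_rooted (pcompose p [:c, d:])"
  unfolding real_rooted_def
proof (intro allI impI)
  fix z :: complex
  assume "poly (map_poly complex_of_real (p \<circ>\<^sub>p [:c, d:])) z = 0"
  then have "of_real c + of_real d * z \<in> \<real>"
    using assms(1) by (simp add: real_rooted_def poly_map_poly_of_real_pcompose)
  then have "(of_real c + of_real d * z - of_real c) / of_real d \<in> \<real>"
    by (intro Reals_divide Reals_diff) auto
  then show "z \<in> \<real>"
    using assms(2) by simp
qed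

lemma real_rooted_smult:
  assumes "real_rooted p" "c \<noteq> 0"
  shows "real_rooted (smult c p)"
  using assms by (simp add: real_rooted_def map_poly_of_real_smult)

lemma real_rooted_factorization:
  assumes "real_rooted p"
  shows "\<exists>c xs. c \<noteq> 0 \<and> length xs = degree p \<and> p = smult c (\<Prod>x\<leftarrow>xs. [:-x, 1:])"
  using assms
proof (induction "degree p" arbitrary: p)
  case 0
  then obtain a where a: "p = [:a:]"
    using degree_eq_zeroE by metis
  have "a \<noteq> 0"
    using 0(2) complex_i_not_numeral
    by (force simp: a real_rooted_def map_poly_of_real_pCons complex_is_Real_iff dest: spec[of _ \<i>])
  then show ?case
    by (intro exI[of _ a] exI[of _ "[]"]) (simp add: a)
next
  case (Suc n)
  let ?c = "map_poly complex_of_real"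
  have "degree (?c p) = Suc n"
    using Suc(2) by (simp add: degree_map_poly)
  then have "\<not> constant (poly (?c p))"
    by (simp add: constant_degree)
  then obtain z where z: "poly (?c p) z = 0"
    using fundamental_theorem_of_algebra by blast
  then obtain x where x: "z = complex_of_real x"
    using Suc(3) by (auto simp: real_rooted_def elim: Reals_cases)
  have "poly p x = 0"
    using z by (simp add: x poly_map_poly_of_real)
  then obtain r where r: "p = [:-x, 1:] * r"
    by (auto simp: poly_eq_0_iff_dvd)
  have "p \<noteq> 0"
    using Suc(2) by auto
  then have "r \<noteq> 0"
    using r by auto
  then have "degree p = Suc (degree r)"
    unfolding r by (subst degree_mult_eq) auto
  moreover have "real_rooted r"
    using Suc(3) by (simp add: r real_rooted_def map_poly_of_real_mult del: mult_pCons_left)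
  ultimately obtain c xs where "c \<noteq> 0" "length xs = degree r" "r = smult c (\<Prod>x\<leftarrow>xs. [:-x, 1:])"
    using Suc(1)[of r] Suc(2) by auto
  then show ?case
    using \<open>degree p = Suc (degree r)\<close>
    by (intro exI[of _ c] exI[of _ "x # xs"]) (simp add: r del: mult_pCons_left)
qed

text \<open>The logarithmic derivative of a product of real linear factors is the sum of the \<open>1 / (z - x)\<close>, and
  each of these maps the upper half plane to the lower one. Hence the derivative has no zero in the
  upper half plane.\<close>

lemma Im_logarithmic_derivative_neg:
  fixes z :: complex
  assumes "Im z > 0" "xs \<noteq> []"
  shows "poly (map_poly complex_of_real (\<Prod>x\<leftarrow>xs. [:-x, 1:])) z \<noteq> 0 \<and>
    Im (poly (map_poly complex_of_real (pderiv (\<Prod>x\<leftarrow>xs. [:-x, 1:]))) z /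
        poly (map_poly complex_of_real (\<Prod>x\<leftarrow>xs. [:-x, 1:])) z) < 0"
  using assms(2)
proof (induction xs rule: list_nonempty_induct)
  case (single x)
  have "z \<noteq> of_real x"
    using assms(1) by auto
  then show ?case
    using assms(1) by (simp add: map_poly_of_real_pCons pderiv_pCons Im_divide)
        (simp add: divide_neg_pos sum_power2_gt_zero_iff)
next
  case (cons x xs)
  let ?g = "\<Prod>x\<leftarrow>xs. [:-x, 1:]"
  let ?c = "map_poly complex_of_real"
  have nz: "z - of_real x \<noteq> 0"
    using assms(1) by auto
  have g: "poly (?c ?g) z \<noteq> 0" and neg: "Im (poly (?c (pderiv ?g)) z / poly (?c ?g) z) < 0"
    using cons by auto
  have eq: "poly (?c [:-x, 1:]) z = z - of_real x"
    by (simp add: map_poly_of_real_pCons)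
  have "poly (?c (pderiv ([:-x, 1:] * ?g))) z / poly (?c ([:-x, 1:] * ?g)) z =
      poly (?c (pderiv ?g)) z / poly (?c ?g) z + 1 / (z - of_real x)"
    unfolding pderiv_mult map_poly_of_real_add map_poly_of_real_mult poly_add poly_mult eq
    using nz g by (simp add: pderiv_pCons field_simps map_poly_of_real_pCons)
  moreover have "Im (1 / (z - of_real x)) < 0"
    using assms(1) nz by (simp add: Im_divide divide_neg_pos sum_power2_gt_zero_iff)
  moreover have "poly (?c ([:-x, 1:] * ?g)) z \<noteq> 0"
    unfolding map_poly_of_real_mult poly_mult eq using nz g by simp
  ultimately show ?case
    using neg by (simp del: mult_pCons_left)
qed

lemma map_poly_of_real_cnj:
  "poly (map_poly complex_of_real p) (cnj z) = cnj (poly (map_poly complex_of_real p) z)"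
  by (induction p) (simp_all add: map_poly_of_real_pCons)

lemma real_rooted_pderiv:
  assumes "real_rooted p" "degree p > 0"
  shows "real_rooted (pderiv p)"
proof -
  obtain c xs where c: "c \<noteq> 0" "length xs = degree p" "p = smult c (\<Prod>x\<leftarrow>xs. [:-x, 1:])"
    using real_rooted_factorization[OF assms(1)] by auto
  have ne: "xs \<noteq> []"
    using c(2) assms(2) by auto
  have upper: "poly (map_poly complex_of_real (pderiv p)) z \<noteq> 0" if "Im z > 0" for z
    using Im_logarithmic_derivative_neg[OF that ne] c(1)
    by (auto simp: c(3) pderiv_smult map_poly_of_real_smult)
  show ?thesis
    unfolding real_rooted_def
  proof (intro allI impI)
    fix z assume z: "poly (map_poly complex_of_real (pderiv p)) z = 0"
    have "\<not> Im z > 0"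
      using upper z by blast
    moreover have "\<not> Im (cnj z) > 0"
      using upper[of "cnj z"] z by (auto simp: map_poly_of_real_cnj)
    ultimately show "z \<in> \<real>"
      by (simp add: complex_is_Real_iff)
  qed
qed

text \<open>Up to sign, the quotients \<open>coeff g j / coeff g 0\<close> are the elementary symmetric functions of the
  reciprocals \<open>1 / x\<close>. The second claim is the identity between power sums and elementary symmetric
  functions in degree two; the third bounds all of them by the largest reciprocal.\<close>

lemma linear_factors_reciprocal_coeffs:
  fixes xs :: "real list"
  assumes "\<forall>x\<in>set xs. x \<noteq> 0"
  defines "g \<equiv> \<Prod>x\<leftarrow>xs. [:-x, 1:]"
  shows "coeff g 0 \<noteq> 0"
    and "(coeff g 1)\<^sup>2 - 2 * coeff g 0 * coeff g 2 = (coeff g 0)\<^sup>2 * (\<Sum>x\<leftarrow>xs. (1 / x)\<^sup>2)"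
    and "0 \<le> \<rho> \<Longrightarrow> \<forall>x\<in>set xs. \<bar>1 / x\<bar> \<le> \<rho> \<Longrightarrow> \<bar>coeff g j\<bar> \<le> 2 ^ length xs * \<bar>coeff g 0\<bar> * \<rho> ^ j"
proof -
  have "coeff g 0 \<noteq> 0 \<and>
    (coeff g 1)\<^sup>2 - 2 * coeff g 0 * coeff g 2 = (coeff g 0)\<^sup>2 * (\<Sum>x\<leftarrow>xs. (1 / x)\<^sup>2) \<and>
    (0 \<le> \<rho> \<longrightarrow> (\<forall>x\<in>set xs. \<bar>1 / x\<bar> \<le> \<rho>) \<longrightarrow> \<bar>coeff g j\<bar> \<le> 2 ^ length xs * \<bar>coeff g 0\<bar> * \<rho> ^ j)"
    using assms(1) unfolding g_def
  proof (induction xs arbitrary: j)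
    case Nil
    then show ?case by (cases j) (auto simp: coeff_pCons)
  next
    case (Cons x xs)
    let ?g = "\<Prod>x\<leftarrow>xs. [:-x, 1:]"
    have x: "x \<noteq> 0" and xs: "\<forall>x\<in>set xs. x \<noteq> 0"
      using Cons.prems by auto
    note IH = Cons.IH[OF xs]
    have c0: "coeff ([:-x, 1:] * ?g) 0 = - x * coeff ?g 0"
      by simp
    have cS: "coeff ([:-x, 1:] * ?g) (Suc i) = coeff ?g i - x * coeff ?g (Suc i)" for i
      by simp
    have g0: "coeff ?g 0 \<noteq> 0"
      using IH by blast
    have sq: "(coeff ?g 1)\<^sup>2 - 2 * coeff ?g 0 * coeff ?g 2 =
        (coeff ?g 0)\<^sup>2 * (\<Sum>x\<leftarrow>xs. (1 / x)\<^sup>2)"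
      using IH by blast
    have c1: "coeff ([:-x, 1:] * ?g) 1 = coeff ?g 0 - x * coeff ?g 1"
      using cS[of 0] by simp
    have c2: "coeff ([:-x, 1:] * ?g) 2 = coeff ?g 1 - x * coeff ?g 2"
      using cS[of 1] by (simp add: numeral_2_eq_2)
    have "(coeff ([:-x, 1:] * ?g) 1)\<^sup>2 - 2 * coeff ([:-x, 1:] * ?g) 0 * coeff ([:-x, 1:] * ?g) 2
       = x\<^sup>2 * ((coeff ?g 1)\<^sup>2 - 2 * coeff ?g 0 * coeff ?g 2) + (coeff ?g 0)\<^sup>2"
      unfolding c0 c1 c2 by (simp add: power2_eq_square algebra_simps)
    also have "\<dots> = (x * coeff ?g 0)\<^sup>2 * (\<Sum>x\<leftarrow>x # xs. (1 / x)\<^sup>2)"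
      unfolding sq using x by (simp add: power2_eq_square field_simps)
    finally have second: "(coeff ([:-x, 1:] * ?g) 1)\<^sup>2
        - 2 * coeff ([:-x, 1:] * ?g) 0 * coeff ([:-x, 1:] * ?g) 2
        = (coeff ([:-x, 1:] * ?g) 0)\<^sup>2 * (\<Sum>x\<leftarrow>x # xs. (1 / x)\<^sup>2)"
      unfolding c0 by simp
    have third: "\<bar>coeff ([:-x, 1:] * ?g) j\<bar>
        \<le> 2 ^ length (x # xs) * \<bar>coeff ([:-x, 1:] * ?g) 0\<bar> * \<rho> ^ j"
      if "\<forall>y\<in>set (x # xs). \<bar>1 / y\<bar> \<le> \<rho>" and r0: "0 \<le> \<rho>"
    proof (cases j)
      case 0
      have "1 * \<bar>x * coeff ?g 0\<bar> \<le> 2 ^ length (x # xs) * \<bar>x * coeff ?g 0\<bar>"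
        by (intro mult_right_mono one_le_power) auto
      then show ?thesis
        unfolding 0 c0 by (simp add: abs_mult)
    next
      case (Suc i)
      have bd: "\<bar>coeff ?g k\<bar> \<le> 2 ^ length xs * \<bar>coeff ?g 0\<bar> * \<rho> ^ k" for k
        using that IH by simp
      have r: "1 \<le> \<bar>x\<bar> * \<rho>"
        using that x by (simp add: field_simps)
      have "\<bar>coeff ([:-x, 1:] * ?g) j\<bar> \<le> 1 * \<bar>coeff ?g i\<bar> + \<bar>x\<bar> * \<bar>coeff ?g (Suc i)\<bar>"
        unfolding Suc cS abs_mult[symmetric] by simp
      also have "\<dots> \<le> (\<bar>x\<bar> * \<rho>) * (2 ^ length xs * \<bar>coeff ?g 0\<bar> * \<rho> ^ i)
          + \<bar>x\<bar> * (2 ^ length xs * \<bar>coeff ?g 0\<bar> * \<rho> ^ Suc i)"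
        using bd[of i] bd[of "Suc i"] r r0 by (intro add_mono mult_mono) auto
      also have "\<dots> = 2 ^ length (x # xs) * \<bar>coeff ([:-x, 1:] * ?g) 0\<bar> * \<rho> ^ j"
        unfolding Suc c0 by (simp add: abs_mult algebra_simps)
      finally show ?thesis .
    qed
    have "coeff ([:-x, 1:] * ?g) 0 \<noteq> 0"
      unfolding c0 using x g0 by simp
    then show ?case
      using second third by (simp del: mult_pCons_left)
  qed
  then show "coeff g 0 \<noteq> 0"
    and "(coeff g 1)\<^sup>2 - 2 * coeff g 0 * coeff g 2 = (coeff g 0)\<^sup>2 * (\<Sum>x\<leftarrow>xs. (1 / x)\<^sup>2)"
    and "0 \<le> \<rho> \<Longrightarrow> \<forall>x\<in>set xs. \<bar>1 / x\<bar> \<le> \<rho> \<Longrightarrow> \<bar>coeff g j\<bar> \<le> 2 ^ length xs * \<bar>coeff g 0\<bar> * \<rho> ^ j"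
    by auto
qed

text \<open>The quantitative form in which real-rootedness enters the main estimate. Let \<open>f\<^sub>j\<close> be the
  coefficients and let \<open>S\<close> be the sum of the squares of the reciprocal roots. Then
  \<open>f\<^sub>0\<^sup>2 S = f\<^sub>1\<^sup>2 - 2 f\<^sub>0 f\<^sub>2\<close>, and \<open>\<bar>f\<^sub>j\<bar>\<close> is at most a constant times \<open>\<bar>f\<^sub>0\<bar> S\<^bsup>j/2\<^esup>\<close>. Clearing \<open>S\<close> gives a
  form that remains true when \<open>0\<close> is a root.\<close>

lemma real_rooted_newton:
  assumes "real_rooted p"
  shows "0 \<le> (coeff p 1)\<^sup>2 - 2 * coeff p 0 * coeff p 2"
    and "j \<ge> 2 \<Longrightarrow> (coeff p j)\<^sup>2 * ((coeff p 0)\<^sup>2) ^ (j - 1)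
       \<le> 4 ^ degree p * ((coeff p 1)\<^sup>2 - 2 * coeff p 0 * coeff p 2) ^ j"
proof -
  have "0 \<le> (coeff p 1)\<^sup>2 - 2 * coeff p 0 * coeff p 2 \<and> (j \<ge> 2 \<longrightarrow>
     (coeff p j)\<^sup>2 * ((coeff p 0)\<^sup>2) ^ (j - 1)
       \<le> 4 ^ degree p * ((coeff p 1)\<^sup>2 - 2 * coeff p 0 * coeff p 2) ^ j)"
  proof (cases "coeff p 0 = 0")
    case True
    then show ?thesis
      by (cases "j \<ge> 2") (auto simp: power_0_left)
  next
    case False
    obtain c xs where c: "c \<noteq> 0" "length xs = degree p" "p = smult c (\<Prod>x\<leftarrow>xs. [:-x, 1:])"
      using real_rooted_factorization[OF assms] by auto
    define g where "g = (\<Prod>x\<leftarrow>xs. [:-x, 1:])"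
    define S where "S = (\<Sum>x\<leftarrow>xs. (1 / x)\<^sup>2)"
    have "poly p 0 \<noteq> 0"
      using False by (simp add: poly_0_coeff_0)
    then have "poly g 0 \<noteq> 0"
      by (simp add: c(3) g_def)
    moreover have "poly (\<Prod>x\<leftarrow>ys. [:-x, 1:]) 0 = 0" if "0 \<in> set ys" for ys :: "real list"
      using that by (induction ys) auto
    ultimately have nz: "\<forall>x\<in>set xs. x \<noteq> 0"
      unfolding g_def by metis
    have S0: "0 \<le> S"
      unfolding S_def by (intro sum_list_nonneg) auto
    have "\<forall>x\<in>set xs. \<bar>1 / x\<bar> \<le> sqrt S"
    proof
      fix x assume "x \<in> set xs"
      then have "(1 / x)\<^sup>2 \<in> set (map (\<lambda>x. (1 / x)\<^sup>2) xs)"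
        by simp
      then have "(1 / x)\<^sup>2 \<le> S"
        unfolding S_def by (intro member_le_sum_list) auto
      then show "\<bar>1 / x\<bar> \<le> sqrt S"
        using real_le_rsqrt real_sqrt_abs real_sqrt_le_iff by metis
    qed
    note g = linear_factors_reciprocal_coeffs[OF nz, folded g_def S_def]
    have q: "(coeff p 1)\<^sup>2 - 2 * coeff p 0 * coeff p 2 = (coeff p 0)\<^sup>2 * S"
    proof -
      have "(coeff p 1)\<^sup>2 - 2 * coeff p 0 * coeff p 2
          = c\<^sup>2 * ((coeff g 1)\<^sup>2 - 2 * coeff g 0 * coeff g 2)"
        unfolding c(3) g_def[symmetric] by (simp add: power2_eq_square algebra_simps)
      also have "\<dots> = (coeff p 0)\<^sup>2 * S"
        unfolding g(2) unfolding c(3) g_def[symmetric] by (simp add: power_mult_distrib)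
      finally show ?thesis .
    qed
    have bd: "\<bar>coeff p j\<bar> \<le> 2 ^ degree p * \<bar>coeff p 0\<bar> * sqrt S ^ j"
    proof -
      have "\<bar>c\<bar> * \<bar>coeff g j\<bar> \<le> \<bar>c\<bar> * (2 ^ length xs * \<bar>coeff g 0\<bar> * sqrt S ^ j)"
        using g(3)[of "sqrt S" j] S0 \<open>\<forall>x\<in>set xs. \<bar>1 / x\<bar> \<le> sqrt S\<close> by (intro mult_left_mono) auto
      moreover have "\<bar>coeff p i\<bar> = \<bar>c\<bar> * \<bar>coeff g i\<bar>" for i
        unfolding c(3) g_def[symmetric] by (simp add: abs_mult)
      ultimately show ?thesis
        by (simp add: c(2) mult_ac)
    qed
    have "(coeff p j)\<^sup>2 * ((coeff p 0)\<^sup>2) ^ (j - 1) \<le>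
        4 ^ degree p * ((coeff p 1)\<^sup>2 - 2 * coeff p 0 * coeff p 2) ^ j" if "j \<ge> 2"
    proof -
      have "(coeff p j)\<^sup>2 \<le> (2 ^ degree p * \<bar>coeff p 0\<bar> * sqrt S ^ j)\<^sup>2"
        using bd abs_le_square_iff[of "coeff p j" "2 ^ degree p * \<bar>coeff p 0\<bar> * sqrt S ^ j"] S0
        by (simp add: abs_mult)
      also have "\<dots> = (2 ^ degree p)\<^sup>2 * (coeff p 0)\<^sup>2 * ((sqrt S)\<^sup>2) ^ j"
        by (simp add: power_mult_distrib power_mult[symmetric] mult.commute)
      also have "\<dots> = 4 ^ degree p * (coeff p 0)\<^sup>2 * S ^ j"
        using S0 by (simp add: power2_eq_square power_mult_distrib[symmetric])
      finally have "(coeff p j)\<^sup>2 * ((coeff p 0)\<^sup>2) ^ (j - 1)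
          \<le> (4 ^ degree p * (coeff p 0)\<^sup>2 * S ^ j) * ((coeff p 0)\<^sup>2) ^ (j - 1)"
        by (intro mult_right_mono) auto
      also have "\<dots> = 4 ^ degree p * ((coeff p 0)\<^sup>2 * S) ^ j"
        using that by (cases j) (auto simp: power_mult_distrib)
      finally show ?thesis
        unfolding q .
    qed
    moreover have "0 \<le> (coeff p 0)\<^sup>2 * S"
      using S0 by simp
    ultimately show ?thesis
      unfolding q by blast
  qed
  then show "0 \<le> (coeff p 1)\<^sup>2 - 2 * coeff p 0 * coeff p 2"
    and "j \<ge> 2 \<Longrightarrow> (coeff p j)\<^sup>2 * ((coeff p 0)\<^sup>2) ^ (j - 1)
       \<le> 4 ^ degree p * ((coeff p 1)\<^sup>2 - 2 * coeff p 0 * coeff p 2) ^ j"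
    by auto
qed

section \<open>Elementary estimates\<close>

text \<open>Induction on the number of coefficients: in \<open>g(\<tau>) - 2\<^sup>q g(\<tau> / 2)\<close> the coefficient of \<open>\<tau>\<^sup>q\<close> cancels, and
  every other one is multiplied by a number of absolute value at least \<open>1\<close>.\<close>

lemma poly_bound_imp_coeff_bound:
  fixes \<epsilon> :: real
  assumes "0 < \<epsilon>"
  shows "\<exists>C>0. \<forall>c B. (\<forall>\<tau>. \<bar>\<tau>\<bar> \<le> \<epsilon> \<longrightarrow> \<bar>\<Sum>k<q. c k * \<tau> ^ k\<bar> \<le> B) \<longrightarrow> (\<forall>k<q. \<bar>c k\<bar> \<le> C * B)"
proof (induction q)
  case 0
  then show ?case by (auto intro!: exI[of _ 1])
next
  case (Suc q)
  then obtain C where C: "C > 0"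
    "\<And>c B. (\<forall>\<tau>. \<bar>\<tau>\<bar> \<le> \<epsilon> \<longrightarrow> \<bar>\<Sum>k<q. c k * \<tau> ^ k\<bar> \<le> B) \<Longrightarrow> (\<forall>k<q. \<bar>c k\<bar> \<le> C * B)"
    by blast
  define C1 where "C1 = C * (1 + 2 ^ q)"
  have C1: "C1 > 0"
    using C(1) by (simp add: C1_def add_pos_pos)
  define C2 where "C2 = (1 + (\<Sum>k<q. C1 * \<epsilon> ^ k)) / \<epsilon> ^ q"
  have C2: "C2 > 0"
    unfolding C2_def using C1 assms by (intro divide_pos_pos add_pos_nonneg sum_nonneg) auto
  have "\<forall>k<Suc q. \<bar>c k\<bar> \<le> max C1 C2 * B"
    if H: "\<forall>\<tau>. \<bar>\<tau>\<bar> \<le> \<epsilon> \<longrightarrow> \<bar>\<Sum>k<Suc q. c k * \<tau> ^ k\<bar> \<le> B" for c B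
  proof -
    have B0: "0 \<le> B"
      using H[rule_format, of 0] assms by force
    have "\<bar>\<Sum>k<q. (c k * (1 - 2 ^ (q - k))) * \<tau> ^ k\<bar> \<le> (1 + 2 ^ q) * B" if "\<bar>\<tau>\<bar> \<le> \<epsilon>" for \<tau>
    proof -
      have "2 ^ q * (c k * (\<tau> / 2) ^ k) = c k * 2 ^ (q - k) * \<tau> ^ k" if "k < Suc q" for k
        using that by (simp add: power_divide power_diff)
      then have "(\<Sum>k<Suc q. c k * \<tau> ^ k) - 2 ^ q * (\<Sum>k<Suc q. c k * (\<tau> / 2) ^ k)
          = (\<Sum>k<Suc q. c k * \<tau> ^ k - c k * 2 ^ (q - k) * \<tau> ^ k)"
        unfolding sum_distrib_left sum_subtractf by (intro arg_cong2[of _ _ _ _ "(-)"] sum.cong) auto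
      also have "\<dots> = (\<Sum>k<q. (c k * (1 - 2 ^ (q - k))) * \<tau> ^ k)"
        by (simp add: left_diff_distrib right_diff_distrib)
      finally have eq: "(\<Sum>k<Suc q. c k * \<tau> ^ k) - 2 ^ q * (\<Sum>k<Suc q. c k * (\<tau> / 2) ^ k)
          = (\<Sum>k<q. (c k * (1 - 2 ^ (q - k))) * \<tau> ^ k)" .
      have "\<bar>x - 2 ^ q * y\<bar> \<le> \<bar>x\<bar> + 2 ^ q * \<bar>y\<bar>" for x y :: real
        using abs_triangle_ineq4[of x "2 ^ q * y"] by (simp add: abs_mult)
      then have "\<bar>\<Sum>k<q. (c k * (1 - 2 ^ (q - k))) * \<tau> ^ k\<bar>
          \<le> \<bar>\<Sum>k<Suc q. c k * \<tau> ^ k\<bar> + 2 ^ q * \<bar>\<Sum>k<Suc q. c k * (\<tau> / 2) ^ k\<bar>"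
        unfolding eq[symmetric] .
      also have "\<dots> \<le> B + 2 ^ q * B"
        using that by (intro add_mono mult_left_mono H[rule_format]) auto
      finally show ?thesis by (simp add: algebra_simps)
    qed
    then have low: "\<bar>c k\<bar> \<le> C1 * B" if "k < q" for k
    proof -
      have "(2::real) ^ 1 \<le> 2 ^ (q - k)"
        using that by (intro power_increasing) auto
      then have "\<bar>c k\<bar> * 1 \<le> \<bar>c k\<bar> * \<bar>1 - 2 ^ (q - k)\<bar>"
        by (intro mult_left_mono) auto
      also have "\<dots> \<le> C * ((1 + 2 ^ q) * B)"
        using C(2)[of "\<lambda>k. c k * (1 - 2 ^ (q - k))"]
          \<open>\<And>\<tau>. \<bar>\<tau>\<bar> \<le> \<epsilon> \<Longrightarrow> \<bar>\<Sum>k<q. (c k * (1 - 2 ^ (q - k))) * \<tau> ^ k\<bar> \<le> (1 + 2 ^ q) * B\<close> that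
        by (auto simp: abs_mult)
      finally show ?thesis by (simp add: C1_def mult_ac)
    qed
    have "\<bar>c q\<bar> * \<epsilon> ^ q = \<bar>c q * \<epsilon> ^ q\<bar>"
      using assms by (simp add: abs_mult)
    also have "\<dots> = \<bar>(\<Sum>k<Suc q. c k * \<epsilon> ^ k) - (\<Sum>k<q. c k * \<epsilon> ^ k)\<bar>"
      by simp
    also have "\<dots> \<le> \<bar>\<Sum>k<Suc q. c k * \<epsilon> ^ k\<bar> + \<bar>\<Sum>k<q. c k * \<epsilon> ^ k\<bar>"
      by (rule abs_triangle_ineq4)
    also have "\<dots> \<le> B + (\<Sum>k<q. C1 * B * \<epsilon> ^ k)"
    proof (rule add_mono)
      show "\<bar>\<Sum>k<Suc q. c k * \<epsilon> ^ k\<bar> \<le> B"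
        using H[rule_format, of \<epsilon>] assms by simp
      show "\<bar>\<Sum>k<q. c k * \<epsilon> ^ k\<bar> \<le> (\<Sum>k<q. C1 * B * \<epsilon> ^ k)"
        using low assms
        by (intro order.trans[OF sum_abs] sum_mono) (auto simp: abs_mult intro!: mult_right_mono)
    qed
    also have "\<dots> = (1 + (\<Sum>k<q. C1 * \<epsilon> ^ k)) * B"
      by (simp add: algebra_simps sum_distrib_left)
    finally have top: "\<bar>c q\<bar> \<le> C2 * B"
      using assms by (simp add: C2_def field_simps)
    show ?thesis
    proof (intro allI impI)
      fix k assume "k < Suc q"
      then consider "k < q" | "k = q" by linarith
      then show "\<bar>c k\<bar> \<le> max C1 C2 * B"
        using low top mult_right_mono[OF max.cobounded1 B0, of C1 C2]
          mult_right_mono[OF max.cobounded2 B0, of C2 C1]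
        by cases (meson order_trans)+
    qed
  qed
  then show ?case
    using C1 by (intro exI[of _ "max C1 C2"]) auto
qed

text \<open>Either the terms of index above \<open>m\<close> already have a definite share of the sum at \<open>s\<close>, or the terms of
  index at most \<open>m\<close> dominate from \<open>s\<close> up to the first radius \<open>r\<close> at which the two parts are in the ratio
  \<open>\<theta>\<close>; on that interval the sum grows at most like the power \<open>m\<close> of the radius. Such an \<open>r \<le> 1\<close> exists
  since \<open>b q \<ge> \<kappa>\<close> secures the share at radius \<open>1\<close>.\<close>

lemma dominating_scale:
  fixes \<kappa> M :: real
  assumes \<kappa>: "0 < \<kappa>" and M: "\<kappa> \<le> M" and q: "m < q" "q \<le> n"
  shows "\<exists>\<eta>>0. \<forall>b s. (\<forall>i. 0 \<le> b i \<and> b i \<le> M) \<longrightarrow> \<kappa> \<le> b q \<longrightarrow> 0 < s \<longrightarrow> s \<le> 1 \<longrightarrow>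
    (\<exists>r\<ge>s. r \<le> 1 \<and> (\<exists>j>m. j \<le> n \<and> \<eta> * (\<Sum>i\<le>n. b i * r ^ i) \<le> b j * r ^ j) \<and>
       (\<Sum>i\<le>n. b i * r ^ i) \<le> 2 * (r / s) ^ m * (\<Sum>i\<le>n. b i * s ^ i))"
proof -
  \<comment> \<open>At radius \<open>1\<close> the terms up to index \<open>m\<close> sum to at most \<open>(m + 1) M\<close> and the others to at least \<open>\<kappa>\<close>.\<close>
  define \<theta> where "\<theta> = \<kappa> / (real (Suc m) * M)"
  have \<theta>: "0 < \<theta>" "\<theta> \<le> 1"
  proof -
    have "\<kappa> \<le> 1 * M" using M by simp
    also have "\<dots> \<le> real (Suc m) * M" using \<kappa> M by (intro mult_right_mono) auto
    finally show "0 < \<theta>" "\<theta> \<le> 1"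
      using \<kappa> M unfolding \<theta>_def by (simp_all del: of_nat_Suc)
  qed
  \<comment> \<open>If the terms above \<open>m\<close> sum to at least \<open>\<theta>\<close> times the rest, the largest of them has this share of the whole.\<close>
  define \<eta> where "\<eta> = 1 / ((1 + 1 / \<theta>) * real n)"
  have n: "real n > 0" using q by simp
  have \<eta>: "0 < \<eta>"
    unfolding \<eta>_def using \<theta> n by (intro divide_pos_pos mult_pos_pos add_pos_pos) auto
  have "\<exists>r\<ge>s. r \<le> 1 \<and> (\<exists>j>m. j \<le> n \<and> \<eta> * (\<Sum>i\<le>n. b i * r ^ i) \<le> b j * r ^ j) \<and>
       (\<Sum>i\<le>n. b i * r ^ i) \<le> 2 * (r / s) ^ m * (\<Sum>i\<le>n. b i * s ^ i)"
    if b: "\<forall>i. 0 \<le> b i \<and> b i \<le> M" and bq: "\<kappa> \<le> b q" and s: "0 < s" "s \<le> 1"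
    for b :: "nat \<Rightarrow> real" and s :: real
  proof -
    define lo where "lo r = (\<Sum>i\<le>m. b i * r ^ i)" for r :: real
    define hi where "hi r = (\<Sum>i\<in>{m<..n}. b i * r ^ i)" for r :: real
    have split: "(\<Sum>i\<le>n. b i * r ^ i) = lo r + hi r" for r
    proof -
      have "{..n} = {..m} \<union> {m<..n}" using q by auto
      then show ?thesis
        unfolding lo_def hi_def by (subst sum.union_disjoint[symmetric]) auto
    qed
    have lo0: "0 \<le> lo r" if "0 \<le> r" for r
      unfolding lo_def using b that by (intro sum_nonneg) auto
    have hi0: "0 \<le> hi r" if "0 \<le> r" for r
      unfolding hi_def using b that by (intro sum_nonneg) auto
    have share: "\<exists>j>m. j \<le> n \<and> \<eta> * (\<Sum>i\<le>n. b i * r ^ i) \<le> b j * r ^ j"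
      if r: "0 < r" and h: "\<theta> * lo r \<le> hi r" for r
    proof (rule ccontr)
      assume "\<not> ?thesis"
      then have lt: "b j * r ^ j < \<eta> * (lo r + hi r)" if "j \<in> {m<..n}" for j
        using that split by (auto simp: not_le)
      have "hi r < (\<Sum>j\<in>{m<..n}. \<eta> * (lo r + hi r))"
        unfolding hi_def using lt q by (intro sum_strict_mono) (auto simp: hi_def)
      also have "\<dots> = real (n - m) * (\<eta> * (lo r + hi r))"
        by simp
      also have "\<dots> \<le> real n * (\<eta> * (lo r + hi r))"
        using \<eta> lo0[of r] hi0[of r] r by (intro mult_right_mono) auto
      also have "\<dots> \<le> real n * (\<eta> * (hi r / \<theta> + hi r))"
        using h \<eta> \<theta> n by (intro mult_left_mono add_mono) (auto simp: field_simps)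
      also have "\<dots> = hi r * ((1 + 1 / \<theta>) * real n * \<eta>)"
        by (simp add: algebra_simps)
      also have "(1 + 1 / \<theta>) * real n * \<eta> = 1"
      proof -
        define X where "X = (1 + 1 / \<theta>) * real n"
        have "0 < X"
          unfolding X_def using \<theta> n by (intro mult_pos_pos add_pos_pos) auto
        then show ?thesis
          unfolding \<eta>_def X_def[symmetric] by simp
      qed
      finally show False by simp
    qed
    have growth: "lo r \<le> (r / s) ^ m * lo s" if "s \<le> r" for r
    proof -
      have "b i * r ^ i \<le> (r / s) ^ m * (b i * s ^ i)" if i: "i \<le> m" for i
      proof -
        have "r ^ i = (r / s) ^ i * s ^ i"
          using s by (simp add: power_divide)
        also have "\<dots> \<le> (r / s) ^ m * s ^ i"
          using s \<open>s \<le> r\<close> i by (intro mult_right_mono power_increasing) auto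
        finally have "b i * r ^ i \<le> b i * ((r / s) ^ m * s ^ i)"
          using b by (intro mult_left_mono) auto
        then show ?thesis by (simp add: mult_ac)
      qed
      then show ?thesis
        unfolding lo_def sum_distrib_left by (intro sum_mono) auto
    qed
    show ?thesis
    proof (cases "\<theta> * lo s \<le> hi s")
      case True
      have "0 \<le> lo s + hi s" using lo0[of s] hi0[of s] s by simp
      then show ?thesis
        using share[OF s(1) True] s by (intro exI[of _ s]) (auto simp: split)
    next
      case False
      have "lo 1 \<le> (\<Sum>i\<le>m. M)"
        unfolding lo_def using b by (intro sum_mono) auto
      then have "\<theta> * lo 1 \<le> \<theta> * (real (Suc m) * M)"
        using \<theta> by (intro mult_left_mono) auto
      also have "\<dots> = \<kappa>"
        using \<kappa> M by (simp add: \<theta>_def del: of_nat_Suc)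
      also have "\<kappa> \<le> hi 1"
        using bq b q member_le_sum[of q "{m<..n}" b] by (auto simp: hi_def)
      finally have one: "\<theta> * lo 1 \<le> hi 1" .
      have "\<exists>r\<ge>s. r \<le> 1 \<and> hi r - \<theta> * lo r = 0"
      proof (rule IVT')
        show "continuous_on {s..1} (\<lambda>r. hi r - \<theta> * lo r)"
          unfolding lo_def hi_def by (intro continuous_intros)
      qed (use False one s in auto)
      then obtain r where r: "s \<le> r" "r \<le> 1" "hi r = \<theta> * lo r"
        by auto
      have r0: "0 < r" using r s by simp
      have "lo r + hi r \<le> 2 * lo r"
        using r(3) \<theta> lo0[of r] r0 mult_right_mono[of \<theta> 1 "lo r"] by simp
      also have "\<dots> \<le> 2 * ((r / s) ^ m * (lo s + hi s))"
        using growth[OF r(1)] hi0[of s] s r0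
        by (intro mult_left_mono order.trans[OF growth[OF r(1)]]) auto
      finally have "lo r + hi r \<le> 2 * (r / s) ^ m * (lo s + hi s)" by simp
      then show ?thesis
        using share[OF r0] r by (intro exI[of _ r]) (auto simp: split)
    qed
  qed
  then show ?thesis
    using \<eta> by blast
qed

text \<open>In \<open>f\<^sub>j\<^sup>2 f\<^sub>0\<^bsup>2j-2\<^esup> \<le> D (f\<^sub>1\<^sup>2 - 2 f\<^sub>0 f\<^sub>2)\<^sup>j\<close> the left side has degree \<open>2 j - 2\<close> in \<open>f\<^sub>0\<close> and the right side only
  degree \<open>j\<close>. For \<open>j \<ge> 3\<close> the first is larger, so a lower bound for \<open>\<bar>f\<^sub>j\<bar>\<close> bounds \<open>f\<^sub>0\<close>.\<close>

lemma newton_bounds_constant_coeff: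
  fixes f :: "nat \<Rightarrow> real" and D :: real
  assumes newton: "(f j)\<^sup>2 * ((f 0)\<^sup>2) ^ (j - 1) \<le> D * ((f 1)\<^sup>2 - 2 * f 0 * f 2) ^ j"
    and nonneg: "0 \<le> (f 1)\<^sup>2 - 2 * f 0 * f 2"
    and j: "3 \<le> j" "j \<le> n" and f: "\<bar>f 1\<bar> \<le> B" "\<bar>f 2\<bar> \<le> B" "\<kappa> \<le> \<bar>f j\<bar>"
    and const: "0 < \<kappa>" "1 \<le> B" "1 \<le> D"
  shows "\<bar>f 0\<bar> \<le> max 1 (D * (3 * B\<^sup>2) ^ n / \<kappa>\<^sup>2)"
proof (cases "\<bar>f 0\<bar> \<le> 1")
  case False
  define y where "y = \<bar>f 0\<bar>"
  have y: "1 < y" using False by (simp add: y_def)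
  have "(f 1)\<^sup>2 - 2 * f 0 * f 2 \<le> \<bar>f 1\<bar>\<^sup>2 + 2 * (y * \<bar>f 2\<bar>)"
    unfolding y_def abs_mult[symmetric] by simp
  also have "\<dots> \<le> B\<^sup>2 * y + 2 * (y * B\<^sup>2)"
  proof (intro add_mono mult_left_mono)
    have "\<bar>f 1\<bar>\<^sup>2 \<le> B\<^sup>2" using f by (intro power_mono) auto
    also have "\<dots> \<le> B\<^sup>2 * y" using y const by simp
    finally show "\<bar>f 1\<bar>\<^sup>2 \<le> B\<^sup>2 * y" .
    show "\<bar>f 2\<bar> \<le> B\<^sup>2" using f(2) const(2) self_le_power[of B 2] by linarith
  qed (use y in auto)
  also have "\<dots> = 3 * B\<^sup>2 * y" by simp
  finally have "((f 1)\<^sup>2 - 2 * f 0 * f 2) ^ j \<le> (3 * B\<^sup>2 * y) ^ j"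
    using nonneg by (intro power_mono) auto
  then have "(f j)\<^sup>2 * ((f 0)\<^sup>2) ^ (j - 1) \<le> D * (3 * B\<^sup>2) ^ j * y ^ j"
    using newton const by (smt (verit) mult.assoc mult_left_mono power_mult_distrib)
  also have "\<dots> \<le> D * (3 * B\<^sup>2) ^ n * y ^ j"
  proof -
    have "1 \<le> 3 * B\<^sup>2" using const one_le_power[of B 2] by linarith
    then show ?thesis
      using const y j by (intro mult_right_mono mult_left_mono power_increasing) auto
  qed
  finally have 1: "(f j)\<^sup>2 * ((f 0)\<^sup>2) ^ (j - 1) \<le> D * (3 * B\<^sup>2) ^ n * y ^ j" .
  have "\<kappa>\<^sup>2 * y * y ^ j \<le> \<bar>f j\<bar>\<^sup>2 * y ^ (2 * (j - 1))"
  proof -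
    have "y * y ^ j = y ^ Suc j" by simp
    also have "\<dots> \<le> y ^ (2 * (j - 1))"
      using y j by (intro power_increasing) auto
    finally have "\<kappa>\<^sup>2 * (y * y ^ j) \<le> \<bar>f j\<bar>\<^sup>2 * y ^ (2 * (j - 1))"
      using f const y by (intro mult_mono power_mono) auto
    then show ?thesis by (simp add: mult_ac)
  qed
  also have "\<dots> = (f j)\<^sup>2 * ((f 0)\<^sup>2) ^ (j - 1)"
    unfolding y_def by (simp add: power_mult)
  also note 1
  finally have "\<kappa>\<^sup>2 * y \<le> D * (3 * B\<^sup>2) ^ n"
    using y by (simp add: mult_le_cancel_right)
  then have "y \<le> D * (3 * B\<^sup>2) ^ n / \<kappa>\<^sup>2"
    using const by (simp add: field_simps)
  then show ?thesis unfolding y_def by simp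
qed auto

section \<open>Families of real-rooted polynomials at a fixed scale\<close>

text \<open>The size of \<open>p\<close> on the disc of radius \<open>s\<close> about \<open>0\<close>. If all roots \<open>x\<close> are real it is comparable to the
  product of the \<open>s + \<bar>x\<bar>\<close>, times the leading coefficient.\<close>

definition root_scale :: "real poly \<Rightarrow> real \<Rightarrow> real" where
  "root_scale p s = (\<Sum>i\<le>degree p. \<bar>coeff p i\<bar> * s ^ i)"

text \<open>A family of real-rooted polynomials of degree \<open>n\<close> whose coefficients have Taylor expansions of order
  \<open>q\<close> at \<open>\<tau> = 0\<close>; \<open>c j k\<close> is the coefficient of \<open>\<tau>\<^sup>k\<close> in the expansion of the \<open>j\<close>-th coefficient, and \<open>M\<close>
  bounds both these numbers and the remainders divided by \<open>\<bar>\<tau>\<bar>\<^sup>q\<close>.\<close>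

definition taylor_family ::
  "nat \<Rightarrow> nat \<Rightarrow> real \<Rightarrow> (real \<Rightarrow> real poly) \<Rightarrow> (nat \<Rightarrow> nat \<Rightarrow> real) \<Rightarrow> bool" where
  "taylor_family q n M P c \<longleftrightarrow>
     (\<forall>\<tau>. \<bar>\<tau>\<bar> \<le> 1 \<longrightarrow> real_rooted (P \<tau>) \<and> degree (P \<tau>) = n) \<and>
     (\<forall>j\<le>n. \<forall>k<q. \<bar>c j k\<bar> \<le> M) \<and>
     (\<forall>j\<le>n. \<forall>\<tau>. \<bar>\<tau>\<bar> \<le> 1 \<longrightarrow> \<bar>coeff (P \<tau>) j - (\<Sum>k<q. c j k * \<tau> ^ k)\<bar> \<le> M * \<bar>\<tau>\<bar> ^ q)"

lemma taylor_family_base: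
  assumes "taylor_family q n M P c" "0 < q" "j \<le> n"
  shows "c j 0 = coeff (P 0) j"
proof -
  have "\<bar>coeff (P 0) j - (\<Sum>k<q. c j k * 0 ^ k)\<bar> \<le> M * \<bar>0\<bar> ^ q"
    using assms unfolding taylor_family_def by (metis abs_zero zero_le_one)
  moreover have "(\<Sum>k<q. c j k * 0 ^ k) = c j 0"
    using assms(2) by (simp add: power_0_left if_distrib[of "\<lambda>x. _ * x"] sum.delta cong: if_cong)
  ultimately show ?thesis
    using zero_power[OF assms(2), where 'a = real] by simp
qed

lemma root_scale_lower:
  assumes "q \<le> degree p" "\<kappa> \<le> \<bar>coeff p q\<bar>" "0 < s"
  shows "\<kappa> * s ^ q \<le> root_scale p s"
proof -
  have "\<kappa> * s ^ q \<le> \<bar>coeff p q\<bar> * s ^ q"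
    using assms by (intro mult_right_mono) auto
  also have "\<dots> \<le> root_scale p s"
    unfolding root_scale_def using assms
    by (intro member_le_sum[of q "{..degree p}" "\<lambda>i. \<bar>coeff p i\<bar> * s ^ i"]) auto
  finally show ?thesis .
qed

lemma coeff_le_root_scale:
  assumes "0 < s"
  shows "\<bar>coeff p i\<bar> * s ^ i \<le> root_scale p s"
proof (cases "i \<le> degree p")
  case True
  then show ?thesis
    unfolding root_scale_def using assms
    by (intro member_le_sum[of i "{..degree p}" "\<lambda>i. \<bar>coeff p i\<bar> * s ^ i"]) auto
next
  case False
  then have "coeff p i = 0" by (simp add: coeff_eq_0)
  then show ?thesis
    unfolding root_scale_def using assms by (simp add: sum_nonneg)
qed

text \<open>The lower bound \<open>\<kappa>\<close> for one coefficient says that at most \<open>q\<close> roots of \<open>P 0\<close> can be close to \<open>0\<close>. It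
  makes \<open>\<kappa> s\<^sup>q\<close> a lower bound for the scale, so that remainders of order \<open>q\<close> are harmless at every scale
  \<open>s \<le> 1\<close>.\<close>

locale scaled_family =
  fixes q n :: nat and M \<kappa> :: real and P :: "real \<Rightarrow> real poly" and c :: "nat \<Rightarrow> nat \<Rightarrow> real"
    and s :: real
  assumes fam: "taylor_family q n M P c" and q: "0 < q" "q \<le> n"
    and \<kappa>: "0 < \<kappa>" "\<kappa> \<le> \<bar>coeff (P 0) q\<bar>" and s: "0 < s" "s \<le> 1"
begin

abbreviation "A \<equiv> root_scale (P 0) s"

lemma degree_P: "\<bar>\<tau>\<bar> \<le> 1 \<Longrightarrow> degree (P \<tau>) = n"
  using fam by (simp add: taylor_family_def)

lemma real_rooted_P: "\<bar>\<tau>\<bar> \<le> 1 \<Longrightarrow> real_rooted (P \<tau>)"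
  using fam by (simp add: taylor_family_def)

lemma M_nonneg: "0 \<le> M"
  using fam q unfolding taylor_family_def by (meson abs_ge_zero le0 order_trans)

lemma A_lower: "\<kappa> * s ^ q \<le> A"
  using root_scale_lower \<kappa> s q degree_P by simp

lemma A_pos: "0 < A"
  using A_lower \<kappa> s by (smt (verit) mult_pos_pos zero_less_power)

lemma scaled_abs_le: "\<bar>\<tau>\<bar> \<le> 1 \<Longrightarrow> \<bar>s * \<tau>\<bar> \<le> 1"
  using s by (simp add: abs_mult mult_le_one)

lemma remainder:
  assumes "j \<le> n" "\<bar>\<tau>\<bar> \<le> 1"
  shows "\<bar>coeff (P (s * \<tau>)) j - (\<Sum>k<q. c j k * s ^ k * \<tau> ^ k)\<bar> * s ^ j \<le> M / \<kappa> * A * \<bar>\<tau>\<bar>"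
proof -
  have "\<bar>coeff (P (s * \<tau>)) j - (\<Sum>k<q. c j k * (s * \<tau>) ^ k)\<bar> \<le> M * \<bar>s * \<tau>\<bar> ^ q"
    using fam assms scaled_abs_le unfolding taylor_family_def by blast
  moreover have "(\<Sum>k<q. c j k * (s * \<tau>) ^ k) = (\<Sum>k<q. c j k * s ^ k * \<tau> ^ k)"
    by (simp add: power_mult_distrib mult_ac)
  ultimately have "\<bar>coeff (P (s * \<tau>)) j - (\<Sum>k<q. c j k * s ^ k * \<tau> ^ k)\<bar> * s ^ j
      \<le> M * \<bar>s * \<tau>\<bar> ^ q * s ^ j"
    using s by (intro mult_right_mono) auto
  also have "\<dots> = M * s ^ q * (\<bar>\<tau>\<bar> ^ q * s ^ j)"
    using s by (simp add: abs_mult power_mult_distrib mult_ac)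
  also have "\<dots> \<le> M * s ^ q * (\<bar>\<tau>\<bar> * 1)"
    using M_nonneg s assms q power_decreasing[of 1 q "\<bar>\<tau>\<bar>"]
    by (intro mult_left_mono mult_mono) (auto simp: power_le_one)
  also have "\<dots> = M / \<kappa> * (\<kappa> * s ^ q) * \<bar>\<tau>\<bar>"
    using \<kappa> by simp
  also have "\<dots> \<le> M / \<kappa> * A * \<bar>\<tau>\<bar>"
    using A_lower M_nonneg \<kappa> by (intro mult_right_mono mult_left_mono) auto
  finally show ?thesis .
qed

lemma increment:
  assumes j: "j \<le> n" and D: "\<And>k. 0 < k \<Longrightarrow> k < q \<Longrightarrow> \<bar>c j k\<bar> * s ^ (j + k) \<le> D * A" "0 \<le> D"
    and \<tau>: "\<bar>\<tau>\<bar> \<le> 1"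
  shows "\<bar>coeff (P (s * \<tau>)) j - coeff (P 0) j\<bar> * s ^ j \<le> (real q * D + M / \<kappa>) * A * \<bar>\<tau>\<bar>"
proof -
  have split: "(\<Sum>k<q. c j k * s ^ k * \<tau> ^ k) =
      coeff (P 0) j + (\<Sum>k\<in>{1..<q}. c j k * s ^ k * \<tau> ^ k)"
  proof -
    have "{..<q} = insert 0 {1..<q}" using q by auto
    then show ?thesis using taylor_family_base[OF fam q(1) j] by simp
  qed
  have "\<bar>\<Sum>k\<in>{1..<q}. c j k * s ^ k * \<tau> ^ k\<bar> * s ^ j \<le>
      (\<Sum>k\<in>{1..<q}. \<bar>c j k * s ^ k * \<tau> ^ k\<bar>) * s ^ j"
    using s by (intro mult_right_mono sum_abs) auto
  also have "\<dots> = (\<Sum>k\<in>{1..<q}. \<bar>c j k\<bar> * s ^ (j + k) * \<bar>\<tau>\<bar> ^ k)"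
    using s unfolding sum_distrib_right
    by (intro sum.cong) (auto simp: abs_mult power_add power_abs mult_ac)
  also have "\<dots> \<le> (\<Sum>k\<in>{1..<q}. D * A * \<bar>\<tau>\<bar>)"
  proof (rule sum_mono)
    fix k assume k: "k \<in> {1..<q}"
    have "\<bar>c j k\<bar> * s ^ (j + k) \<le> D * A" using D k by auto
    moreover have "\<bar>\<tau>\<bar> ^ k \<le> \<bar>\<tau>\<bar>" using k \<tau> power_decreasing[of 1 k "\<bar>\<tau>\<bar>"] by auto
    ultimately show "\<bar>c j k\<bar> * s ^ (j + k) * \<bar>\<tau>\<bar> ^ k \<le> D * A * \<bar>\<tau>\<bar>"
      using D A_pos by (intro mult_mono[of _ "D * A"]) auto
  qed
  also have "\<dots> = real (q - 1) * (D * A * \<bar>\<tau>\<bar>)" by simp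
  also have "\<dots> \<le> real q * (D * A * \<bar>\<tau>\<bar>)"
    using D A_pos by (intro mult_right_mono) auto
  finally have 1: "\<bar>\<Sum>k\<in>{1..<q}. c j k * s ^ k * \<tau> ^ k\<bar> * s ^ j \<le> real q * D * A * \<bar>\<tau>\<bar>"
    by simp
  have "\<bar>coeff (P (s * \<tau>)) j - coeff (P 0) j\<bar> \<le>
      \<bar>coeff (P (s * \<tau>)) j - (\<Sum>k<q. c j k * s ^ k * \<tau> ^ k)\<bar> + \<bar>\<Sum>k\<in>{1..<q}. c j k * s ^ k * \<tau> ^ k\<bar>"
    unfolding split by simp
  then have "\<bar>coeff (P (s * \<tau>)) j - coeff (P 0) j\<bar> * s ^ j \<le>
      (\<bar>coeff (P (s * \<tau>)) j - (\<Sum>k<q. c j k * s ^ k * \<tau> ^ k)\<bar> + \<bar>\<Sum>k\<in>{1..<q}. c j k * s ^ k * \<tau> ^ k\<bar>) * s ^ j"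
    using s by (intro mult_right_mono) auto
  also have "\<dots> \<le> M / \<kappa> * A * \<bar>\<tau>\<bar> + real q * D * A * \<bar>\<tau>\<bar>"
    unfolding distrib_right using remainder[OF j \<tau>] 1 by linarith
  finally show ?thesis by (simp add: algebra_simps)
qed

text \<open>The coefficients of the polynomial \<open>\<zeta> \<mapsto> P(s \<tau>)(s \<zeta>) / A\<close>: both variables are measured in units of
  \<open>s\<close>, and the coefficients at \<open>\<tau> = 0\<close> are normalised to have absolute sum \<open>1\<close>.\<close>

definition f :: "real \<Rightarrow> nat \<Rightarrow> real" where
  "f \<tau> i = coeff (P (s * \<tau>)) i * s ^ i / A"

lemma f_base: "\<bar>f 0 i\<bar> \<le> 1"
  using coeff_le_root_scale[OF s(1), of "P 0" i] A_pos s by (simp add: f_def abs_mult)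

lemma f_newton:
  assumes "\<bar>\<tau>\<bar> \<le> 1"
  shows "0 \<le> (f \<tau> 1)\<^sup>2 - 2 * f \<tau> 0 * f \<tau> 2"
    and "2 \<le> j \<Longrightarrow> (f \<tau> j)\<^sup>2 * ((f \<tau> 0)\<^sup>2) ^ (j - 1) \<le>
      4 ^ n * ((f \<tau> 1)\<^sup>2 - 2 * f \<tau> 0 * f \<tau> 2) ^ j"
proof -
  define p where "p = smult (1 / A) (pcompose (P (s * \<tau>)) [:0, s:])"
  have "real_rooted p"
    unfolding p_def using real_rooted_P scaled_abs_le assms A_pos s
    by (intro real_rooted_smult real_rooted_pcompose_linear) auto
  moreover have "degree p = n"
    using scaled_abs_le assms A_pos s degree_P by (simp add: p_def degree_pcompose)
  moreover have "coeff p i = f \<tau> i" for i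
    by (simp add: p_def f_def coeff_pcompose_linear)
  ultimately show "0 \<le> (f \<tau> 1)\<^sup>2 - 2 * f \<tau> 0 * f \<tau> 2"
    and "2 \<le> j \<Longrightarrow> (f \<tau> j)\<^sup>2 * ((f \<tau> 0)\<^sup>2) ^ (j - 1) \<le>
      4 ^ n * ((f \<tau> 1)\<^sup>2 - 2 * f \<tau> 0 * f \<tau> 2) ^ j"
    using real_rooted_newton[of p] by auto
qed

lemma f_increment:
  assumes "j \<le> n" "\<And>k. 0 < k \<Longrightarrow> k < q \<Longrightarrow> \<bar>c j k\<bar> * s ^ (j + k) \<le> D * A" "0 \<le> D" "\<bar>\<tau>\<bar> \<le> 1"
  shows "\<bar>f \<tau> j - f 0 j\<bar> \<le> (real q * D + M / \<kappa>) * \<bar>\<tau>\<bar>"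
proof -
  have "f \<tau> j - f 0 j = (coeff (P (s * \<tau>)) j - coeff (P 0) j) * s ^ j / A"
    by (simp add: f_def left_diff_distrib diff_divide_distrib)
  then have "\<bar>f \<tau> j - f 0 j\<bar> = \<bar>coeff (P (s * \<tau>)) j - coeff (P 0) j\<bar> * s ^ j / A"
    using A_pos s by (simp add: abs_mult)
  also have "\<dots> \<le> ((real q * D + M / \<kappa>) * A * \<bar>\<tau>\<bar>) / A"
    using increment[OF assms] A_pos by (intro divide_right_mono) auto
  finally show ?thesis
    using A_pos by simp
qed

end

lemma small_step:
  fixes E \<eta> :: real
  assumes "0 \<le> E" "0 < \<eta>"
  obtains \<epsilon> where "0 < \<epsilon>" "\<epsilon> \<le> 1" "E * \<epsilon> \<le> \<eta> / 2"
proof -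
  define \<epsilon> where "\<epsilon> = min 1 (\<eta> / (2 * (E + 1)))"
  have \<epsilon>: "0 < \<epsilon>" "\<epsilon> \<le> 1" using assms by (auto simp: \<epsilon>_def)
  have "E * \<epsilon> \<le> (E + 1) * (\<eta> / (2 * (E + 1)))"
    using assms \<epsilon> by (intro mult_mono) (auto simp: \<epsilon>_def)
  also have "\<dots> = \<eta> / 2" using assms by (simp add: field_simps)
  finally show ?thesis using that \<epsilon> by blast
qed

text \<open>Suppose that the coefficients of positive index are under control and that one of index \<open>j \<ge> 3\<close> has a
  share of the scale. For small \<open>\<tau>\<close> that coefficient stays away from \<open>0\<close>, so real-rootedness bounds the
  constant coefficient on a whole interval of \<open>\<tau>\<close>, and a bounded function has bounded Taylor
  coefficients.\<close>

lemma constant_coeff_bound_of_cubic_share: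
  fixes q n :: nat and M \<kappa> D \<eta> :: real
  assumes "0 < q" "0 < \<eta>" "0 \<le> D" "0 < \<kappa>" "0 \<le> M"
  shows "\<exists>C>0. \<forall>P c s j. scaled_family q n M \<kappa> P c s \<longrightarrow>
    (\<forall>i\<in>{1..n}. \<forall>k<q. \<bar>c i k\<bar> * s ^ (i + k) \<le> D * root_scale (P 0) s) \<longrightarrow>
    3 \<le> j \<longrightarrow> j \<le> n \<longrightarrow> \<eta> * root_scale (P 0) s \<le> \<bar>coeff (P 0) j\<bar> * s ^ j \<longrightarrow>
    (\<forall>k<q. \<bar>c 0 k\<bar> * s ^ k \<le> C * root_scale (P 0) s)"
proof -
  define E where "E = real q * D + M / \<kappa>"
  have E: "0 \<le> E" using assms by (simp add: E_def)
  obtain \<epsilon> where \<epsilon>: "0 < \<epsilon>" "\<epsilon> \<le> 1" and E\<epsilon>: "E * \<epsilon> \<le> \<eta> / 2"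
    using small_step[OF E assms(2)] by blast
  define B0 where "B0 = max 1 (4 ^ n * (3 * (1 + E)\<^sup>2) ^ n / (\<eta> / 2)\<^sup>2)"
  obtain C where C: "0 < C" "\<And>c B. (\<forall>\<tau>. \<bar>\<tau>\<bar> \<le> \<epsilon> \<longrightarrow> \<bar>\<Sum>k<q. c k * \<tau> ^ k\<bar> \<le> B) \<Longrightarrow> (\<forall>k<q. \<bar>c k\<bar> \<le> C * B)"
    using poly_bound_imp_coeff_bound[OF \<epsilon>(1), of q] by blast
  have "\<forall>k<q. \<bar>c 0 k\<bar> * s ^ k \<le> C * (B0 + M / \<kappa>) * root_scale (P 0) s"
    if fam: "scaled_family q n M \<kappa> P c s"
      and D: "\<forall>i\<in>{1..n}. \<forall>k<q. \<bar>c i k\<bar> * s ^ (i + k) \<le> D * root_scale (P 0) s"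
      and j: "3 \<le> j" "j \<le> n" and big: "\<eta> * root_scale (P 0) s \<le> \<bar>coeff (P 0) j\<bar> * s ^ j"
    for P c s j
  proof -
    interpret scaled_family q n M \<kappa> P c s by fact
    have inc: "\<bar>f \<tau> i - f 0 i\<bar> \<le> E * \<bar>\<tau>\<bar>" if "\<bar>\<tau>\<bar> \<le> 1" "i \<in> {1..n}" for \<tau> i
      unfolding E_def using that D assms by (intro f_increment) auto
    have fj: "\<eta> \<le> \<bar>f 0 j\<bar>"
      using big A_pos s by (simp add: f_def abs_mult field_simps)
    have f0: "\<bar>f \<tau> 0\<bar> \<le> B0" if \<tau>: "\<bar>\<tau>\<bar> \<le> \<epsilon>" for \<tau>
      unfolding B0_def
    proof (rule newton_bounds_constant_coeff[of _ j])
      have \<tau>1: "\<bar>\<tau>\<bar> \<le> 1" using \<tau> \<epsilon> by simp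
      show "(f \<tau> j)\<^sup>2 * ((f \<tau> 0)\<^sup>2) ^ (j - 1) \<le> 4 ^ n * ((f \<tau> 1)\<^sup>2 - 2 * f \<tau> 0 * f \<tau> 2) ^ j"
        using f_newton(2)[OF \<tau>1] j by simp
      show "0 \<le> (f \<tau> 1)\<^sup>2 - 2 * f \<tau> 0 * f \<tau> 2"
        using f_newton(1)[OF \<tau>1] .
      have "E * \<bar>\<tau>\<bar> \<le> E * 1" using E \<tau>1 by (intro mult_left_mono) auto
      then have "\<bar>f \<tau> i\<bar> \<le> 1 + E" if "i \<in> {1..n}" for i
        using inc[OF \<tau>1 that] f_base[of i] by linarith
      then show "\<bar>f \<tau> 1\<bar> \<le> 1 + E" "\<bar>f \<tau> 2\<bar> \<le> 1 + E"
        using j by auto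
      have "E * \<bar>\<tau>\<bar> \<le> \<eta> / 2"
        using E \<tau> mult_left_mono[OF \<tau> E] E\<epsilon> by linarith
      then show "\<eta> / 2 \<le> \<bar>f \<tau> j\<bar>"
        using inc[OF \<tau>1, of j] j fj by auto
    qed (use j assms E in auto)
    have "\<bar>\<Sum>k<q. c 0 k * s ^ k * \<tau> ^ k\<bar> \<le> (B0 + M / \<kappa>) * A" if \<tau>: "\<bar>\<tau>\<bar> \<le> \<epsilon>" for \<tau>
    proof -
      have \<tau>1: "\<bar>\<tau>\<bar> \<le> 1" using \<tau> \<epsilon> by simp
      have "\<bar>coeff (P (s * \<tau>)) 0\<bar> \<le> B0 * A"
        using f0[OF \<tau>] A_pos by (simp add: f_def field_simps)
      moreover have "\<bar>coeff (P (s * \<tau>)) 0 - (\<Sum>k<q. c 0 k * s ^ k * \<tau> ^ k)\<bar> \<le> M / \<kappa> * A * \<bar>\<tau>\<bar>"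
        using remainder[OF _ \<tau>1, of 0] by simp
      moreover have "M / \<kappa> * A * \<bar>\<tau>\<bar> \<le> M / \<kappa> * A * 1"
        using assms A_pos \<tau>1 by (intro mult_left_mono) auto
      ultimately show ?thesis
        unfolding distrib_right by linarith
    qed
    then have "\<forall>k<q. \<bar>c 0 k * s ^ k\<bar> \<le> C * ((B0 + M / \<kappa>) * A)"
      by (intro C(2)) blast
    then show ?thesis
      using s by (simp add: abs_mult mult.assoc)
  qed
  moreover have "0 < C * (B0 + M / \<kappa>)"
    using C(1) assms by (auto simp: B0_def intro!: mult_pos_pos add_pos_nonneg)
  ultimately show ?thesis by blast
qed

text \<open>If the coefficient of index \<open>2\<close> has a share, real-rootedness gives only the one-sided bound
  \<open>2 f\<^sub>0 f\<^sub>2 \<le> f\<^sub>1\<^sup>2\<close>. It holds on both sides of \<open>\<tau> = 0\<close>, however, and therefore bounds the slope of \<open>f\<^sub>0\<close> at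
  \<open>0\<close> as soon as the higher Taylor coefficients of \<open>f\<^sub>0\<close> are controlled. For \<open>Z\<^sup>2 - D(\<tau>)\<close> this is Glaeser's
  inequality for the nonnegative function \<open>D\<close>.\<close>

lemma linear_coeff_bound_of_quadratic_share:
  fixes q n :: nat and M \<kappa> D \<eta> :: real
  assumes "2 \<le> q" "q \<le> n" "0 < \<eta>" "0 \<le> D" "0 < \<kappa>" "0 \<le> M"
  shows "\<exists>C>0. \<forall>P c s. scaled_family q n M \<kappa> P c s \<longrightarrow>
    (\<forall>i\<in>{1..n}. \<forall>k<q. \<bar>c i k\<bar> * s ^ (i + k) \<le> D * root_scale (P 0) s) \<longrightarrow>
    (\<forall>k\<in>{2..<q}. \<bar>c 0 k\<bar> * s ^ k \<le> D * root_scale (P 0) s) \<longrightarrow>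
    \<eta> * root_scale (P 0) s \<le> \<bar>coeff (P 0) 2\<bar> * s\<^sup>2 \<longrightarrow>
    \<bar>c 0 1\<bar> * s \<le> C * root_scale (P 0) s"
proof -
  define E where "E = real q * D + M / \<kappa>"
  have E: "0 \<le> E" using assms by (simp add: E_def)
  obtain \<epsilon> where \<epsilon>: "0 < \<epsilon>" "\<epsilon> \<le> 1" and E\<epsilon>: "E * \<epsilon> \<le> \<eta> / 2"
    using small_step[OF E assms(3)] by blast
  define C where "C = ((1 + E)\<^sup>2 / \<eta> + 1 + E) / \<epsilon>"
  have "\<bar>c 0 1\<bar> * s \<le> C * root_scale (P 0) s"
    if fam: "scaled_family q n M \<kappa> P c s"
      and D: "\<forall>i\<in>{1..n}. \<forall>k<q. \<bar>c i k\<bar> * s ^ (i + k) \<le> D * root_scale (P 0) s"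
      and D0: "\<forall>k\<in>{2..<q}. \<bar>c 0 k\<bar> * s ^ k \<le> D * root_scale (P 0) s"
      and big: "\<eta> * root_scale (P 0) s \<le> \<bar>coeff (P 0) 2\<bar> * s\<^sup>2"
    for P c s
  proof -
    interpret scaled_family q n M \<kappa> P c s by fact
    have inc: "\<bar>f \<tau> i - f 0 i\<bar> \<le> E * \<bar>\<tau>\<bar>" if "\<bar>\<tau>\<bar> \<le> 1" "i \<in> {1..n}" for \<tau> i
      unfolding E_def using that D assms by (intro f_increment) auto
    have f2: "\<eta> \<le> \<bar>f 0 2\<bar>"
      using big A_pos s by (simp add: f_def abs_mult field_simps)
    \<comment> \<open>The sign of \<open>f\<^sub>2\<close> decides on which side \<open>f\<^sub>0\<close> is bounded.\<close>
    define \<sigma> where "\<sigma> = sgn (f 0 2)"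
    have \<sigma>: "\<bar>\<sigma>\<bar> = 1"
      using f2 assms by (auto simp: \<sigma>_def abs_sgn_eq)
    have one_sided: "\<sigma> * f \<tau> 0 \<le> (1 + E)\<^sup>2 / \<eta>" if \<tau>: "\<bar>\<tau>\<bar> \<le> \<epsilon>" for \<tau>
    proof -
      have \<tau>1: "\<bar>\<tau>\<bar> \<le> 1" using \<tau> \<epsilon> by simp
      have "E * \<bar>\<tau>\<bar> \<le> \<eta> / 2"
        using E \<tau> mult_left_mono[OF \<tau> E] E\<epsilon> by linarith
      then have close: "f \<tau> 2 - f 0 2 \<le> \<eta> / 2" "f 0 2 - f \<tau> 2 \<le> \<eta> / 2"
        using inc[OF \<tau>1, of 2] assms by auto
      have lower: "\<eta> / 2 \<le> \<sigma> * f \<tau> 2"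
        using close f2 assms(3) by (auto simp: \<sigma>_def sgn_if split: if_splits)
      have "E * \<bar>\<tau>\<bar> \<le> E * 1" using E \<tau>1 by (intro mult_left_mono) auto
      then have "\<bar>f \<tau> 1\<bar> \<le> 1 + E"
        using inc[OF \<tau>1, of 1] f_base[of 1] assms by auto
      then have "(f \<tau> 1)\<^sup>2 \<le> (1 + E)\<^sup>2"
        using E by (simp add: abs_le_square_iff[symmetric])
      moreover have "\<sigma> * \<sigma> = 1"
        using \<sigma> by (metis abs_mult_self_eq mult_1)
      then have "2 * f \<tau> 0 * f \<tau> 2 = 2 * ((\<sigma> * f \<tau> 0) * (\<sigma> * f \<tau> 2))"
        by (metis (no_types, opaque_lifting) mult.assoc mult.commute mult_1)
      ultimately have prod: "2 * ((\<sigma> * f \<tau> 0) * (\<sigma> * f \<tau> 2)) \<le> (1 + E)\<^sup>2"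
        using f_newton(1)[OF \<tau>1] by linarith
      show ?thesis
      proof (cases "\<sigma> * f \<tau> 0 \<le> 0")
        case True
        then show ?thesis using assms by (smt (verit) divide_nonneg_pos zero_le_power2)
      next
        case False
        then have "2 * ((\<sigma> * f \<tau> 0) * (\<eta> / 2)) \<le> 2 * ((\<sigma> * f \<tau> 0) * (\<sigma> * f \<tau> 2))"
          using lower by (intro mult_left_mono) auto
        then show ?thesis
          using prod assms by (simp add: field_simps)
      qed
    qed
    have slope: "\<sigma> * (c 0 1 * s * \<tau>) \<le> ((1 + E)\<^sup>2 / \<eta> + 1 + E) * A" if \<tau>: "\<bar>\<tau>\<bar> \<le> \<epsilon>" for \<tau>
    proof -
      have \<tau>1: "\<bar>\<tau>\<bar> \<le> 1" using \<tau> \<epsilon> by simp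
      have "{..<q} = insert 0 (insert 1 {2..<q})" using assms(1) by auto
      then have split: "(\<Sum>k<q. c 0 k * s ^ k * \<tau> ^ k) =
          coeff (P 0) 0 + (c 0 1 * s * \<tau> + (\<Sum>k\<in>{2..<q}. c 0 k * s ^ k * \<tau> ^ k))"
        using taylor_family_base[OF fam q(1), of 0] by simp
      have "\<bar>\<Sum>k\<in>{2..<q}. c 0 k * s ^ k * \<tau> ^ k\<bar> \<le> (\<Sum>k\<in>{2..<q}. D * A)"
      proof (intro order.trans[OF sum_abs] sum_mono)
        fix k assume k: "k \<in> {2..<q}"
        have "\<bar>c 0 k * s ^ k * \<tau> ^ k\<bar> = \<bar>c 0 k\<bar> * s ^ k * \<bar>\<tau>\<bar> ^ k"
          using s by (simp add: abs_mult power_abs)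
        also have "\<dots> \<le> D * A * 1"
          using D0 k s \<tau>1 assms A_pos by (intro mult_mono[of _ "D * A"] power_le_one) auto
        finally show "\<bar>c 0 k * s ^ k * \<tau> ^ k\<bar> \<le> D * A" by simp
      qed
      also have "\<dots> \<le> real q * (D * A)"
        using assms A_pos by (simp add: mult_right_mono)
      finally have tail: "\<bar>\<Sum>k\<in>{2..<q}. c 0 k * s ^ k * \<tau> ^ k\<bar> \<le> real q * D * A" by simp
      have "M / \<kappa> * A * \<bar>\<tau>\<bar> \<le> M / \<kappa> * A * 1"
        using assms A_pos \<tau>1 by (intro mult_left_mono) auto
      then have rem: "\<bar>coeff (P (s * \<tau>)) 0 - (\<Sum>k<q. c 0 k * s ^ k * \<tau> ^ k)\<bar> \<le> M / \<kappa> * A"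
        using remainder[OF _ \<tau>1, of 0] by simp
      have "\<sigma> * coeff (P (s * \<tau>)) 0 \<le> (1 + E)\<^sup>2 / \<eta> * A"
        using one_sided[OF \<tau>] A_pos by (simp add: f_def field_simps)
      moreover have "\<bar>coeff (P 0) 0\<bar> \<le> A"
        using coeff_le_root_scale[OF s(1), of "P 0" 0] by simp
      ultimately have "\<sigma> * (c 0 1 * s * \<tau>) \<le> (1 + E)\<^sup>2 / \<eta> * A + A + (real q * D * A + M / \<kappa> * A)"
      proof -
        have r: "c 0 1 * s * \<tau> = coeff (P (s * \<tau>)) 0 - coeff (P 0) 0
          - (\<Sum>k\<in>{2..<q}. c 0 k * s ^ k * \<tau> ^ k)
          - (coeff (P (s * \<tau>)) 0 - (\<Sum>k<q. c 0 k * s ^ k * \<tau> ^ k))"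
          unfolding split by simp
        have le: "\<sigma> * x \<le> \<bar>x\<bar>" "- (\<sigma> * x) \<le> \<bar>x\<bar>" for x
          using \<sigma> abs_mult[of \<sigma> x] by auto
        show ?thesis
          unfolding r right_diff_distrib[of \<sigma>]
          using le[of "coeff (P 0) 0"] le[of "\<Sum>k\<in>{2..<q}. c 0 k * s ^ k * \<tau> ^ k"]
            le[of "coeff (P (s * \<tau>)) 0 - (\<Sum>k<q. c 0 k * s ^ k * \<tau> ^ k)"] tail rem
            \<open>\<sigma> * coeff (P (s * \<tau>)) 0 \<le> (1 + E)\<^sup>2 / \<eta> * A\<close> \<open>\<bar>coeff (P 0) 0\<bar> \<le> A\<close>
          unfolding right_diff_distrib[of \<sigma>] by linarith
      qed
      then show ?thesis
        unfolding E_def by (simp add: algebra_simps)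
    qed
    have "\<bar>c 0 1\<bar> * s * \<epsilon> = \<bar>\<sigma> * (c 0 1 * s * \<epsilon>)\<bar>"
      using \<sigma> s \<epsilon> by (simp add: abs_mult)
    also have "\<dots> \<le> ((1 + E)\<^sup>2 / \<eta> + 1 + E) * A"
      using slope[of \<epsilon>] slope[of "- \<epsilon>"] \<epsilon> by auto
    finally show ?thesis
      using \<epsilon> by (simp add: C_def field_simps)
  qed
  moreover have "0 < C"
    unfolding C_def using \<epsilon> E assms by (intro divide_pos_pos add_nonneg_pos add_pos_nonneg) auto
  ultimately show ?thesis by blast
qed

section \<open>Bounds for the Taylor coefficients at all scales\<close>

lemma dominating_root_scale:
  fixes \<kappa> M :: real
  assumes "0 < \<kappa>" "\<kappa> \<le> M" "m < q" "q \<le> n"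
  shows "\<exists>\<eta>>0. \<forall>P c s. scaled_family q n M \<kappa> P c s \<longrightarrow>
    (\<exists>r\<ge>s. scaled_family q n M \<kappa> P c r \<and>
       (\<exists>j>m. j \<le> n \<and> \<eta> * root_scale (P 0) r \<le> \<bar>coeff (P 0) j\<bar> * r ^ j) \<and>
       root_scale (P 0) r \<le> 2 * (r / s) ^ m * root_scale (P 0) s)"
proof -
  obtain \<eta> where \<eta>: "\<eta> > 0" and
    dom: "\<And>b s. (\<forall>i. 0 \<le> b i \<and> b i \<le> M) \<Longrightarrow> \<kappa> \<le> b q \<Longrightarrow> 0 < s \<Longrightarrow> s \<le> 1 \<Longrightarrow>
    (\<exists>r\<ge>s. r \<le> 1 \<and> (\<exists>j>m. j \<le> n \<and> \<eta> * (\<Sum>i\<le>n. b i * r ^ i) \<le> b j * r ^ j) \<and>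
       (\<Sum>i\<le>n. b i * r ^ i) \<le> 2 * (r / s) ^ m * (\<Sum>i\<le>n. b i * s ^ i))"
    using dominating_scale[OF assms] by blast
  have "\<exists>r\<ge>s. scaled_family q n M \<kappa> P c r \<and>
       (\<exists>j>m. j \<le> n \<and> \<eta> * root_scale (P 0) r \<le> \<bar>coeff (P 0) j\<bar> * r ^ j) \<and>
       root_scale (P 0) r \<le> 2 * (r / s) ^ m * root_scale (P 0) s"
    if "scaled_family q n M \<kappa> P c s" for P c s
  proof -
    interpret scaled_family q n M \<kappa> P c s by fact
    have deg: "degree (P 0) = n" using degree_P by simp
    have "0 \<le> \<bar>coeff (P 0) i\<bar> \<and> \<bar>coeff (P 0) i\<bar> \<le> M" for i
    proof (cases "i \<le> n")
      case True
      then show ?thesis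
        using fam q taylor_family_base[OF fam q(1) True] unfolding taylor_family_def by (metis abs_ge_zero)
    next
      case False
      then show ?thesis using deg M_nonneg by (simp add: coeff_eq_0)
    qed
    then obtain r where r: "s \<le> r" "r \<le> 1"
       "\<exists>j>m. j \<le> n \<and> \<eta> * root_scale (P 0) r \<le> \<bar>coeff (P 0) j\<bar> * r ^ j"
       "root_scale (P 0) r \<le> 2 * (r / s) ^ m * root_scale (P 0) s"
      using dom[of "\<lambda>i. \<bar>coeff (P 0) i\<bar>" s] \<kappa> s unfolding root_scale_def deg by auto
    have "scaled_family q n M \<kappa> P c r"
      using fam q \<kappa> s r by unfold_locales auto
    then show ?thesis using r by blast
  qed
  then show ?thesis using \<eta> by blast
qed

text \<open>The scale may be enlarged at the price of the factor \<open>(r / s)\<^sup>m\<close> when the coefficient of order \<open>k \<ge> m\<close>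
  is estimated: the gain \<open>(s / r)\<^sup>k\<close> makes up for it.\<close>

lemma scale_transfer:
  fixes r s C :: real
  assumes "0 < s" "s \<le> r" "m \<le> k" "0 \<le> C" "x * r ^ k \<le> C * a" "a \<le> 2 * (r / s) ^ m * b" "0 \<le> x"
  shows "x * s ^ k \<le> 2 * C * b"
proof -
  have r: "0 < r" using assms by simp
  have "s ^ k = r ^ k * (s / r) ^ k"
    using r by (simp add: power_divide)
  also have "\<dots> \<le> r ^ k * (s / r) ^ m"
    using assms r by (intro mult_left_mono power_decreasing) auto
  finally have "x * s ^ k \<le> (x * r ^ k) * (s / r) ^ m"
    using assms(7) mult_left_mono[of "s ^ k" "r ^ k * (s / r) ^ m" x] by (simp add: mult.assoc)
  also have "\<dots> \<le> (C * (2 * (r / s) ^ m * b)) * (s / r) ^ m"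
    using assms r by (intro mult_right_mono order.trans[OF assms(5)] mult_left_mono) auto
  also have "\<dots> = 2 * C * b"
    using assms r by (simp add: power_divide)
  finally show ?thesis .
qed

text \<open>The derivative in \<open>Z\<close> is again such a family, of degree and order one less; the expansions lose one
  order because the lower bound \<open>\<kappa>\<close> now sits at index \<open>q\<close>.\<close>

lemma scaled_family_pderiv:
  assumes "scaled_family (Suc q) n M \<kappa> P c s" "0 < q"
  shows "scaled_family q (n - 1) (2 * real n * M) \<kappa> (\<lambda>\<tau>. pderiv (P \<tau>)) (\<lambda>j k. real (Suc j) * c (Suc j) k) s"
    and "root_scale (pderiv (P 0)) s * s \<le> real n * root_scale (P 0) s"
proof -
  interpret scaled_family "Suc q" n M \<kappa> P c s by fact
  have n: "n = Suc (n - 1)" using q by simp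
  have M: "0 \<le> M" by (rule M_nonneg)
  have c: "\<bar>c j k\<bar> \<le> M" if "j \<le> n" "k < Suc q" for j k
    using fam that by (auto simp: taylor_family_def)
  have main: "\<bar>coeff (pderiv (P \<tau>)) j - (\<Sum>k<q. real (Suc j) * c (Suc j) k * \<tau> ^ k)\<bar> \<le>
      2 * real n * M * \<bar>\<tau>\<bar> ^ q" if j: "j \<le> n - 1" and \<tau>: "\<bar>\<tau>\<bar> \<le> 1" for j \<tau>
  proof -
    have j': "Suc j \<le> n" using j n by simp
    have 1: "\<bar>coeff (P \<tau>) (Suc j) - (\<Sum>k<Suc q. c (Suc j) k * \<tau> ^ k)\<bar> \<le> M * \<bar>\<tau>\<bar> ^ Suc q"
      using fam j' \<tau> unfolding taylor_family_def by blast
    have 2: "M * \<bar>\<tau>\<bar> ^ Suc q \<le> M * \<bar>\<tau>\<bar> ^ q"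
      using \<tau> M by (intro mult_left_mono power_decreasing) auto
    have 3: "\<bar>c (Suc j) q * \<tau> ^ q\<bar> \<le> M * \<bar>\<tau>\<bar> ^ q"
      using c[OF j', of q] by (simp add: abs_mult power_abs mult_right_mono)
    have "coeff (pderiv (P \<tau>)) j - (\<Sum>k<q. real (Suc j) * c (Suc j) k * \<tau> ^ k) =
        real (Suc j) * (coeff (P \<tau>) (Suc j) - (\<Sum>k<q. c (Suc j) k * \<tau> ^ k))"
      by (simp add: coeff_pderiv right_diff_distrib sum_distrib_left mult.assoc del: of_nat_Suc)
    then have "\<bar>coeff (pderiv (P \<tau>)) j - (\<Sum>k<q. real (Suc j) * c (Suc j) k * \<tau> ^ k)\<bar> =
        real (Suc j) * \<bar>coeff (P \<tau>) (Suc j) - (\<Sum>k<q. c (Suc j) k * \<tau> ^ k)\<bar>"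
      by (simp add: abs_mult del: of_nat_Suc)
    also have "\<dots> \<le> real n * (2 * (M * \<bar>\<tau>\<bar> ^ q))"
    proof (intro mult_mono)
      show "\<bar>coeff (P \<tau>) (Suc j) - (\<Sum>k<q. c (Suc j) k * \<tau> ^ k)\<bar> \<le> 2 * (M * \<bar>\<tau>\<bar> ^ q)"
        using 1 2 3 unfolding sum.lessThan_Suc by linarith
    qed (use j' in auto)
    finally show ?thesis by simp
  qed
  have bd: "\<bar>real (Suc j) * c (Suc j) k\<bar> \<le> 2 * real n * M" if "j \<le> n - 1" "k < q" for j k
  proof -
    have "real (Suc j) * \<bar>c (Suc j) k\<bar> \<le> real n * M"
      using that n c[of "Suc j" k] by (intro mult_mono) auto
    also have "\<dots> \<le> 2 * real n * M" using M by simp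
    finally show ?thesis by (simp add: abs_mult del: of_nat_Suc)
  qed
  have "taylor_family q (n - 1) (2 * real n * M) (\<lambda>\<tau>. pderiv (P \<tau>)) (\<lambda>j k. real (Suc j) * c (Suc j) k)"
    unfolding taylor_family_def
    using main bd degree_P real_rooted_P n by (auto simp: degree_pderiv intro!: real_rooted_pderiv)
  moreover have "\<kappa> \<le> \<bar>coeff (pderiv (P 0)) q\<bar>"
  proof -
    have "1 * \<bar>coeff (P 0) (Suc q)\<bar> \<le> real (Suc q) * \<bar>coeff (P 0) (Suc q)\<bar>"
      by (intro mult_right_mono) auto
    then show ?thesis
      using \<kappa> by (simp add: coeff_pderiv abs_mult del: of_nat_Suc)
  qed
  ultimately show "scaled_family q (n - 1) (2 * real n * M) \<kappa> (\<lambda>\<tau>. pderiv (P \<tau>))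
      (\<lambda>j k. real (Suc j) * c (Suc j) k) s"
    using q \<kappa> s assms(2) by unfold_locales auto
  have "root_scale (pderiv (P 0)) s * s = (\<Sum>i\<le>n - 1. real (Suc i) * (\<bar>coeff (P 0) (Suc i)\<bar> * s ^ Suc i))"
    using degree_P[of 0] unfolding root_scale_def sum_distrib_right
    by (intro sum.cong) (auto simp: degree_pderiv coeff_pderiv abs_mult simp del: of_nat_Suc)
  also have "\<dots> \<le> (\<Sum>i\<le>n - 1. real n * (\<bar>coeff (P 0) (Suc i)\<bar> * s ^ Suc i))"
    using n s by (intro sum_mono mult_right_mono) auto
  also have "\<dots> = real n * (\<Sum>i\<le>n - 1. \<bar>coeff (P 0) (Suc i)\<bar> * s ^ Suc i)"
    by (simp add: sum_distrib_left)
  also have "(\<Sum>i\<le>n - 1. \<bar>coeff (P 0) (Suc i)\<bar> * s ^ Suc i) \<le> root_scale (P 0) s"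
  proof -
    have "root_scale (P 0) s = (\<Sum>i\<le>Suc (n - 1). \<bar>coeff (P 0) i\<bar> * s ^ i)"
      unfolding root_scale_def using n degree_P[of 0] by simp
    then show ?thesis
      unfolding sum.atMost_Suc_shift by simp
  qed
  finally show "root_scale (pderiv (P 0)) s * s \<le> real n * root_scale (P 0) s"
    by (simp add: mult_left_mono)
qed

text \<open>The main estimate: at every scale \<open>s\<close> the coefficients of the rescaled family are bounded at \<open>\<tau> = 0\<close>
  together with all their derivatives, uniformly in \<open>s\<close> and in the family. For \<open>j \<ge> 1\<close> this is the
  induction hypothesis for the derivative. For the constant coefficient, the estimate is obtained at a
  larger scale, at which a coefficient of index at least \<open>3\<close> (for \<open>k \<ge> 2\<close>) or at least \<open>2\<close> (for \<open>k = 1\<close>)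
  has a share, and transferred back; the growth of the scale in between is quadratic or linear, which
  the transfer can absorb for just these \<open>k\<close>.\<close>

lemma taylor_coeff_bound:
  fixes \<kappa> M :: real
  assumes "1 \<le> q" "q \<le> n" "0 < \<kappa>" "\<kappa> \<le> M"
  shows "\<exists>C>0. \<forall>P c s. scaled_family q n M \<kappa> P c s \<longrightarrow>
    (\<forall>j\<le>n. \<forall>k<q. \<bar>c j k\<bar> * s ^ (j + k) \<le> C * root_scale (P 0) s)"
  using assms
proof (induction q arbitrary: n M rule: nat_induct_at_least)
  case base
  have "\<bar>c j k\<bar> * s ^ (j + k) \<le> 1 * root_scale (P 0) s"
    if "scaled_family 1 n M \<kappa> P c s" "j \<le> n" "k < 1" for P c s j k
  proof -
    interpret scaled_family 1 n M \<kappa> P c s by fact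
    show ?thesis
      using taylor_family_base[OF fam q(1) that(2)] coeff_le_root_scale[OF s(1), of "P 0" j] that by simp
  qed
  then show ?case by (intro exI[of _ 1]) auto
next
  case (Suc q)
  let ?q = "Suc q"
  have M: "0 \<le> M" using Suc.prems by simp
  obtain C1 where C1: "0 < C1" and deriv: "\<And>P c s. scaled_family q (n - 1) (2 * real n * M) \<kappa> P c s \<Longrightarrow>
    (\<forall>j\<le>n - 1. \<forall>k<q. \<bar>c j k\<bar> * s ^ (j + k) \<le> C1 * root_scale (P 0) s)"
  proof -
    have "1 * M \<le> (2 * real n) * M"
      using Suc.prems M by (intro mult_right_mono) auto
    then have "\<kappa> \<le> 2 * real n * M" using Suc.prems(3) by linarith
    moreover have "q \<le> n - 1" using Suc.prems(1) by linarith
    ultimately show ?thesis using Suc.IH[of "n - 1" "2 * real n * M"] Suc.prems(2) that by blast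
  qed
  define D where "D = C1 * real n + M / \<kappa>"
  have D: "0 \<le> D" using C1 M Suc.prems by (simp add: D_def)
  \<comment> \<open>Coefficients of positive index: the derivative, and for \<open>k = q\<close> the lower bound of the scale.\<close>
  have high: "\<bar>c i k\<bar> * s ^ (i + k) \<le> D * root_scale (P 0) s"
    if sf: "scaled_family ?q n M \<kappa> P c s" and i: "i \<in> {1..n}" and k: "k < ?q" for P c s i k
  proof -
    interpret scaled_family ?q n M \<kappa> P c s by fact
    obtain j where j: "i = Suc j" "j \<le> n - 1" using i by (cases i) auto
    show ?thesis
    proof (cases "k < q")
      case True
      have "1 * (\<bar>c i k\<bar> * s ^ (i + k)) \<le> real (Suc j) * (\<bar>c i k\<bar> * s ^ (i + k))"
        using s by (intro mult_right_mono) auto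
      also have "\<dots> = \<bar>real (Suc j) * c (Suc j) k\<bar> * s ^ (j + k) * s"
        using j by (simp add: abs_mult del: of_nat_Suc)
      also have "\<dots> \<le> C1 * root_scale (pderiv (P 0)) s * s"
        using deriv[OF scaled_family_pderiv(1)[OF sf]] Suc.hyps j True s
        by (intro mult_right_mono) auto
      also have "\<dots> \<le> C1 * (real n * A)"
        using scaled_family_pderiv(2)[OF sf] Suc.hyps C1 by (simp add: mult.assoc)
      also have "\<dots> \<le> D * A"
        using A_pos M \<kappa> by (simp add: D_def distrib_right)
      finally show ?thesis by simp
    next
      case False
      have "\<bar>c i k\<bar> * s ^ (i + k) \<le> M * s ^ ?q"
      proof (intro mult_mono power_decreasing)
        show "\<bar>c i k\<bar> \<le> M" using sf i k by (auto simp: scaled_family_def taylor_family_def)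
        show "?q \<le> i + k" using i False by simp
      qed (use s M in auto)
      also have "\<dots> = M / \<kappa> * (\<kappa> * s ^ ?q)" using \<kappa> by simp
      also have "\<dots> \<le> M / \<kappa> * A"
        using A_lower M \<kappa> by (intro mult_left_mono) auto
      also have "\<dots> \<le> D * A"
        using A_pos C1 by (simp add: D_def distrib_right)
      finally show ?thesis .
    qed
  qed
  \<comment> \<open>Constant coefficient, order at least two: go up to a scale with a cubic share.\<close>
  obtain D2 where D2: "0 \<le> D2" and quad: "\<And>P c s k. scaled_family ?q n M \<kappa> P c s \<Longrightarrow> k \<in> {2..<?q} \<Longrightarrow>
      \<bar>c 0 k\<bar> * s ^ k \<le> D2 * root_scale (P 0) s"
  proof (cases "2 < ?q")
    case True
    obtain \<eta> where \<eta>: "0 < \<eta>" and dom: "\<And>P c s. scaled_family ?q n M \<kappa> P c s \<Longrightarrow>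
      (\<exists>r\<ge>s. scaled_family ?q n M \<kappa> P c r \<and>
       (\<exists>j>2. j \<le> n \<and> \<eta> * root_scale (P 0) r \<le> \<bar>coeff (P 0) j\<bar> * r ^ j) \<and>
       root_scale (P 0) r \<le> 2 * (r / s) ^ 2 * root_scale (P 0) s)"
      using dominating_root_scale[of \<kappa> M 2 ?q n] True Suc.prems by blast
    obtain C where C: "0 < C" and cubic: "\<And>P c s j. scaled_family ?q n M \<kappa> P c s \<Longrightarrow>
      (\<forall>i\<in>{1..n}. \<forall>k<?q. \<bar>c i k\<bar> * s ^ (i + k) \<le> D * root_scale (P 0) s) \<Longrightarrow>
      3 \<le> j \<Longrightarrow> j \<le> n \<Longrightarrow> \<eta> * root_scale (P 0) s \<le> \<bar>coeff (P 0) j\<bar> * s ^ j \<Longrightarrow>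
      (\<forall>k<?q. \<bar>c 0 k\<bar> * s ^ k \<le> C * root_scale (P 0) s)"
      using constant_coeff_bound_of_cubic_share[of ?q \<eta> D \<kappa> M n] \<eta> D Suc.prems M by blast
    have "\<bar>c 0 k\<bar> * s ^ k \<le> 2 * C * root_scale (P 0) s"
      if fam: "scaled_family ?q n M \<kappa> P c s" and k: "k \<in> {2..<?q}" for P c s k
    proof -
      obtain r j where r: "s \<le> r" "scaled_family ?q n M \<kappa> P c r" "2 < j" "j \<le> n"
        "\<eta> * root_scale (P 0) r \<le> \<bar>coeff (P 0) j\<bar> * r ^ j"
        "root_scale (P 0) r \<le> 2 * (r / s) ^ 2 * root_scale (P 0) s"
        using dom[OF fam] by blast
      have "\<bar>c 0 k\<bar> * r ^ k \<le> C * root_scale (P 0) r"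
        using cubic[OF r(2) _ _ r(4,5)] high[OF r(2)] k r(3) by auto
      then show ?thesis
        using scale_transfer[of s r 2 k C] k r C fam by (simp add: scaled_family_def)
    qed
    then show ?thesis using that[of "2 * C"] C by auto
  next
    case False
    then show ?thesis using that[of 0] by auto
  qed
  \<comment> \<open>Constant coefficient, order one: go up to a scale with at least a quadratic share.\<close>
  obtain \<eta> where \<eta>: "0 < \<eta>" and dom: "\<And>P c s. scaled_family ?q n M \<kappa> P c s \<Longrightarrow>
    (\<exists>r\<ge>s. scaled_family ?q n M \<kappa> P c r \<and>
     (\<exists>j>1. j \<le> n \<and> \<eta> * root_scale (P 0) r \<le> \<bar>coeff (P 0) j\<bar> * r ^ j) \<and>
     root_scale (P 0) r \<le> 2 * (r / s) ^ 1 * root_scale (P 0) s)"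
    using dominating_root_scale[of \<kappa> M 1 ?q n] Suc.prems Suc.hyps by (metis less_Suc_eq_le)
  obtain C3 where C3: "0 < C3" and cubic: "\<And>P c s j. scaled_family ?q n M \<kappa> P c s \<Longrightarrow>
    (\<forall>i\<in>{1..n}. \<forall>k<?q. \<bar>c i k\<bar> * s ^ (i + k) \<le> D * root_scale (P 0) s) \<Longrightarrow>
    3 \<le> j \<Longrightarrow> j \<le> n \<Longrightarrow> \<eta> * root_scale (P 0) s \<le> \<bar>coeff (P 0) j\<bar> * s ^ j \<Longrightarrow>
    (\<forall>k<?q. \<bar>c 0 k\<bar> * s ^ k \<le> C3 * root_scale (P 0) s)"
    using constant_coeff_bound_of_cubic_share[of ?q \<eta> D \<kappa> M n] \<eta> D Suc.prems M by blast
  obtain C2 where C2: "0 < C2" and square: "\<And>P c s. scaled_family ?q n M \<kappa> P c s \<Longrightarrow>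
    (\<forall>i\<in>{1..n}. \<forall>k<?q. \<bar>c i k\<bar> * s ^ (i + k) \<le> (D + D2) * root_scale (P 0) s) \<Longrightarrow>
    (\<forall>k\<in>{2..<?q}. \<bar>c 0 k\<bar> * s ^ k \<le> (D + D2) * root_scale (P 0) s) \<Longrightarrow>
    \<eta> * root_scale (P 0) s \<le> \<bar>coeff (P 0) 2\<bar> * s\<^sup>2 \<Longrightarrow>
    \<bar>c 0 1\<bar> * s \<le> C2 * root_scale (P 0) s"
    using linear_coeff_bound_of_quadratic_share[of ?q n \<eta> "D + D2" \<kappa> M] \<eta> D D2 Suc.prems Suc.hyps M by auto
  have linear: "\<bar>c 0 1\<bar> * s \<le> 2 * (C2 + C3) * root_scale (P 0) s"
    if fam: "scaled_family ?q n M \<kappa> P c s" for P c s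
  proof -
    obtain r j where r: "s \<le> r" "scaled_family ?q n M \<kappa> P c r" "1 < j" "j \<le> n"
      "\<eta> * root_scale (P 0) r \<le> \<bar>coeff (P 0) j\<bar> * r ^ j"
      "root_scale (P 0) r \<le> 2 * (r / s) ^ 1 * root_scale (P 0) s"
      using dom[OF fam] by blast
    have A: "0 < root_scale (P 0) r"
      by (rule scaled_family.A_pos[OF r(2)])
    have "\<bar>c 0 1\<bar> * r \<le> (C2 + C3) * root_scale (P 0) r"
    proof (cases "j = 2")
      case True
      have "x \<le> (D + D2) * root_scale (P 0) r"
        if "x \<le> D * root_scale (P 0) r \<or> x \<le> D2 * root_scale (P 0) r" for x
      proof -
        have "0 \<le> D * root_scale (P 0) r" "0 \<le> D2 * root_scale (P 0) r" using D D2 A by auto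
        then show ?thesis unfolding distrib_right using that by linarith
      qed
      then have "\<bar>c 0 1\<bar> * r \<le> C2 * root_scale (P 0) r"
        using r(5) True by (intro square[OF r(2)] ballI allI impI) (use high[OF r(2)] quad[OF r(2)] in auto)
      also have "\<dots> \<le> (C2 + C3) * root_scale (P 0) r"
        using A C3 by (intro mult_right_mono) auto
      finally show ?thesis .
    next
      case False
      have "\<forall>k<?q. \<bar>c 0 k\<bar> * r ^ k \<le> C3 * root_scale (P 0) r"
        using cubic[OF r(2) _ _ r(4,5)] high[OF r(2)] False r(3) by auto
      then have "\<bar>c 0 1\<bar> * r \<le> C3 * root_scale (P 0) r"
        using Suc.hyps by (metis less_Suc_eq_le power_one_right)
      also have "\<dots> \<le> (C2 + C3) * root_scale (P 0) r"
        using A C2 by (intro mult_right_mono) auto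
      finally show ?thesis .
    qed
    then show ?thesis
      using scale_transfer[of s r 1 1 "C2 + C3" "\<bar>c 0 1\<bar>"] r C2 C3 fam by (simp add: scaled_family_def)
  qed
  define C where "C = 1 + D + D2 + 2 * (C2 + C3)"
  have "\<bar>c j k\<bar> * s ^ (j + k) \<le> C * root_scale (P 0) s"
    if sf: "scaled_family ?q n M \<kappa> P c s" and j: "j \<le> n" and k: "k < ?q" for P c s j k
  proof -
    interpret scaled_family ?q n M \<kappa> P c s by fact
    have up: "X * A \<le> C * A" if "X \<le> C" for X
      using that A_pos by (intro mult_right_mono) auto
    consider "j \<in> {1..n}" | "j = 0" "k = 0" | "j = 0" "k = 1" | "j = 0" "k \<in> {2..<?q}"
      using j k by force
    then show ?thesis
    proof cases
      case 1
      then show ?thesis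
        using high[OF sf 1 k] up[of D] D D2 C2 C3 by (simp add: C_def)
    next
      case 2
      then show ?thesis
        using taylor_family_base[of ?q n M P c 0] fam coeff_le_root_scale[OF s(1), of "P 0" 0]
          up[of 1] D D2 C2 C3 by (simp add: C_def scaled_family_def)
    next
      case 3
      then show ?thesis
        using linear[OF sf] up[of "2 * (C2 + C3)"] D D2 by (simp add: C_def)
    next
      case 4
      then show ?thesis
        using quad[OF sf 4(2)] up[of D2] D C2 C3 by (simp add: C_def)
    qed
  qed
  moreover have "0 < C" using D D2 C2 C3 by (simp add: C_def)
  ultimately show ?case by blast
qed

section \<open>Displacement of a continuous root\<close>

text \<open>Multiplying by \<open>Z - x\<close> enlarges the scale at most by the factor \<open>s + \<bar>x\<bar>\<close> and the value at \<open>y\<close> by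
  exactly \<open>\<bar>y - x\<bar>\<close>.\<close>

lemma linear_factors_root_scale_le:
  fixes s y K :: real
  assumes "0 < s" "\<forall>x\<in>set xs. s + \<bar>x\<bar> \<le> K * \<bar>y - x\<bar>"
  shows "(\<Sum>i\<le>N. \<bar>coeff (\<Prod>x\<leftarrow>xs. [:-x, 1:]) i\<bar> * s ^ i) \<le>
    K ^ length xs * \<bar>poly (\<Prod>x\<leftarrow>xs. [:-x, 1:]) y\<bar>"
  using assms(2)
proof (induction xs)
  case Nil
  have "(\<Sum>i\<le>N. \<bar>coeff (1 :: real poly) i\<bar> * s ^ i) = (\<Sum>i\<in>{0}. \<bar>coeff (1 :: real poly) i\<bar> * s ^ i)"
    by (intro sum.mono_neutral_right) (auto simp: coeff_1)
  then show ?case by simp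
next
  case (Cons x xs)
  let ?g = "\<Prod>x\<leftarrow>xs. [:-x, 1:]"
  let ?W = "\<Sum>i\<le>N. \<bar>coeff ?g i\<bar> * s ^ i"
  have IH: "?W \<le> K ^ length xs * \<bar>poly ?g y\<bar>"
    using Cons by simp
  have W0: "0 \<le> ?W" using assms(1) by (intro sum_nonneg) auto
  have each: "\<bar>coeff ([:-x, 1:] * ?g) i\<bar> * s ^ i \<le>
      \<bar>x\<bar> * (\<bar>coeff ?g i\<bar> * s ^ i) + (case i of 0 \<Rightarrow> 0 | Suc k \<Rightarrow> \<bar>coeff ?g k\<bar> * s ^ k * s)" for i
  proof -
    have "\<bar>coeff ([:-x, 1:] * ?g) i\<bar> \<le> \<bar>x\<bar> * \<bar>coeff ?g i\<bar> + \<bar>coeff (pCons 0 ?g) i\<bar>"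
      unfolding abs_mult[symmetric] by simp
    then have "\<bar>coeff ([:-x, 1:] * ?g) i\<bar> * s ^ i \<le> (\<bar>x\<bar> * \<bar>coeff ?g i\<bar> + \<bar>coeff (pCons 0 ?g) i\<bar>) * s ^ i"
      using assms(1) by (intro mult_right_mono) auto
    then show ?thesis
      by (cases i) (auto simp: algebra_simps)
  qed
  have "(\<Sum>i\<le>N. \<bar>coeff ([:-x, 1:] * ?g) i\<bar> * s ^ i) \<le>
      (\<Sum>i\<le>N. \<bar>x\<bar> * (\<bar>coeff ?g i\<bar> * s ^ i) + (case i of 0 \<Rightarrow> 0 | Suc k \<Rightarrow> \<bar>coeff ?g k\<bar> * s ^ k * s))"
    by (intro sum_mono each)
  also have "\<dots> = \<bar>x\<bar> * ?W + (\<Sum>i\<le>N. case i of 0 \<Rightarrow> 0 | Suc k \<Rightarrow> \<bar>coeff ?g k\<bar> * s ^ k * s)"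
    by (simp add: sum.distrib sum_distrib_left)
  also have "(\<Sum>i\<le>N. case i of 0 \<Rightarrow> 0 | Suc k \<Rightarrow> \<bar>coeff ?g k\<bar> * s ^ k * s) \<le> ?W * s"
  proof (cases N)
    case 0
    then show ?thesis using assms(1) by simp
  next
    case (Suc M)
    have "(\<Sum>i\<le>N. case i of 0 \<Rightarrow> 0 | Suc k \<Rightarrow> \<bar>coeff ?g k\<bar> * s ^ k * s) = (\<Sum>k\<le>M. \<bar>coeff ?g k\<bar> * s ^ k) * s"
      unfolding Suc sum.atMost_Suc_shift by (simp add: sum_distrib_right)
    also have "\<dots> \<le> ?W * s"
      unfolding Suc using assms(1) by (intro mult_right_mono) auto
    finally show ?thesis .
  qed
  finally have "(\<Sum>i\<le>N. \<bar>coeff ([:-x, 1:] * ?g) i\<bar> * s ^ i) \<le> (s + \<bar>x\<bar>) * ?W"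
    by (simp add: algebra_simps)
  also have "\<dots> \<le> (K * \<bar>y - x\<bar>) * (K ^ length xs * \<bar>poly ?g y\<bar>)"
    using Cons.prems IH W0 assms(1) by (intro mult_mono) (auto intro: order.trans[of 0 "s + \<bar>x\<bar>"])
  also have "\<dots> = K ^ length (x # xs) * \<bar>poly ([:-x, 1:] * ?g) y\<bar>"
    unfolding poly_mult by (simp add: abs_mult)
  finally show ?case by (simp del: mult_pCons_left)
qed

text \<open>Among the \<open>n + 1\<close> radii \<open>s, 2 s, \<dots>, (n + 1) s\<close> one has distance at least \<open>s / 2\<close> from the absolute values
  of the \<open>n\<close> roots. At that radius the polynomial is as large as its scale.\<close>

lemma spaced_radius:
  fixes s :: real
  assumes p: "real_rooted p" "degree p = n" and s: "0 < s"
  shows "\<exists>\<rho>\<in>{1..Suc n}. \<forall>y. \<bar>y\<bar> = real \<rho> * s \<longrightarrow> root_scale p s \<le> (2 * real n + 5) ^ n * \<bar>poly p y\<bar>"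
proof -
  obtain a xs where a: "a \<noteq> 0" "length xs = n" "p = smult a (\<Prod>x\<leftarrow>xs. [:-x, 1:])"
    using real_rooted_factorization[OF p(1)] p(2) by auto
  have "\<exists>\<rho>\<in>{1..Suc n}. \<forall>x\<in>set xs. s / 2 \<le> \<bar>real \<rho> * s - \<bar>x\<bar>\<bar>"
  proof (rule ccontr)
    assume "\<not> ?thesis"
    then have "\<forall>\<rho>\<in>{1..Suc n}. \<exists>x\<in>set xs. \<bar>real \<rho> * s - \<bar>x\<bar>\<bar> < s / 2"
      by (meson not_le)
    then obtain g where g: "\<And>\<rho>. \<rho> \<in> {1..Suc n} \<Longrightarrow> g \<rho> \<in> set xs \<and> \<bar>real \<rho> * s - \<bar>g \<rho>\<bar>\<bar> < s / 2"
      by metis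
    have "inj_on g {1..Suc n}"
    proof (rule inj_onI)
      fix u v assume uv: "u \<in> {1..Suc n}" "v \<in> {1..Suc n}" "g u = g v"
      have "\<bar>real u * s - real v * s\<bar> < s"
        using conjunct2[OF g[OF uv(1)]] conjunct2[OF g[OF uv(2)]] unfolding uv(3) abs_less_iff
        by linarith
      then have "\<bar>real u - real v\<bar> * s < 1 * s"
        using s by (simp add: abs_mult left_diff_distrib[symmetric])
      then have "\<bar>real u - real v\<bar> < 1"
        using s by simp
      then show "u = v" by linarith
    qed
    then have "card {1..Suc n} \<le> card (set xs)"
      by (rule card_inj_on_le) (use g in auto)
    then show False
      using card_length[of xs] a(2) by simp
  qed
  then obtain \<rho> where \<rho>: "\<rho> \<in> {1..Suc n}" "\<forall>x\<in>set xs. s / 2 \<le> \<bar>real \<rho> * s - \<bar>x\<bar>\<bar>"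
    by blast
  have "root_scale p s \<le> (2 * real n + 5) ^ n * \<bar>poly p y\<bar>" if y: "\<bar>y\<bar> = real \<rho> * s" for y
  proof -
    have "s + \<bar>x\<bar> \<le> (2 * real n + 5) * \<bar>y - x\<bar>" if x: "x \<in> set xs" for x
    proof -
      define d where "d = \<bar>real \<rho> * s - \<bar>x\<bar>\<bar>"
      have d: "s / 2 \<le> d" "d \<le> \<bar>y - x\<bar>" "\<bar>x\<bar> \<le> real \<rho> * s + d"
        using \<rho>(2) x y by (auto simp: d_def)
      have "real \<rho> * s \<le> (real n + 1) * s"
        using \<rho>(1) s by (intro mult_right_mono) auto
      also have "\<dots> \<le> (real n + 1) * (2 * d)"
        using d by (intro mult_left_mono) auto
      finally have "s + \<bar>x\<bar> \<le> (2 * real n + 5) * d"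
        using d by (simp add: algebra_simps)
      also have "\<dots> \<le> (2 * real n + 5) * \<bar>y - x\<bar>"
        using d by (intro mult_left_mono) auto
      finally show ?thesis .
    qed
    then have "\<bar>a\<bar> * (\<Sum>i\<le>n. \<bar>coeff (\<Prod>x\<leftarrow>xs. [:-x, 1:]) i\<bar> * s ^ i) \<le>
        \<bar>a\<bar> * ((2 * real n + 5) ^ length xs * \<bar>poly (\<Prod>x\<leftarrow>xs. [:-x, 1:]) y\<bar>)"
      by (intro mult_left_mono linear_factors_root_scale_le s) auto
    then show ?thesis
      unfolding root_scale_def p(2) using a(2) by (simp add: a(3) abs_mult sum_distrib_left mult_ac)
  qed
  then show ?thesis using \<rho>(1) by blast
qed

text \<open>To move \<open>\<tau>\<close> by \<open>\<epsilon> s\<close> changes the polynomial on the disc of radius \<open>(n + 1) s\<close> by a small fraction of the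
  scale at \<open>s\<close>, by the main estimate. So the polynomials up to there do not vanish at the two points
  \<open>\<plusminus> \<rho> s\<close> of a spaced radius, and a continuous root that starts at \<open>0\<close> is trapped between them.\<close>

lemma root_displacement:
  fixes \<kappa> M :: real
  assumes "1 \<le> q" "q \<le> n" "0 < \<kappa>" "\<kappa> \<le> M"
  shows "\<exists>\<epsilon>>0. \<epsilon> \<le> 1 \<and> (\<forall>P c l. taylor_family q n M P c \<longrightarrow> \<kappa> \<le> \<bar>coeff (P 0) q\<bar> \<longrightarrow>
    continuous_on {-1..1} l \<longrightarrow> l 0 = 0 \<longrightarrow> (\<forall>\<tau>. \<bar>\<tau>\<bar> \<le> 1 \<longrightarrow> poly (P \<tau>) (l \<tau>) = 0) \<longrightarrow>
    (\<forall>\<tau>. \<bar>\<tau>\<bar> \<le> \<epsilon> \<longrightarrow> \<bar>l \<tau>\<bar> \<le> (real n + 1) / \<epsilon> * \<bar>\<tau>\<bar>))"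
proof -
  obtain C where C: "0 < C" and bound: "\<And>P c s j k. scaled_family q n M \<kappa> P c s \<Longrightarrow> j \<le> n \<Longrightarrow> k < q \<Longrightarrow>
      \<bar>c j k\<bar> * s ^ (j + k) \<le> C * root_scale (P 0) s"
    using taylor_coeff_bound[OF assms] by blast
  define E where "E = real q * C + M / \<kappa>"
  have E: "0 \<le> E" using C assms by (simp add: E_def)
  \<comment> \<open>Bounds the perturbation at radius \<open>\<rho> s\<close> per unit step, relative to the value there; half of \<open>1 / L\<close> is a safe step.\<close>
  define L where "L = (2 * real n + 5) ^ n * (real n + 1) ^ Suc n * (E + 1)"
  have L: "1 \<le> L"
    unfolding L_def using E by (intro mult_ge1_I one_le_power) auto
  define \<epsilon> where "\<epsilon> = 1 / (2 * L)"
  have \<epsilon>: "0 < \<epsilon>" "\<epsilon> \<le> 1" using L by (auto simp: \<epsilon>_def field_simps)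
  have main: "\<bar>l \<tau>\<bar> \<le> (real n + 1) / \<epsilon> * \<bar>\<tau>\<bar>"
    if fam: "taylor_family q n M P c" and \<kappa>: "\<kappa> \<le> \<bar>coeff (P 0) q\<bar>"
      and l: "continuous_on {-1..1} l" "l 0 = 0" "\<forall>\<tau>. \<bar>\<tau>\<bar> \<le> 1 \<longrightarrow> poly (P \<tau>) (l \<tau>) = 0"
      and \<tau>: "\<bar>\<tau>\<bar> \<le> \<epsilon>" for P c l \<tau>
  proof (rule ccontr)
    assume neg: "\<not> ?thesis"
    then have "\<tau> \<noteq> 0" using l(2) by auto
    \<comment> \<open>The smallest scale at which \<open>\<tau>\<close> still lies within the admissible step.\<close>
    define s where "s = \<bar>\<tau>\<bar> / \<epsilon>"
    have s: "0 < s" "s \<le> 1" using \<tau> \<epsilon> \<open>\<tau> \<noteq> 0\<close> by (auto simp: s_def)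
    interpret scaled_family q n M \<kappa> P c s
      using fam \<kappa> s assms by unfold_locales auto
    obtain \<rho> where \<rho>: "\<rho> \<in> {1..Suc n}"
      "\<And>y. \<bar>y\<bar> = real \<rho> * s \<Longrightarrow> A \<le> (2 * real n + 5) ^ n * \<bar>poly (P 0) y\<bar>"
      using spaced_radius[of "P 0" n s] real_rooted_P[of 0] degree_P[of 0] s by auto
    have \<rho>n: "real \<rho> \<le> real n + 1" using \<rho>(1) by simp
    \<comment> \<open>If the root were beyond \<open>(n + 1) s\<close>, it would cross the spaced radius on the way.\<close>
    have "\<exists>u\<ge>0. u \<le> 1 \<and> \<bar>l (u * \<tau>)\<bar> = real \<rho> * s"
    proof (rule IVT')
      have "real \<rho> * s \<le> (real n + 1) * s" using \<rho>n s by (intro mult_right_mono) auto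
      then show "real \<rho> * s \<le> \<bar>l (1 * \<tau>)\<bar>" using neg by (simp add: s_def)
      show "continuous_on {0..1} (\<lambda>u. \<bar>l (u * \<tau>)\<bar>)"
      proof (intro continuous_intros continuous_on_compose2[OF l(1)])
        show "(\<lambda>u. u * \<tau>) ` {0..1} \<subseteq> {-1..1}"
        proof
          fix t assume "t \<in> (\<lambda>u. u * \<tau>) ` {0..1}"
          then obtain u where u: "0 \<le> u" "u \<le> 1" "t = u * \<tau>" by auto
          then have "\<bar>t\<bar> \<le> 1 * \<bar>\<tau>\<bar>" by (simp add: abs_mult mult_left_le_one_le)
          then show "t \<in> {-1..1}" using \<tau> \<epsilon> by auto
        qed
      qed
    qed (use s l in auto)
    then obtain u where u: "0 \<le> u" "u \<le> 1" "\<bar>l (u * \<tau>)\<bar> = real \<rho> * s" by blast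
    define t where "t = u * \<tau> / s"
    have st: "s * t = u * \<tau>" using s by (simp add: t_def)
    have t: "\<bar>t\<bar> \<le> \<epsilon>"
    proof -
      have "\<bar>t\<bar> = u * \<epsilon>" using u \<epsilon> \<open>\<tau> \<noteq> 0\<close> by (simp add: t_def s_def abs_mult)
      also have "\<dots> \<le> 1 * \<epsilon>" using u \<epsilon> by (intro mult_right_mono) auto
      finally show ?thesis by simp
    qed
    have t1: "\<bar>t\<bar> \<le> 1" using t \<epsilon> by simp
    define y where "y = l (u * \<tau>)"
    have zero: "poly (P (s * t)) y = 0"
      using l(3) scaled_abs_le[OF t1] by (simp add: y_def st)
    have expand: "poly (P (s * t')) y = (\<Sum>j\<le>n. coeff (P (s * t')) j * y ^ j)" if "\<bar>t'\<bar> \<le> 1" for t'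
      using degree_P[OF scaled_abs_le[OF that]] by (simp add: poly_altdef)
    have "\<bar>poly (P 0) y\<bar> = \<bar>\<Sum>j\<le>n. (coeff (P (s * t)) j - coeff (P 0) j) * y ^ j\<bar>"
      using expand[OF t1] expand[of 0] zero by (simp add: left_diff_distrib sum_subtractf)
    also have "\<dots> \<le> (\<Sum>j\<le>n. E * A * \<epsilon> * (real n + 1) ^ n)"
    proof (intro order.trans[OF sum_abs] sum_mono)
      fix j assume "j \<in> {..n}"
      then have j: "j \<le> n" by simp
      have "\<bar>(coeff (P (s * t)) j - coeff (P 0) j) * y ^ j\<bar> =
          \<bar>coeff (P (s * t)) j - coeff (P 0) j\<bar> * s ^ j * real \<rho> ^ j"
        using u(3) by (simp add: abs_mult power_abs y_def power_mult_distrib)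
      also have "\<dots> \<le> E * A * \<bar>t\<bar> * (real n + 1) ^ n"
      proof (intro mult_mono[of _ "E * A * \<bar>t\<bar>"])
        show "\<bar>coeff (P (s * t)) j - coeff (P 0) j\<bar> * s ^ j \<le> E * A * \<bar>t\<bar>"
          unfolding E_def using bound[OF scaled_family_axioms j] C t1 by (intro increment[OF j]) auto
        have "real \<rho> ^ j \<le> (real n + 1) ^ j" using \<rho>n by (intro power_mono) auto
        also have "\<dots> \<le> (real n + 1) ^ n" using j by (intro power_increasing) auto
        finally show "real \<rho> ^ j \<le> (real n + 1) ^ n" .
      qed (use E A_pos in auto)
      also have "\<dots> \<le> E * A * \<epsilon> * (real n + 1) ^ n"
        using E A_pos t by (intro mult_right_mono mult_left_mono) auto
      finally show "\<bar>(coeff (P (s * t)) j - coeff (P 0) j) * y ^ j\<bar> \<le> E * A * \<epsilon> * (real n + 1) ^ n" .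
    qed
    also have "\<dots> = (real n + 1) ^ Suc n * E * \<epsilon> * A"
      by (simp add: algebra_simps)
    finally have small: "\<bar>poly (P 0) y\<bar> \<le> (real n + 1) ^ Suc n * E * \<epsilon> * A" .
    have "A \<le> (2 * real n + 5) ^ n * ((real n + 1) ^ Suc n * E * \<epsilon> * A)"
      using \<rho>(2)[of y] u(3) small by (auto simp: y_def intro: order.trans mult_left_mono)
    also have "\<dots> = (2 * real n + 5) ^ n * (real n + 1) ^ Suc n * E * (\<epsilon> * A)"
      by (simp only: mult_ac)
    also have "\<dots> \<le> L * (\<epsilon> * A)"
      unfolding L_def using E \<epsilon> A_pos by (intro mult_right_mono mult_left_mono) auto
    also have "\<dots> = A / 2" using L by (simp add: \<epsilon>_def)
    finally show False using A_pos by simp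
  qed
  show ?thesis
    by (intro exI[of _ \<epsilon>] conjI allI impI) (rule \<epsilon>, rule \<epsilon>, (rule main; assumption))
qed

section \<open>Taylor expansion along segments\<close>

lemma has_real_derivative_along_axis:
  assumes "partial_diffable_at i f (y + t *\<^sub>R axis i 1)"
  shows "((\<lambda>t. f (y + t *\<^sub>R axis i 1)) has_real_derivative pd i f (y + t *\<^sub>R axis i 1)) (at t)"
proof -
  have "((\<lambda>u. f (y + t *\<^sub>R axis i 1 + u *\<^sub>R axis i 1)) has_real_derivative pd i f (y + t *\<^sub>R axis i 1)) (at 0)"
    using assms unfolding partial_diffable_at_def pd_def by (simp add: DERIV_deriv_iff_field_differentiable)
  moreover have "y + t *\<^sub>R axis i 1 + u *\<^sub>R axis i 1 = y + (u + t) *\<^sub>R axis i 1" for u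
    by (simp add: algebra_simps)
  ultimately show ?thesis
    using DERIV_shift[of "\<lambda>t. f (y + t *\<^sub>R axis i 1)" _ 0 t] by simp
qed

text \<open>Change the coordinates of \<open>x\<close> into those of \<open>x + h\<close> one at a time and apply the mean value inequality in
  each step.\<close>

lemma has_derivative_of_continuous_partials:
  fixes f :: "real^'m::finite \<Rightarrow> real"
  assumes U: "open U" "x \<in> U"
    and pdiff: "\<And>i y. y \<in> U \<Longrightarrow> partial_diffable_at i f y"
    and cont: "\<And>i. continuous_on U (pd i f)"
  shows "(f has_derivative (\<lambda>h. \<Sum>i\<in>UNIV. h $ i * pd i f x)) (at x)"
  unfolding has_derivative_at_alt
proof (intro conjI allI impI)
  show "bounded_linear (\<lambda>h. \<Sum>i\<in>UNIV. h $ i * pd i f x)"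
    by (intro bounded_linear_sum bounded_linear_mult_const bounded_linear_vec_nth)
next
  fix e :: real assume e: "0 < e"
  define m where "m = real CARD('m)"
  have m: "0 < m" by (simp add: m_def)
  have "\<exists>d>0. ball x d \<subseteq> U \<and> (\<forall>y\<in>ball x d. \<bar>pd i f y - pd i f x\<bar> \<le> e / m)" for i
  proof -
    obtain d1 where d1: "0 < d1" "ball x d1 \<subseteq> U"
      using U openE by blast
    have "\<exists>d>0. \<forall>y\<in>U. dist y x < d \<longrightarrow> dist (pd i f y) (pd i f x) < e / m"
      using cont[of i] U(2) e m unfolding continuous_on_iff by simp
    then obtain d2 where d2: "0 < d2" "\<And>y. y \<in> U \<Longrightarrow> dist y x < d2 \<Longrightarrow> \<bar>pd i f y - pd i f x\<bar> < e / m"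
      by (auto simp: dist_real_def)
    show ?thesis
      using d1 d2 by (intro exI[of _ "min d1 d2"]) (force simp: dist_commute intro: less_imp_le)
  qed
  then obtain d where d: "\<And>i. 0 < d i" "\<And>i. ball x (d i) \<subseteq> U"
    "\<And>i y. y \<in> ball x (d i) \<Longrightarrow> \<bar>pd i f y - pd i f x\<bar> \<le> e / m"
    by metis
  define r where "r = Min (range d)"
  have r: "0 < r" "\<And>i. r \<le> d i"
    using d(1) by (auto simp: r_def)
  have main: "\<bar>f (x + h) - f x - (\<Sum>i\<in>UNIV. h $ i * pd i f x)\<bar> \<le> e * norm h"
    if h: "norm h < r" for h
  proof -
    define part where "part S = (\<chi> i. if i \<in> S then h $ i else 0)" for S :: "'m set"
    have "\<bar>f (x + part S) - f x - (\<Sum>i\<in>S. h $ i * pd i f x)\<bar> \<le> real (card S) * (e / m * norm h)"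
      if "finite S" for S
      using that
    proof (induction S rule: finite_induct)
      case empty
      have "part {} = 0" by (simp add: part_def vec_eq_iff)
      then show ?case by simp
    next
      case (insert i S)
      define y where "y = x + part S"
      define B where "B = {- \<bar>h $ i\<bar>..\<bar>h $ i\<bar>}"
      have in_ball: "y + t *\<^sub>R axis i 1 \<in> ball x (d i)" if "t \<in> B" for t
      proof -
        have "norm (part S + t *\<^sub>R axis i 1) \<le> norm h"
          using that insert(2) by (intro norm_le_componentwise_cart) (auto simp: part_def axis_def B_def)
        also have "\<dots> < d i" using h r(2)[of i] by linarith
        finally have "norm (part S + t *\<^sub>R axis i 1) < d i" .
        moreover have "x - (y + t *\<^sub>R axis i 1) = - (part S + t *\<^sub>R axis i 1)"
          by (simp add: y_def)
        ultimately show ?thesis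
          by (simp only: mem_ball dist_norm norm_minus_cancel)
      qed
      define \<phi> where "\<phi> t = f (y + t *\<^sub>R axis i 1) - t * pd i f x" for t
      have "\<bar>\<phi> (h $ i) - \<phi> 0\<bar> \<le> e / m * \<bar>h $ i - 0\<bar>"
        unfolding real_norm_def[symmetric]
      proof (rule field_differentiable_bound)
        show "convex B" by (simp add: B_def)
        show "h $ i \<in> B" "0 \<in> B" by (auto simp: B_def)
        fix t assume t: "t \<in> B"
        have "y + t *\<^sub>R axis i 1 \<in> U" using in_ball[OF t] d(2) by blast
        then show "(\<phi> has_field_derivative (pd i f (y + t *\<^sub>R axis i 1) - pd i f x)) (at t within B)"
          unfolding \<phi>_def
          by (auto intro!: derivative_eq_intros has_field_derivative_at_within[OF has_real_derivative_along_axis] pdiff)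
        show "norm (pd i f (y + t *\<^sub>R axis i 1) - pd i f x) \<le> e / m"
          using d(3)[OF in_ball[OF t]] by simp
      qed
      moreover have "\<bar>h $ i - 0\<bar> \<le> norm h" by (simp add: component_le_norm_cart)
      then have "e / m * \<bar>h $ i - 0\<bar> \<le> e / m * norm h" using e m by (intro mult_left_mono) auto
      moreover have "part (insert i S) = part S + h $ i *\<^sub>R axis i 1"
        using insert(2) by (auto simp: part_def vec_eq_iff axis_def)
      then have "x + part (insert i S) = y + h $ i *\<^sub>R axis i 1" by (simp add: y_def)
      then have "f (x + part (insert i S)) - f x - (\<Sum>i\<in>insert i S. h $ i * pd i f x) =
          (f y - f x - (\<Sum>i\<in>S. h $ i * pd i f x)) + (\<phi> (h $ i) - \<phi> 0)"
        using insert(1,2) by (simp add: \<phi>_def)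
      ultimately have "\<bar>f (x + part (insert i S)) - f x - (\<Sum>i\<in>insert i S. h $ i * pd i f x)\<bar> \<le>
          real (card S) * (e / m * norm h) + e / m * norm h"
        using insert(3) unfolding y_def by linarith
      then show ?case using insert(1,2) by (simp add: distrib_right add.commute add_divide_distrib)
    qed
    from this[of UNIV] have "\<bar>f (x + part UNIV) - f x - (\<Sum>i\<in>UNIV. h $ i * pd i f x)\<bar> \<le> m * (e / m * norm h)"
      by (simp add: m_def)
    moreover have "part UNIV = h" by (simp add: part_def vec_eq_iff)
    ultimately show ?thesis using m by simp
  qed
  show "\<exists>d>0. \<forall>y. norm (y - x) < d \<longrightarrow>
      norm (f y - f x - (\<Sum>i\<in>UNIV. (y - x) $ i * pd i f x)) \<le> e * norm (y - x)"
    using main[of "y - x" for y] r(1) by (intro exI[of _ r]) auto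
qed

text \<open>The \<open>k\<close>-th derivative in direction \<open>w\<close> of the partial derivative \<open>pds js f\<close>. New coordinates are put at
  the front of the word, where \<open>pds\<close> performs the outermost differentiation, so commuting partial
  derivatives is never at issue.\<close>

primrec directional_deriv ::
  "nat \<Rightarrow> real^'m::finite \<Rightarrow> (real^'m \<Rightarrow> real) \<Rightarrow> 'm list \<Rightarrow> real^'m \<Rightarrow> real" where
  "directional_deriv 0 w f js x = pds js f x"
| "directional_deriv (Suc k) w f js x = (\<Sum>i\<in>UNIV. w $ i * directional_deriv k w f (i # js) x)"

lemma has_real_derivative_directional_deriv:
  fixes f :: "real^'m::finite \<Rightarrow> real"
  assumes f: "Ck_on K U f" "open U" and x: "x + t *\<^sub>R w \<in> U" and len: "length js + k < K"
  shows "((\<lambda>t. directional_deriv k w f js (x + t *\<^sub>R w)) has_real_derivative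
    directional_deriv (Suc k) w f js (x + t *\<^sub>R w)) (at t)"
  using len
proof (induction k arbitrary: js)
  case 0
  have "(pds js f has_derivative (\<lambda>h. \<Sum>i\<in>UNIV. h $ i * pd i (pds js f) (x + t *\<^sub>R w))) (at (x + t *\<^sub>R w))"
  proof (rule has_derivative_of_continuous_partials[OF f(2) x])
    show "partial_diffable_at i (pds js f) y" if "y \<in> U" for i y
      using f(1) 0 that by (simp add: Ck_on_def)
    show "continuous_on U (pd i (pds js f))" for i
    proof -
      have "continuous_on U (pds (i # js) f)"
        using f(1) 0 by (auto simp: Ck_on_def simp del: pds.simps)
      then show ?thesis by simp
    qed
  qed
  moreover have "((\<lambda>t. x + t *\<^sub>R w) has_derivative (\<lambda>h. h *\<^sub>R w)) (at t)"
    by (auto intro!: derivative_eq_intros)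
  ultimately have "((\<lambda>t. pds js f (x + t *\<^sub>R w)) has_derivative
      (\<lambda>h. \<Sum>i\<in>UNIV. (h *\<^sub>R w) $ i * pd i (pds js f) (x + t *\<^sub>R w))) (at t)"
    using has_derivative_compose by fastforce
  moreover have "(\<lambda>h. \<Sum>i\<in>UNIV. (h *\<^sub>R w) $ i * pd i (pds js f) (x + t *\<^sub>R w)) =
      (*) (\<Sum>i\<in>UNIV. w $ i * pd i (pds js f) (x + t *\<^sub>R w))"
    by (auto simp: fun_eq_iff sum_distrib_right sum_distrib_left mult_ac intro!: sum.cong)
  ultimately show ?case
    by (simp add: has_field_derivative_def)
next
  case (Suc k)
  have "((\<lambda>t. directional_deriv k w f (i # js) (x + t *\<^sub>R w)) has_real_derivative
    directional_deriv (Suc k) w f (i # js) (x + t *\<^sub>R w)) (at t)" for i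
    using Suc by simp
  then have "((\<lambda>t. \<Sum>i\<in>UNIV. w $ i * directional_deriv k w f (i # js) (x + t *\<^sub>R w)) has_real_derivative
    (\<Sum>i\<in>UNIV. w $ i * directional_deriv (Suc k) w f (i # js) (x + t *\<^sub>R w))) (at t)"
    by (intro DERIV_sum DERIV_cmult)
  then show ?case by simp
qed

text \<open>With \<open>g = 0\<close> this bounds a directional derivative, and with \<open>g = f\<close> its increment between two points.\<close>

lemma directional_deriv_diff_bound:
  fixes f g :: "real^'m::finite \<Rightarrow> real"
  assumes w: "\<And>i. \<bar>w $ i\<bar> \<le> 1" and b: "\<And>js. length js = K \<Longrightarrow> \<bar>pds js f y - pds js g z\<bar> \<le> b"
    and len: "length js + k = K"
  shows "\<bar>directional_deriv k w f js y - directional_deriv k w g js z\<bar> \<le> real CARD('m) ^ k * b"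
  using len
proof (induction k arbitrary: js)
  case 0
  then show ?case using b by simp
next
  case (Suc k)
  have "\<bar>directional_deriv (Suc k) w f js y - directional_deriv (Suc k) w g js z\<bar> =
      \<bar>\<Sum>i\<in>UNIV. w $ i * (directional_deriv k w f (i # js) y - directional_deriv k w g (i # js) z)\<bar>"
    by (simp add: right_diff_distrib sum_subtractf)
  also have "\<dots> \<le> (\<Sum>i\<in>(UNIV :: 'm set). 1 * (real CARD('m) ^ k * b))"
  proof (intro order.trans[OF sum_abs] sum_mono)
    fix i
    show "\<bar>w $ i * (directional_deriv k w f (i # js) y - directional_deriv k w g (i # js) z)\<bar>
        \<le> 1 * (real CARD('m) ^ k * b)"
      unfolding abs_mult using w Suc by (intro mult_mono) auto
  qed
  finally show ?case by simp
qed

lemma pds_zero: "pds js (\<lambda>_. 0) x = 0"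
proof (induction js arbitrary: x)
  case (Cons i js)
  then have "pds js (\<lambda>_. 0) = (\<lambda>_. 0)" by auto
  then show ?case by (simp add: pd_def)
qed auto

lemma directional_deriv_bound:
  fixes f :: "real^'m::finite \<Rightarrow> real"
  assumes "\<And>i. \<bar>w $ i\<bar> \<le> 1" "\<And>js. length js = k \<Longrightarrow> \<bar>pds js f y\<bar> \<le> b"
  shows "\<bar>directional_deriv k w f [] y\<bar> \<le> real CARD('m) ^ k * b"
proof -
  have "directional_deriv k w (\<lambda>_. 0) js y = 0" for js
    by (induction k arbitrary: js) (simp_all add: pds_zero)
  then show ?thesis
    using directional_deriv_diff_bound[of w k f y "\<lambda>_. 0" y b "[]" k] assms by (simp add: pds_zero)
qed

definition taylor_expansion :: "nat \<Rightarrow> real \<Rightarrow> (real \<Rightarrow> real) \<Rightarrow> bool" where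
  "taylor_expansion q M g \<longleftrightarrow> (\<exists>c. (\<forall>k<q. \<bar>c k\<bar> \<le> M) \<and>
     (\<forall>\<tau>. \<bar>\<tau>\<bar> \<le> 1 \<longrightarrow> \<bar>g \<tau> - (\<Sum>k<q. c k * \<tau> ^ k)\<bar> \<le> M * \<bar>\<tau>\<bar> ^ q))"

text \<open>Taylor's formula with the \<open>k\<close>-th derivative evaluated at an intermediate point; by the Lipschitz
  condition, replacing that point by \<open>x\<close> costs one more factor \<open>\<bar>\<tau>\<bar>\<close>.\<close>

lemma taylor_expansion_along_segment:
  fixes f :: "real^'m::finite \<Rightarrow> real"
  assumes f: "Ck_on k U f" "open U" "K \<subseteq> U"
    and bd: "\<And>js y. length js \<le> k \<Longrightarrow> y \<in> K \<Longrightarrow> \<bar>pds js f y\<bar> \<le> N"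
    and lip: "\<And>js y z. length js = k \<Longrightarrow> y \<in> K \<Longrightarrow> z \<in> K \<Longrightarrow> \<bar>pds js f y - pds js f z\<bar> \<le> N * norm (y - z)"
    and seg: "cball x (norm w) \<subseteq> K" "norm w \<le> 1"
  shows "taylor_expansion (Suc k) (real CARD('m) ^ k * N) (\<lambda>\<tau>. f (x + \<tau> *\<^sub>R w))"
proof -
  have N: "0 \<le> N"
    using bd[of "[]" x] seg(1) by (force intro: order.trans[OF abs_ge_zero])
  have m: "1 \<le> real CARD('m)" using zero_less_card_finite[where 'a = 'm] by linarith
  have w: "\<bar>w $ i\<bar> \<le> 1" for i
    using component_le_norm_cart[of w i] seg(2) by linarith
  have inK: "x + \<tau> *\<^sub>R w \<in> K" if "\<bar>\<tau>\<bar> \<le> 1" for \<tau>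
    using that seg(1) by (auto simp: subset_eq dist_norm mult_left_le_one_le)
  define c where "c j = directional_deriv j w f [] x / fact j" for j
  have c: "\<bar>c j\<bar> \<le> real CARD('m) ^ k * N" if "j < Suc k" for j
  proof -
    have "\<bar>c j\<bar> \<le> \<bar>directional_deriv j w f [] x\<bar>"
      using mult_left_mono[of 1 "fact j" "\<bar>directional_deriv j w f [] x\<bar>"]
      by (simp add: c_def field_simps)
    also have "\<dots> \<le> real CARD('m) ^ j * N"
      using that inK[of 0] by (intro directional_deriv_bound w bd) auto
    also have "\<dots> \<le> real CARD('m) ^ k * N"
      using that m N by (intro mult_right_mono power_increasing) auto
    finally show ?thesis .
  qed
  have rem: "\<bar>f (x + \<tau> *\<^sub>R w) - (\<Sum>j<Suc k. c j * \<tau> ^ j)\<bar> \<le> real CARD('m) ^ k * N * \<bar>\<tau>\<bar> ^ Suc k"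
    if \<tau>: "\<bar>\<tau>\<bar> \<le> 1" for \<tau>
  proof -
    \<comment> \<open>For \<open>k = 0\<close> this holds with \<open>t = \<tau>\<close>, so that the Lipschitz case needs no separate treatment below.\<close>
    have "\<exists>t. \<bar>t\<bar> \<le> \<bar>\<tau>\<bar> \<and> f (x + \<tau> *\<^sub>R w) =
        (\<Sum>j<k. c j * \<tau> ^ j) + directional_deriv k w f [] (x + t *\<^sub>R w) / fact k * \<tau> ^ k"
    proof (cases "k = 0 \<or> \<tau> = 0")
      case True
      then show ?thesis
      proof
        assume "k = 0"
        then show ?thesis by (intro exI[of _ \<tau>]) simp
      next
        assume "\<tau> = 0"
        moreover have "(\<Sum>j<k. c j * 0 ^ j) = (if k = 0 then 0 else c 0)"
          by (cases k) (auto simp: sum.lessThan_Suc_shift)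
        ultimately show ?thesis
          by (cases "k = 0") (auto simp: c_def intro!: exI[of _ 0])
      qed
    next
      case False
      have "\<exists>t. (if \<tau> < 0 then \<tau> < t \<and> t < 0 else 0 < t \<and> t < \<tau>) \<and>
        f (x + \<tau> *\<^sub>R w) = (\<Sum>j<k. (directional_deriv j w f [] (x + 0 *\<^sub>R w) / fact j) * (\<tau> - 0) ^ j) +
          (directional_deriv k w f [] (x + t *\<^sub>R w) / fact k) * (\<tau> - 0) ^ k"
      proof (rule Taylor[where a = "-1" and b = 1 and diff = "\<lambda>j t. directional_deriv j w f [] (x + t *\<^sub>R w)"])
        show "\<forall>j t. j < k \<and> -1 \<le> t \<and> t \<le> 1 \<longrightarrow>
          DERIV (\<lambda>t. directional_deriv j w f [] (x + t *\<^sub>R w)) t :> directional_deriv (Suc j) w f [] (x + t *\<^sub>R w)"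
        proof (intro allI impI has_real_derivative_directional_deriv[OF f(1,2)])
          fix j and t :: real assume "j < k \<and> -1 \<le> t \<and> t \<le> 1"
          then show "x + t *\<^sub>R w \<in> U" "length [] + j < k" using inK[of t] f(3) by auto
        qed
      qed (use False \<tau> in auto)
      then obtain t where t: "if \<tau> < 0 then \<tau> < t \<and> t < 0 else 0 < t \<and> t < \<tau>"
        "f (x + \<tau> *\<^sub>R w) = (\<Sum>j<k. (directional_deriv j w f [] (x + 0 *\<^sub>R w) / fact j) * (\<tau> - 0) ^ j) +
          (directional_deriv k w f [] (x + t *\<^sub>R w) / fact k) * (\<tau> - 0) ^ k"
        by blast
      have "\<bar>t\<bar> \<le> \<bar>\<tau>\<bar>" using t(1) by (auto split: if_splits)
      then show ?thesis
        using t(2) by (intro exI[of _ t]) (simp add: c_def)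
    qed
    then obtain t where t: "\<bar>t\<bar> \<le> \<bar>\<tau>\<bar>" "f (x + \<tau> *\<^sub>R w) =
        (\<Sum>j<k. c j * \<tau> ^ j) + directional_deriv k w f [] (x + t *\<^sub>R w) / fact k * \<tau> ^ k" by blast
    have "f (x + \<tau> *\<^sub>R w) - (\<Sum>j<Suc k. c j * \<tau> ^ j) =
        (directional_deriv k w f [] (x + t *\<^sub>R w) - directional_deriv k w f [] x) * (\<tau> ^ k / fact k)"
      unfolding t(2) by (simp add: c_def left_diff_distrib diff_divide_distrib)
    then have "\<bar>f (x + \<tau> *\<^sub>R w) - (\<Sum>j<Suc k. c j * \<tau> ^ j)\<bar> =
        \<bar>directional_deriv k w f [] (x + t *\<^sub>R w) - directional_deriv k w f [] x\<bar> * (\<bar>\<tau>\<bar> ^ k / fact k)"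
      by (simp add: abs_mult power_abs)
    also have "\<dots> \<le> (real CARD('m) ^ k * (N * \<bar>\<tau>\<bar>)) * (\<bar>\<tau>\<bar> ^ k / 1)"
    proof (intro mult_mono divide_left_mono)
      show "\<bar>directional_deriv k w f [] (x + t *\<^sub>R w) - directional_deriv k w f [] x\<bar> \<le> real CARD('m) ^ k * (N * \<bar>\<tau>\<bar>)"
      proof (rule directional_deriv_diff_bound[where K = k])
        fix js :: "'m list" assume js: "length js = k"
        have "\<bar>pds js f (x + t *\<^sub>R w) - pds js f x\<bar> \<le> N * norm (x + t *\<^sub>R w - x)"
          using inK[of t] inK[of 0] t(1) \<tau> by (intro lip js) auto
        also have "\<dots> \<le> N * \<bar>\<tau>\<bar>"
          using N t(1) seg(2) mult_mono[of "\<bar>t\<bar>" "\<bar>\<tau>\<bar>" "norm w" 1] by (intro mult_left_mono) auto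
        finally show "\<bar>pds js f (x + t *\<^sub>R w) - pds js f x\<bar> \<le> N * \<bar>\<tau>\<bar>" .
      qed (use w in auto)
    qed (use N in auto)
    finally show ?thesis by (simp add: mult_ac)
  qed
  show ?thesis
    unfolding taylor_expansion_def using c rem by blast
qed

lemma Ck1_norm_bounds:
  fixes f :: "real^'m::finite \<Rightarrow> real"
  assumes "Ck1_norm k K f < \<infinity>"
  shows "length js \<le> k \<Longrightarrow> y \<in> K \<Longrightarrow> \<bar>pds js f y\<bar> \<le> Ck1_rnorm k K f"
    and "length js = k \<Longrightarrow> y \<in> K \<Longrightarrow> z \<in> K \<Longrightarrow> \<bar>pds js f y - pds js f z\<bar> \<le> Ck1_rnorm k K f * norm (y - z)"
proof -
  have eq: "Ck1_norm k K f = ennreal (Ck1_rnorm k K f)"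
    using assms by (simp add: Ck1_rnorm_def)
  have N: "0 \<le> Ck1_rnorm k K f" by (simp add: Ck1_rnorm_def)
  show "\<bar>pds js f y\<bar> \<le> Ck1_rnorm k K f" if "length js \<le> k" "y \<in> K"
  proof -
    have "ennreal \<bar>pds js f y\<bar> \<le> (SUP x\<in>K. ennreal \<bar>pds js f x\<bar>)"
      using that by (intro SUP_upper)
    also have "\<dots> \<le> Ck_norm k K f"
      unfolding Ck_norm_def using that by (intro SUP_upper) simp
    also have "\<dots> \<le> Ck1_norm k K f"
      unfolding Ck1_norm_def by simp
    finally show ?thesis
      unfolding eq using N by simp
  qed
  show "\<bar>pds js f y - pds js f z\<bar> \<le> Ck1_rnorm k K f * norm (y - z)"
    if "length js = k" "y \<in> K" "z \<in> K"
  proof (cases "y = z")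
    case False
    have "ennreal (\<bar>pds js f y - pds js f z\<bar> / norm (y - z)) \<le> Lip K (pds js f)"
      unfolding Lip_def using that False by (intro SUP_upper2[of "(y, z)"]) auto
    also have "\<dots> \<le> (SUP js\<in>{js. length js = k}. Lip K (pds js f))"
      using that by (intro SUP_upper) simp
    also have "\<dots> \<le> Ck1_norm k K f"
      unfolding Ck1_norm_def by simp
    finally show ?thesis
      unfolding eq using N False by (simp add: field_simps)
  qed simp
qed

section \<open>Roots of families with several parameters\<close>

lemma taylor_expansion_nonneg:
  assumes "taylor_expansion q M g"
  shows "0 \<le> M"
proof -
  obtain c where "\<And>\<tau>. \<bar>\<tau>\<bar> \<le> 1 \<Longrightarrow> \<bar>g \<tau> - (\<Sum>k<q. c k * \<tau> ^ k)\<bar> \<le> M * \<bar>\<tau>\<bar> ^ q"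
    using assms unfolding taylor_expansion_def by blast
  from this[of 1] show ?thesis
    using abs_ge_zero[of "g 1 - (\<Sum>k<q. c k * 1 ^ k)"] by simp
qed

lemma taylor_expansion_lower_order:
  assumes "taylor_expansion p M g" "q \<le> p"
  shows "taylor_expansion q (real (Suc p) * M) g"
proof -
  have M: "0 \<le> M" by (rule taylor_expansion_nonneg[OF assms(1)])
  have MM: "1 * M \<le> real (Suc p) * M" using M by (intro mult_right_mono) auto
  obtain c where c: "\<And>k. k < p \<Longrightarrow> \<bar>c k\<bar> \<le> M"
    "\<And>\<tau>. \<bar>\<tau>\<bar> \<le> 1 \<Longrightarrow> \<bar>g \<tau> - (\<Sum>k<p. c k * \<tau> ^ k)\<bar> \<le> M * \<bar>\<tau>\<bar> ^ p"
    using assms(1) unfolding taylor_expansion_def by blast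
  have "\<bar>g \<tau> - (\<Sum>k<q. c k * \<tau> ^ k)\<bar> \<le> real (Suc p) * M * \<bar>\<tau>\<bar> ^ q" if \<tau>: "\<bar>\<tau>\<bar> \<le> 1" for \<tau>
  proof -
    have "{..<p} = {..<q} \<union> {q..<p}" using assms(2) by auto
    then have split: "(\<Sum>k<p. c k * \<tau> ^ k) = (\<Sum>k<q. c k * \<tau> ^ k) + (\<Sum>k\<in>{q..<p}. c k * \<tau> ^ k)"
      by (simp add: sum.union_disjoint ivl_disj_int)
    have "\<bar>\<Sum>k\<in>{q..<p}. c k * \<tau> ^ k\<bar> \<le> (\<Sum>k\<in>{q..<p}. M * \<bar>\<tau>\<bar> ^ q)"
    proof (intro order.trans[OF sum_abs] sum_mono)
      fix k assume "k \<in> {q..<p}"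
      then show "\<bar>c k * \<tau> ^ k\<bar> \<le> M * \<bar>\<tau>\<bar> ^ q"
        using c(1)[of k] \<tau> M by (auto simp: abs_mult power_abs intro!: mult_mono power_decreasing)
    qed
    also have "\<dots> \<le> real p * (M * \<bar>\<tau>\<bar> ^ q)"
      using M by (auto intro!: mult_right_mono)
    finally have 1: "\<bar>\<Sum>k\<in>{q..<p}. c k * \<tau> ^ k\<bar> \<le> real p * (M * \<bar>\<tau>\<bar> ^ q)" .
    have 2: "M * \<bar>\<tau>\<bar> ^ p \<le> M * \<bar>\<tau>\<bar> ^ q"
      using M \<tau> assms(2) by (intro mult_left_mono power_decreasing) auto
    have "\<bar>g \<tau> - (\<Sum>k<q. c k * \<tau> ^ k)\<bar> \<le> M * \<bar>\<tau>\<bar> ^ q + real p * (M * \<bar>\<tau>\<bar> ^ q)"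
      using c(2)[OF \<tau>] 1 2 unfolding split by linarith
    then show ?thesis by (simp add: algebra_simps)
  qed
  moreover have "\<bar>c k\<bar> \<le> real (Suc p) * M" if "k < q" for k
    using c(1)[of k] that assms(2) MM by simp
  ultimately show ?thesis
    unfolding taylor_expansion_def by blast
qed

lemma taylor_expansion_mono:
  assumes "taylor_expansion q M g" "M \<le> M'"
  shows "taylor_expansion q M' g"
proof -
  have up: "M * \<bar>\<tau>\<bar> ^ q \<le> M' * \<bar>\<tau>\<bar> ^ q" for \<tau> :: real
    using assms(2) by (intro mult_right_mono) auto
  obtain c where c: "\<And>k. k < q \<Longrightarrow> \<bar>c k\<bar> \<le> M"
    "\<And>\<tau>. \<bar>\<tau>\<bar> \<le> 1 \<Longrightarrow> \<bar>g \<tau> - (\<Sum>k<q. c k * \<tau> ^ k)\<bar> \<le> M * \<bar>\<tau>\<bar> ^ q"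
    using assms(1) unfolding taylor_expansion_def by blast
  show ?thesis
    unfolding taylor_expansion_def
    by (intro exI[of _ c] conjI allI impI order.trans[OF c(1) assms(2)] order.trans[OF c(2) up])
qed

lemma taylor_expansion_const:
  assumes "0 < q"
  shows "taylor_expansion q \<bar>a\<bar> (\<lambda>_. a)"
  unfolding taylor_expansion_def
proof (intro exI[of _ "\<lambda>k. if k = 0 then a else 0"] conjI allI impI)
  fix \<tau> :: real
  have "(\<Sum>k<q. (if k = 0 then a else 0) * \<tau> ^ k) = (\<Sum>k\<in>{0}. (if k = 0 then a else 0) * \<tau> ^ k)"
    using assms by (intro sum.mono_neutral_right) auto
  then have "(\<Sum>k<q. (if k = 0 then a else 0) * \<tau> ^ k) = a"
    by simp
  then show "\<bar>a - (\<Sum>k<q. (if k = 0 then a else 0) * \<tau> ^ k)\<bar> \<le> \<bar>a\<bar> * \<bar>\<tau>\<bar> ^ q"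
    by simp
qed auto

lemma taylor_expansion_sum:
  assumes "finite I" "\<And>i. i \<in> I \<Longrightarrow> taylor_expansion q M (g i)"
  shows "taylor_expansion q ((\<Sum>i\<in>I. \<bar>w i\<bar>) * M) (\<lambda>\<tau>. \<Sum>i\<in>I. w i * g i \<tau>)"
proof -
  have "\<forall>i\<in>I. \<exists>c. (\<forall>k<q. \<bar>c k\<bar> \<le> M) \<and>
      (\<forall>\<tau>. \<bar>\<tau>\<bar> \<le> 1 \<longrightarrow> \<bar>g i \<tau> - (\<Sum>k<q. c k * \<tau> ^ k)\<bar> \<le> M * \<bar>\<tau>\<bar> ^ q)"
    using assms(2) unfolding taylor_expansion_def by blast
  from bchoice[OF this] obtain c where "\<forall>i\<in>I. (\<forall>k<q. \<bar>c i k\<bar> \<le> M) \<and>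
      (\<forall>\<tau>. \<bar>\<tau>\<bar> \<le> 1 \<longrightarrow> \<bar>g i \<tau> - (\<Sum>k<q. c i k * \<tau> ^ k)\<bar> \<le> M * \<bar>\<tau>\<bar> ^ q)"
    by blast
  then have c: "\<And>i k. i \<in> I \<Longrightarrow> k < q \<Longrightarrow> \<bar>c i k\<bar> \<le> M"
    "\<And>i \<tau>. i \<in> I \<Longrightarrow> \<bar>\<tau>\<bar> \<le> 1 \<Longrightarrow> \<bar>g i \<tau> - (\<Sum>k<q. c i k * \<tau> ^ k)\<bar> \<le> M * \<bar>\<tau>\<bar> ^ q"
    by auto
  have bound: "\<bar>\<Sum>i\<in>I. w i * u i\<bar> \<le> (\<Sum>i\<in>I. \<bar>w i\<bar>) * b" if "\<And>i. i \<in> I \<Longrightarrow> \<bar>u i\<bar> \<le> b" for u b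
    unfolding sum_distrib_right using that
    by (intro order.trans[OF sum_abs] sum_mono) (simp add: abs_mult mult_left_mono)
  show ?thesis
    unfolding taylor_expansion_def
  proof (intro exI[of _ "\<lambda>k. \<Sum>i\<in>I. w i * c i k"] conjI allI impI)
    show "\<bar>\<Sum>i\<in>I. w i * c i k\<bar> \<le> (\<Sum>i\<in>I. \<bar>w i\<bar>) * M" if "k < q" for k
      by (rule bound) (use c(1) that in blast)
    fix \<tau> :: real assume \<tau>: "\<bar>\<tau>\<bar> \<le> 1"
    have "(\<Sum>k<q. (\<Sum>i\<in>I. w i * c i k) * \<tau> ^ k) = (\<Sum>i\<in>I. w i * (\<Sum>k<q. c i k * \<tau> ^ k))"
      unfolding sum_distrib_right sum_distrib_left by (subst sum.swap) (simp add: mult.assoc)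
    then have "(\<Sum>i\<in>I. w i * g i \<tau>) - (\<Sum>k<q. (\<Sum>i\<in>I. w i * c i k) * \<tau> ^ k) =
        (\<Sum>i\<in>I. w i * (g i \<tau> - (\<Sum>k<q. c i k * \<tau> ^ k)))"
      by (simp add: sum_subtractf right_diff_distrib)
    then show "\<bar>(\<Sum>i\<in>I. w i * g i \<tau>) - (\<Sum>k<q. (\<Sum>i\<in>I. w i * c i k) * \<tau> ^ k)\<bar> \<le>
        (\<Sum>i\<in>I. \<bar>w i\<bar>) * M * \<bar>\<tau>\<bar> ^ q"
      using bound[of "\<lambda>i. g i \<tau> - (\<Sum>k<q. c i k * \<tau> ^ k)" "M * \<bar>\<tau>\<bar> ^ q"] c(2) \<tau>
      by (simp add: mult.assoc)
  qed
qed

lemma coeff_pcompose_shift: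
  fixes p :: "real poly"
  assumes "degree p \<le> n"
  shows "coeff (pcompose p [:b, 1:]) j = (\<Sum>i\<le>n. (real (i choose j) * b ^ (i - j)) * coeff p i)"
proof -
  have lin: "coeff ([:b, 1:] ^ i) j = real (i choose j) * b ^ (i - j)" for i
  proof (cases "j \<le> i")
    case True
    then show ?thesis by (simp add: coeff_linear_poly_power)
  next
    case False
    then have "degree ([:b, 1:] ^ i) < j" by (simp add: degree_linear_power)
    then show ?thesis using False by (simp add: coeff_eq_0)
  qed
  have "pcompose p [:b, 1:] = (\<Sum>i\<le>degree p. smult (coeff p i) ([:b, 1:] ^ i))"
    unfolding pcompose_altdef poly_altdef by (simp add: degree_map_poly coeff_map_poly)
  then have "coeff (pcompose p [:b, 1:]) j = (\<Sum>i\<le>degree p. coeff p i * coeff ([:b, 1:] ^ i) j)"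
    by (simp add: coeff_sum)
  also have "\<dots> = (\<Sum>i\<le>n. coeff p i * coeff ([:b, 1:] ^ i) j)"
    using assms by (intro sum.mono_neutral_left) (auto simp: coeff_eq_0)
  finally show ?thesis by (simp add: lin mult.commute)
qed

lemma coeff_P_fam: "coeff (P_fam n a x) i = (if i = n then 1 else if i < n then a (n - i) x else 0)"
proof -
  have "coeff (P_fam n a x) i = (if n = i then 1 else 0) + (\<Sum>j=1..n. if n - j = i then a j x else 0)"
    by (simp add: P_fam_def coeff_sum)
  also have "(\<Sum>j=1..n. if n - j = i then a j x else 0) = (if i < n then a (n - i) x else 0)"
  proof (cases "i < n")
    case True
    have "(\<Sum>j=1..n. if n - j = i then a j x else 0) = (\<Sum>j\<in>{n - i}. if n - j = i then a j x else 0)"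
      using True by (intro sum.mono_neutral_right) auto
    then show ?thesis using True by simp
  next
    case False
    then show ?thesis by (intro trans[OF sum.neutral]) auto
  qed
  finally show ?thesis by auto
qed

lemma degree_P_fam: "degree (P_fam n a x) = n"
proof (rule antisym)
  show "degree (P_fam n a x) \<le> n"
    by (intro degree_le) (simp add: coeff_P_fam)
  show "n \<le> degree (P_fam n a x)"
    by (intro le_degree) (simp add: coeff_P_fam)
qed

lemma hyperbolic_imp_real_rooted: "hyperbolic p \<Longrightarrow> real_rooted p"
  by (simp add: hyperbolic_def real_rooted_def)

text \<open>The one-parameter result applies to the family along the segment from \<open>x - w\<close> to \<open>x + w\<close> after the
  shift of \<open>Z\<close> by \<open>l x\<close>. The coefficients of the shifted polynomials are fixed linear combinations of the
  original ones, so they inherit the expansions.\<close>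

lemma root_displacement_along_segment:
  fixes \<kappa> M :: real
  assumes q: "1 \<le> q" "q \<le> n" and \<kappa>: "0 < \<kappa>" and M: "1 \<le> M"
  shows "\<exists>\<epsilon>>0. \<epsilon> \<le> 1 \<and> (\<forall>a (l :: real^'m::finite \<Rightarrow> real) x w.
    (\<forall>y\<in>cball x (norm w). real_rooted (P_fam n a y) \<and> poly (P_fam n a y) (l y) = 0) \<longrightarrow>
    continuous_on (cball x (norm w)) l \<longrightarrow> \<bar>l x\<bar> \<le> M \<longrightarrow>
    (\<forall>i\<in>{1..n}. taylor_expansion q M (\<lambda>\<tau>. a i (x + \<tau> *\<^sub>R w))) \<longrightarrow>
    \<kappa> \<le> \<bar>coeff (pcompose (P_fam n a x) [:l x, 1:]) q\<bar> \<longrightarrow>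
    (\<forall>\<tau>. \<bar>\<tau>\<bar> \<le> \<epsilon> \<longrightarrow> \<bar>l (x + \<tau> *\<^sub>R w) - l x\<bar> \<le> (real n + 1) / \<epsilon> * \<bar>\<tau>\<bar>))"
proof -
  \<comment> \<open>The weights \<open>(i choose j) (l x)\<^bsup>i-j\<^esup>\<close> of the shift are at most \<open>2\<^sup>n M\<^sup>n\<close>.\<close>
  define M' where "M' = max \<kappa> ((\<Sum>i\<le>n. 2 ^ n * M ^ n) * M)"
  have \<kappa>M': "\<kappa> \<le> M'" by (simp add: M'_def)
  obtain \<epsilon> where \<epsilon>: "0 < \<epsilon>" "\<epsilon> \<le> 1" and disp: "\<forall>P c l. taylor_family q n M' P c \<longrightarrow>
    \<kappa> \<le> \<bar>coeff (P 0) q\<bar> \<longrightarrow> continuous_on {-1..1} l \<longrightarrow> l 0 = 0 \<longrightarrow>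
    (\<forall>\<tau>. \<bar>\<tau>\<bar> \<le> 1 \<longrightarrow> poly (P \<tau>) (l \<tau>) = 0) \<longrightarrow>
    (\<forall>\<tau>. \<bar>\<tau>\<bar> \<le> \<epsilon> \<longrightarrow> \<bar>l \<tau>\<bar> \<le> (real n + 1) / \<epsilon> * \<bar>\<tau>\<bar>)"
    using root_displacement[OF q \<kappa> \<kappa>M'] by (elim exE conjE) (rule that; assumption)
  show ?thesis
  proof (intro exI[of _ \<epsilon>] conjI allI impI \<epsilon>)
    fix a and l :: "real^'m \<Rightarrow> real" and x w \<tau>
    assume root: "\<forall>y\<in>cball x (norm w). real_rooted (P_fam n a y) \<and> poly (P_fam n a y) (l y) = 0"
      and cont: "continuous_on (cball x (norm w)) l" and lx: "\<bar>l x\<bar> \<le> M"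
      and taylor: "\<forall>i\<in>{1..n}. taylor_expansion q M (\<lambda>\<tau>. a i (x + \<tau> *\<^sub>R w))"
      and large: "\<kappa> \<le> \<bar>coeff (pcompose (P_fam n a x) [:l x, 1:]) q\<bar>" and \<tau>: "\<bar>\<tau>\<bar> \<le> \<epsilon>"
    have in_ball: "x + t *\<^sub>R w \<in> cball x (norm w)" if "\<bar>t\<bar> \<le> 1" for t
      using that by (simp add: dist_norm mult_left_le_one_le)
    define P where "P t = pcompose (P_fam n a (x + t *\<^sub>R w)) [:l x, 1:]" for t
    have "\<exists>c. (\<forall>k<q. \<bar>c k\<bar> \<le> M') \<and>
        (\<forall>t. \<bar>t\<bar> \<le> 1 \<longrightarrow> \<bar>coeff (P t) j - (\<Sum>k<q. c k * t ^ k)\<bar> \<le> M' * \<bar>t\<bar> ^ q)" for j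
    proof -
      have each: "taylor_expansion q M (\<lambda>t. coeff (P_fam n a (x + t *\<^sub>R w)) i)" if "i \<in> {..n}" for i
      proof (cases "i = n")
        case True
        have "taylor_expansion q M (\<lambda>_. 1)"
          using taylor_expansion_mono[OF taylor_expansion_const[of q 1]] q M by simp
        then show ?thesis using True by (simp add: coeff_P_fam)
      next
        case False
        then show ?thesis using that taylor by (simp add: coeff_P_fam)
      qed
      have "(\<Sum>i\<le>n. \<bar>real (i choose j) * l x ^ (i - j)\<bar>) \<le> (\<Sum>i\<le>n. 2 ^ n * M ^ n)"
      proof (rule sum_mono)
        fix i assume i: "i \<in> {..n}"
        have "i choose j \<le> 2 ^ n"
          using order.trans[OF binomial_le_pow2[of i j] power_increasing[of i n "2::nat"]] i by simp
        then have "real (i choose j) \<le> 2 ^ n"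
          by (metis of_nat_le_iff of_nat_numeral of_nat_power)
        moreover have "\<bar>l x\<bar> ^ (i - j) \<le> M ^ n"
          using i lx M by (intro order.trans[OF power_mono power_increasing]) auto
        ultimately show "\<bar>real (i choose j) * l x ^ (i - j)\<bar> \<le> 2 ^ n * M ^ n"
          unfolding abs_mult power_abs by (intro mult_mono) auto
      qed
      then have "(\<Sum>i\<le>n. \<bar>real (i choose j) * l x ^ (i - j)\<bar>) * M \<le> M'"
        using M unfolding M'_def by (intro order.trans[OF mult_right_mono max.cobounded2]) auto
      from taylor_expansion_mono[OF taylor_expansion_sum[OF finite_atMost each] this]
      have "taylor_expansion q M' (\<lambda>t. coeff (P t) j)"
        unfolding P_def by (subst coeff_pcompose_shift[of _ n]) (simp_all add: degree_P_fam)
      then show ?thesis unfolding taylor_expansion_def .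
    qed
    then have "\<exists>c. \<forall>j. (\<forall>k<q. \<bar>c j k\<bar> \<le> M') \<and>
        (\<forall>t. \<bar>t\<bar> \<le> 1 \<longrightarrow> \<bar>coeff (P t) j - (\<Sum>k<q. c j k * t ^ k)\<bar> \<le> M' * \<bar>t\<bar> ^ q)"
      by (intro choice allI)
    then obtain c where c: "\<And>j k. k < q \<Longrightarrow> \<bar>c j k\<bar> \<le> M'"
        "\<And>j t. \<bar>t\<bar> \<le> 1 \<Longrightarrow> \<bar>coeff (P t) j - (\<Sum>k<q. c j k * t ^ k)\<bar> \<le> M' * \<bar>t\<bar> ^ q"
      by blast
    have "taylor_family q n M' P c"
      unfolding taylor_family_def
    proof (intro conjI allI impI)
      fix t :: real assume "\<bar>t\<bar> \<le> 1"
      then show "real_rooted (P t)" "degree (P t) = n"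
        using root in_ball unfolding P_def
        by (auto intro!: real_rooted_pcompose_linear simp: degree_pcompose degree_P_fam)
    qed (use c in auto)
    moreover have "continuous_on {-1..1} (\<lambda>t. l (x + t *\<^sub>R w) - l x)"
      by (intro continuous_intros continuous_on_compose2[OF cont]) (use in_ball in auto)
    moreover have "poly (P t) (l (x + t *\<^sub>R w) - l x) = 0" if "\<bar>t\<bar> \<le> 1" for t
      using root in_ball[OF that] by (simp add: P_def poly_pcompose)
    ultimately show "\<bar>l (x + \<tau> *\<^sub>R w) - l x\<bar> \<le> (real n + 1) / \<epsilon> * \<bar>\<tau>\<bar>"
      using disp[rule_format, of P c "\<lambda>t. l (x + t *\<^sub>R w) - l x" \<tau>] large \<tau> by (simp add: P_def)
  qed
qed

lemma root_lipschitz_at_point: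
  fixes \<kappa> M :: real
  assumes q: "1 \<le> q" "q \<le> n" and \<kappa>: "0 < \<kappa>" and M: "1 \<le> M"
  shows "\<exists>\<epsilon>>0. \<epsilon> \<le> 1 \<and> (\<forall>a (l :: real^'m::finite \<Rightarrow> real) x \<delta>. 0 < \<delta> \<longrightarrow>
    (\<forall>y\<in>cball x \<delta>. real_rooted (P_fam n a y) \<and> poly (P_fam n a y) (l y) = 0) \<longrightarrow>
    continuous_on (cball x \<delta>) l \<longrightarrow> \<bar>l x\<bar> \<le> M \<longrightarrow>
    (\<forall>w. norm w = \<delta> \<longrightarrow> (\<forall>i\<in>{1..n}. taylor_expansion q M (\<lambda>\<tau>. a i (x + \<tau> *\<^sub>R w)))) \<longrightarrow>
    \<kappa> \<le> \<bar>coeff (pcompose (P_fam n a x) [:l x, 1:]) q\<bar> \<longrightarrow>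
    (\<forall>y. norm (y - x) \<le> \<epsilon> * \<delta> \<longrightarrow> \<bar>l y - l x\<bar> \<le> (real n + 1) / (\<epsilon> * \<delta>) * norm (y - x)))"
proof -
  obtain \<epsilon> where \<epsilon>: "0 < \<epsilon>" "\<epsilon> \<le> 1" and disp: "\<forall>a (l :: real^'m \<Rightarrow> real) x w.
    (\<forall>y\<in>cball x (norm w). real_rooted (P_fam n a y) \<and> poly (P_fam n a y) (l y) = 0) \<longrightarrow>
    continuous_on (cball x (norm w)) l \<longrightarrow> \<bar>l x\<bar> \<le> M \<longrightarrow>
    (\<forall>i\<in>{1..n}. taylor_expansion q M (\<lambda>\<tau>. a i (x + \<tau> *\<^sub>R w))) \<longrightarrow>
    \<kappa> \<le> \<bar>coeff (pcompose (P_fam n a x) [:l x, 1:]) q\<bar> \<longrightarrow>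
    (\<forall>\<tau>. \<bar>\<tau>\<bar> \<le> \<epsilon> \<longrightarrow> \<bar>l (x + \<tau> *\<^sub>R w) - l x\<bar> \<le> (real n + 1) / \<epsilon> * \<bar>\<tau>\<bar>)"
    using root_displacement_along_segment[OF assms, where 'm = 'm]
    by (elim exE conjE) (rule that; assumption)
  show ?thesis
  proof (intro exI[of _ \<epsilon>] conjI allI impI \<epsilon>)
    fix a and l :: "real^'m \<Rightarrow> real" and x \<delta> y
    assume \<delta>: "0 < \<delta>"
      and root: "\<forall>y\<in>cball x \<delta>. real_rooted (P_fam n a y) \<and> poly (P_fam n a y) (l y) = 0"
      and cont: "continuous_on (cball x \<delta>) l" and lx: "\<bar>l x\<bar> \<le> M"
      and taylor: "\<forall>w. norm w = \<delta> \<longrightarrow> (\<forall>i\<in>{1..n}. taylor_expansion q M (\<lambda>\<tau>. a i (x + \<tau> *\<^sub>R w)))"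
      and large: "\<kappa> \<le> \<bar>coeff (pcompose (P_fam n a x) [:l x, 1:]) q\<bar>"
      and y: "norm (y - x) \<le> \<epsilon> * \<delta>"
    show "\<bar>l y - l x\<bar> \<le> (real n + 1) / (\<epsilon> * \<delta>) * norm (y - x)"
    proof (cases "y = x")
      case False
      define r where "r = norm (y - x)"
      have r: "0 < r" using False by (simp add: r_def)
      define w where "w = (\<delta> / r) *\<^sub>R (y - x)"
      have w: "norm w = \<delta>" using \<delta> r by (simp add: w_def r_def)
      have end_point: "x + (r / \<delta>) *\<^sub>R w = y" using \<delta> r by (simp add: w_def)
      have "\<bar>r / \<delta>\<bar> \<le> \<epsilon>" using y r \<delta> by (simp add: r_def field_simps)
      then have "\<bar>l (x + (r / \<delta>) *\<^sub>R w) - l x\<bar> \<le> (real n + 1) / \<epsilon> * \<bar>r / \<delta>\<bar>"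
        using disp[THEN spec, of a, THEN spec, of l, THEN spec, of x, THEN spec, of w]
          root cont lx taylor large w by blast
      then show ?thesis
        unfolding end_point using r \<delta> by (simp add: r_def)
    qed simp
  qed
qed

section \<open>Lipschitz bounds for continuous roots\<close>

lemma coeff_shift_order_nonzero:
  fixes p :: "real poly"
  assumes "p \<noteq> 0"
  shows "coeff (pcompose p [:b, 1:]) (order b p) \<noteq> 0"
proof -
  obtain r where r: "p = [:-b, 1:] ^ order b p * r" "\<not> [:-b, 1:] dvd r"
    using order_decomp[OF assms] by blast
  have pw: "pcompose ([:-b, 1:] ^ k) [:b, 1:] = monom 1 k" for k
  proof (induction k)
    case (Suc k)
    have "pcompose ([:-b, 1:] ^ Suc k) [:b, 1:] = pcompose [:-b, 1:] [:b, 1:] * monom 1 k"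
      unfolding power_Suc pcompose_mult Suc ..
    then show ?case by (simp add: pcompose_pCons monom_Suc)
  qed (simp add: pcompose_1)
  have "pcompose p [:b, 1:] = monom 1 (order b p) * pcompose r [:b, 1:]"
    by (subst r(1)) (simp only: pcompose_mult pw)
  then have "coeff (pcompose p [:b, 1:]) (order b p) = poly r b"
    by (simp add: coeff_monom_mult)
  then show ?thesis
    using r(2) by (simp add: poly_eq_0_iff_dvd)
qed

lemma order_le_max_multiplicity:
  assumes "x \<in> U" "poly (P_fam n a x) z = 0"
  shows "order z (P_fam n a x) \<le> max_multiplicity n U a"
  unfolding max_multiplicity_def
proof (rule Max_ge)
  have "P_fam n a y \<noteq> 0" for y
    using coeff_P_fam[of n a y n] by auto
  then have "order w (P_fam n a y) \<le> n" for w y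
    using order_degree[of "P_fam n a y" w] by (simp add: degree_P_fam)
  then have "{order z (P_fam n a x) |x z. x \<in> U \<and> poly (P_fam n a x) z = 0} \<subseteq> {..n}"
    by auto
  then show "finite {order z (P_fam n a x) |x z. x \<in> U \<and> poly (P_fam n a x) z = 0}"
    by (rule finite_subset) simp
qed (use assms in blast)

text \<open>Near \<open>x0\<close> the order \<open>q\<close> is the multiplicity of the root \<open>l x0\<close>. It is at most \<open>p\<close>, so expansions of order \<open>p\<close>
  suffice, and the shifted coefficient of index \<open>q\<close> is nonzero at \<open>x0\<close>, hence bounded below nearby.\<close>

lemma continuous_root_locally_lipschitz:
  fixes U :: "(real^'m::finite) set"
  assumes U: "open U" and fam: "Ck1_hyperbolic_family (max_multiplicity n U a - 1) n U a"
    and root: "continuous_root n U a l"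
  shows "locally_lipschitz_on U l"
  unfolding locally_lipschitz_on_def
proof
  fix x0 assume x0: "x0 \<in> U"
  define p where "p = max_multiplicity n U a"
  define q where "q = order (l x0) (P_fam n a x0)"
  have nz: "P_fam n a x0 \<noteq> 0"
    using coeff_P_fam[of n a x0 n] by auto
  have lroot: "poly (P_fam n a x) (l x) = 0" if "x \<in> U" for x
    using root that by (simp add: continuous_root_def)
  have lcont: "continuous_on U l" using root by (simp add: continuous_root_def)
  have q: "1 \<le> q" "q \<le> n" "q \<le> p"
    using order_root[of "P_fam n a x0" "l x0"] lroot[OF x0] nz order_degree[OF nz, of "l x0"]
      order_le_max_multiplicity[OF x0 lroot[OF x0]]
    by (auto simp: q_def p_def degree_P_fam)
  obtain \<rho>' where \<rho>': "0 < \<rho>'" "cball x0 \<rho>' \<subseteq> U"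
    using U x0 open_contains_cball by blast
  \<comment> \<open>The ball \<open>K\<close> of radius \<open>2 \<rho>\<close> contains the balls of radius \<open>\<rho>\<close> about all points near \<open>x0\<close>.\<close>
  define \<rho> where "\<rho> = min 1 (\<rho>' / 2)"
  have \<rho>: "0 < \<rho>" "\<rho> \<le> 1" using \<rho>' by (auto simp: \<rho>_def)
  define K where "K = cball x0 (2 * \<rho>)"
  have KU: "K \<subseteq> U"
    using \<rho>' subset_cball[of "2 * \<rho>" \<rho>' x0] by (auto simp: K_def \<rho>_def)
  have Kcpt: "compact K" by (simp add: K_def)
  define N where "N = (\<Sum>i=1..n. Ck1_rnorm (p - 1) K (a i))"
  have aCk: "Ck1_on (p - 1) U (a i)" if "i \<in> {1..n}" for i
    using fam that by (simp add: Ck1_hyperbolic_family_def p_def)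
  have N: "Ck1_rnorm (p - 1) K (a i) \<le> N" if "i \<in> {1..n}" for i
    unfolding N_def using that by (intro member_le_sum) (auto simp: Ck1_rnorm_def)
  have N0: "0 \<le> N" unfolding N_def by (intro sum_nonneg) (simp add: Ck1_rnorm_def)
  define F where "F x = coeff (pcompose (P_fam n a x) [:l x, 1:]) q" for x
  define \<kappa> where "\<kappa> = \<bar>F x0\<bar> / 2"
  have \<kappa>: "0 < \<kappa>"
    using coeff_shift_order_nonzero[OF nz, of "l x0"] by (simp add: \<kappa>_def F_def q_def)
  have acont: "continuous_on U (a i)" if "i \<in> {1..n}" for i
    using aCk[OF that] by (auto simp: Ck1_on_def Ck_on_def dest: spec[of _ "[]"])
  have Fcont: "continuous_on U F"
  proof -
    have ccont: "continuous_on U (\<lambda>x. coeff (P_fam n a x) i)" for i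
      using acont[of "n - i"] by (cases "i < n"; cases "i = n") (auto simp: coeff_P_fam)
    show ?thesis
      unfolding F_def coeff_pcompose_shift[OF eq_refl[OF degree_P_fam]]
      by (intro continuous_intros ccont lcont)
  qed
  obtain r1 where r1: "0 < r1" "\<And>x. x \<in> U \<Longrightarrow> dist x x0 < r1 \<Longrightarrow> dist (F x) (F x0) < \<kappa>"
    using Fcont x0 \<kappa> unfolding continuous_on_iff by meson
  obtain r2 where r2: "0 < r2" "\<And>x. x \<in> U \<Longrightarrow> dist x x0 < r2 \<Longrightarrow> dist (l x) (l x0) < 1"
    using lcont x0 unfolding continuous_on_iff by (meson zero_less_one)
  define k where "k = p - 1"
  have k: "Suc k = p" using q by (simp add: k_def)
  define M where "M = 1 + \<bar>l x0\<bar> + real (Suc p) * (real CARD('m) ^ k * N)"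
  have M: "1 \<le> M" "1 + \<bar>l x0\<bar> \<le> M" "real (Suc p) * (real CARD('m) ^ k * N) \<le> M"
    using N0 by (auto simp: M_def)
  obtain \<epsilon> where \<epsilon>: "0 < \<epsilon>" "\<epsilon> \<le> 1" and est: "\<forall>a (l :: real^'m \<Rightarrow> real) x \<delta>. 0 < \<delta> \<longrightarrow>
    (\<forall>y\<in>cball x \<delta>. real_rooted (P_fam n a y) \<and> poly (P_fam n a y) (l y) = 0) \<longrightarrow>
    continuous_on (cball x \<delta>) l \<longrightarrow> \<bar>l x\<bar> \<le> M \<longrightarrow>
    (\<forall>w. norm w = \<delta> \<longrightarrow> (\<forall>i\<in>{1..n}. taylor_expansion q M (\<lambda>\<tau>. a i (x + \<tau> *\<^sub>R w)))) \<longrightarrow>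
    \<kappa> \<le> \<bar>coeff (pcompose (P_fam n a x) [:l x, 1:]) q\<bar> \<longrightarrow>
    (\<forall>y. norm (y - x) \<le> \<epsilon> * \<delta> \<longrightarrow> \<bar>l y - l x\<bar> \<le> (real n + 1) / (\<epsilon> * \<delta>) * norm (y - x))"
    using root_lipschitz_at_point[OF q(1,2) \<kappa> M(1), where 'm = 'm]
    by (elim exE conjE) (rule that; assumption)
  define u where "u = Min {r1 / 2, r2 / 2, \<rho>, \<epsilon> * \<rho> / 2}"
  have u: "0 < u" "u < r1" "u < r2" "u \<le> \<rho>" "2 * u \<le> \<epsilon> * \<rho>"
  proof -
    have "u \<le> r1 / 2" "u \<le> r2 / 2" "u \<le> \<rho>" "u \<le> \<epsilon> * \<rho> / 2" by (auto simp: u_def)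
    then show "0 < u" "u < r1" "u < r2" "u \<le> \<rho>" "2 * u \<le> \<epsilon> * \<rho>"
      using r1 r2 \<rho> \<epsilon> by (auto simp: u_def)
  qed
  have "\<bar>l y - l x\<bar> \<le> (real n + 1) / (\<epsilon> * \<rho>) * norm (y - x)"
    if x: "x \<in> cball x0 u" and y: "y \<in> cball x0 u" for x y
  proof (rule est[THEN spec, of a, THEN spec, of l, THEN spec, of x, THEN spec, of \<rho>, THEN mp, THEN mp, THEN mp, THEN mp, THEN mp, THEN mp, THEN spec, of y, THEN mp])
    show "0 < \<rho>" by (fact \<rho>(1))
    have xK: "cball x \<rho> \<subseteq> K"
      unfolding K_def using x u(4) by (intro cball_subset_cball_iff[THEN iffD2] disjI1) (auto simp: dist_commute)
    then have xU: "cball x \<rho> \<subseteq> U" using KU by blast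
    moreover have "x \<in> cball x \<rho>" using \<rho> by simp
    ultimately have xinU: "x \<in> U" by blast
    show "\<forall>y\<in>cball x \<rho>. real_rooted (P_fam n a y) \<and> poly (P_fam n a y) (l y) = 0"
      using xU fam lroot by (auto simp: Ck1_hyperbolic_family_def intro: hyperbolic_imp_real_rooted)
    show "continuous_on (cball x \<rho>) l" using lcont xU continuous_on_subset by blast
    have d: "dist x x0 < r1" "dist x x0 < r2" using x u by (auto simp: dist_commute)
    show "\<bar>l x\<bar> \<le> M" using r2(2)[OF xinU d(2)] M(2) by (simp add: dist_real_def)
    show "\<kappa> \<le> \<bar>coeff (pcompose (P_fam n a x) [:l x, 1:]) q\<bar>"
    proof -
      have "\<bar>F x - F x0\<bar> < \<kappa>"
        using r1(2)[OF xinU d(1)] by (simp add: dist_real_def)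
      then have "\<kappa> \<le> \<bar>F x\<bar>" unfolding \<kappa>_def by linarith
      then show ?thesis by (simp add: F_def)
    qed
    show "\<forall>w. norm w = \<rho> \<longrightarrow> (\<forall>i\<in>{1..n}. taylor_expansion q M (\<lambda>\<tau>. a i (x + \<tau> *\<^sub>R w)))"
    proof (intro allI impI ballI)
      fix w :: "real^'m" and i assume w: "norm w = \<rho>" and i: "i \<in> {1..n}"
      have fin: "Ck1_norm k K (a i) < \<infinity>"
        unfolding k_def by (rule Ck1_norm_finite[OF aCk[OF i] Kcpt KU])
      have "taylor_expansion (Suc k) (real CARD('m) ^ k * N) (\<lambda>\<tau>. a i (x + \<tau> *\<^sub>R w))"
      proof (rule taylor_expansion_along_segment[OF _ U KU])
        show "Ck_on k U (a i)" using aCk[OF i] by (simp add: Ck1_on_def k_def)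
        show "\<bar>pds js (a i) y\<bar> \<le> N" if "length js \<le> k" "y \<in> K" for js y
          using Ck1_norm_bounds(1)[OF fin that] N[OF i] by (simp add: k_def)
        show "\<bar>pds js (a i) y - pds js (a i) z\<bar> \<le> N * norm (y - z)"
          if "length js = k" "y \<in> K" "z \<in> K" for js y z
          using Ck1_norm_bounds(2)[OF fin that] mult_right_mono[OF N[OF i] norm_ge_zero[of "y - z"]]
          by (simp add: k_def)
      qed (use xK w \<rho> in auto)
      then show "taylor_expansion q M (\<lambda>\<tau>. a i (x + \<tau> *\<^sub>R w))"
        using taylor_expansion_mono[OF taylor_expansion_lower_order M(3)] q(3) unfolding k by blast
    qed
    have "norm (y - x) \<le> norm (y - x0) + norm (x - x0)"
      using norm_triangle_ineq4[of "y - x0" "x - x0"] by simp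
    also have "\<dots> \<le> u + u" using x y by (intro add_mono) (auto simp: dist_norm norm_minus_commute)
    finally show "norm (y - x) \<le> \<epsilon> * \<rho>" using u(5) by simp
  qed
  then have "((real n + 1) / (\<epsilon> * \<rho>))-lipschitz_on (cball x0 u \<inter> U) l"
    using \<epsilon> \<rho> by (intro lipschitz_onI) (auto simp: dist_norm norm_minus_commute abs_minus_commute)
  then show "\<exists>u>0. \<exists>L. L-lipschitz_on (cball x0 u \<inter> U) l"
    using u(1) by blast
qed

text \<open>For \<open>\<bar>z\<bar> > n\<close> the leading term outweighs the \<open>n\<close> others.\<close>

lemma abs_root_le:
  fixes p :: "real poly"
  assumes deg: "degree p = n" "coeff p n = 1" "1 \<le> n" and bd: "\<And>i. i < n \<Longrightarrow> \<bar>coeff p i\<bar> \<le> 1"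
    and z: "poly p z = 0"
  shows "\<bar>z\<bar> \<le> real n"
proof (rule ccontr)
  assume "\<not> ?thesis"
  then have big: "real n < \<bar>z\<bar>" and z1: "1 \<le> \<bar>z\<bar>" using deg(3) by auto
  obtain k where k: "n = Suc k" using deg(3) by (cases n) auto
  have "poly p z = (\<Sum>i<n. coeff p i * z ^ i) + z ^ n"
    using deg by (simp add: poly_altdef lessThan_Suc_atMost[symmetric])
  then have "\<bar>z\<bar> ^ n = \<bar>\<Sum>i<n. coeff p i * z ^ i\<bar>"
    using z by (simp add: power_abs[symmetric] eq_neg_iff_add_eq_0[symmetric])
  also have "\<dots> \<le> (\<Sum>i<n. \<bar>z\<bar> ^ k)"
  proof (intro order.trans[OF sum_abs] sum_mono)
    fix i assume i: "i \<in> {..<n}"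
    have "\<bar>coeff p i * z ^ i\<bar> \<le> 1 * \<bar>z\<bar> ^ k"
      unfolding abs_mult power_abs using bd i z1 k by (intro mult_mono power_increasing) auto
    then show "\<bar>coeff p i * z ^ i\<bar> \<le> \<bar>z\<bar> ^ k" by simp
  qed
  also have "\<dots> = real n * \<bar>z\<bar> ^ k" by simp
  also have "\<dots> < \<bar>z\<bar> * \<bar>z\<bar> ^ k"
    using big z1 by (intro mult_strict_right_mono zero_less_power) auto
  finally show False using k by simp
qed

lemma P_fam_rescale:
  assumes "0 < (s :: real)"
  shows "P_fam n (\<lambda>i x. a i x / s ^ i) x = smult (1 / s ^ n) (pcompose (P_fam n a x) [:0, s:])"
proof (rule poly_eqI)
  fix i
  show "coeff (P_fam n (\<lambda>i x. a i x / s ^ i) x) i = coeff (smult (1 / s ^ n) (pcompose (P_fam n a x) [:0, s:])) i"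
    using assms by (auto simp: coeff_P_fam coeff_pcompose_linear power_diff)
qed

text \<open>Replace \<open>a\<^sub>i\<close> by \<open>a\<^sub>i / s\<^sup>i\<close> and the root by \<open>l / s\<close>: the norms become at most \<open>1\<close>, the estimate at a
  point applies with \<open>q = n\<close> and \<open>\<kappa> = 1\<close>, and the constant no longer depends on the family. Undoing the
  scaling produces the factor \<open>s\<close>. The local estimate covers pairs of points at distance up to \<open>\<epsilon> \<delta>\<close>;
  more distant pairs are covered by the bound \<open>n\<close> for all roots of the scaled polynomials.\<close>

lemma continuous_root_uniform_lipschitz:
  fixes U0 U1 :: "(real^'m::finite) set"
  assumes n: "1 \<le> n" and U1: "open U1" and sub: "U0 \<Subset> U1"
  shows "\<exists>C>0. \<forall>U a l s x y. open U \<longrightarrow> U1 \<Subset> U \<longrightarrow> Ck1_hyperbolic_family (n - 1) n U a \<longrightarrow>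
    continuous_root n U a l \<longrightarrow> 0 < s \<longrightarrow>
    (\<forall>i\<in>{1..n}. Ck1_rnorm (n - 1) (closure U1) (a i) \<le> s ^ i) \<longrightarrow> x \<in> U0 \<longrightarrow> y \<in> U0 \<longrightarrow>
    \<bar>l x - l y\<bar> \<le> C * s * norm (x - y)"
proof -
  obtain \<delta>' where \<delta>': "0 < \<delta>'" "(\<Union>x\<in>closure U0. cball x \<delta>') \<subseteq> U1"
    using compact_subset_open_imp_cball_epsilon_subset[of "closure U0" U1] sub U1
    unfolding rel_compact_in_def by blast
  define \<delta> where "\<delta> = min 1 \<delta>'"
  have \<delta>: "0 < \<delta>" "\<delta> \<le> 1" using \<delta>' by (auto simp: \<delta>_def)
  have ball_U1: "cball x \<delta> \<subseteq> U1" if "x \<in> U0" for x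
    using that \<delta>'(2) closure_subset[of U0] subset_cball[of \<delta> \<delta>' x] by (auto simp: \<delta>_def)
  define k where "k = n - 1"
  have k: "Suc k = n" using n by (simp add: k_def)
  define M where "M = real n + real CARD('m) ^ k"
  have M: "1 \<le> M" "real n \<le> M" "real CARD('m) ^ k \<le> M"
    using n by (auto simp: M_def intro: add_increasing2)
  obtain \<epsilon> where \<epsilon>: "0 < \<epsilon>" "\<epsilon> \<le> 1" and est: "\<forall>a (l :: real^'m \<Rightarrow> real) x \<delta>. 0 < \<delta> \<longrightarrow>
    (\<forall>y\<in>cball x \<delta>. real_rooted (P_fam n a y) \<and> poly (P_fam n a y) (l y) = 0) \<longrightarrow>
    continuous_on (cball x \<delta>) l \<longrightarrow> \<bar>l x\<bar> \<le> M \<longrightarrow>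
    (\<forall>w. norm w = \<delta> \<longrightarrow> (\<forall>i\<in>{1..n}. taylor_expansion n M (\<lambda>\<tau>. a i (x + \<tau> *\<^sub>R w)))) \<longrightarrow>
    1 \<le> \<bar>coeff (pcompose (P_fam n a x) [:l x, 1:]) n\<bar> \<longrightarrow>
    (\<forall>y. norm (y - x) \<le> \<epsilon> * \<delta> \<longrightarrow> \<bar>l y - l x\<bar> \<le> (real n + 1) / (\<epsilon> * \<delta>) * norm (y - x))"
    using root_lipschitz_at_point[OF n order_refl zero_less_one M(1), where 'm = 'm]
    by (elim exE conjE) (rule that; assumption)
  define C where "C = (2 * real n + 1) / (\<epsilon> * \<delta>)"
  have C: "0 < C" unfolding C_def using \<epsilon> \<delta> by (intro divide_pos_pos mult_pos_pos) auto
  show ?thesis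
  proof (intro exI[of _ C] conjI allI impI C)
    fix U and a and l :: "real^'m \<Rightarrow> real" and s x y
    assume U: "open U" "U1 \<Subset> U" and fam: "Ck1_hyperbolic_family (n - 1) n U a"
      and root: "continuous_root n U a l" and s: "0 < s"
      and norms: "\<forall>i\<in>{1..n}. Ck1_rnorm (n - 1) (closure U1) (a i) \<le> s ^ i"
      and x: "x \<in> U0" and y: "y \<in> U0"
    define K where "K = closure U1"
    have K: "compact K" "K \<subseteq> U" using U(2) by (auto simp: K_def rel_compact_in_def)
    have U1K: "U1 \<subseteq> K" by (simp add: K_def closure_subset)
    define b where "b i x = a i x / s ^ i" for i x
    define h where "h x = l x / s" for x
    have fin: "Ck1_norm k K (a i) < \<infinity>" if "i \<in> {1..n}" for i
      using fam that K by (intro Ck1_norm_finite[OF _ K]) (simp add: Ck1_hyperbolic_family_def k_def)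
    note bd = Ck1_norm_bounds[OF fin]
    have P_b: "P_fam n b z = smult (1 / s ^ n) (pcompose (P_fam n a z) [:0, s:])" for z
      unfolding b_def by (rule P_fam_rescale[OF s])
    have rr: "real_rooted (P_fam n b z)" if "z \<in> U" for z
      unfolding P_b using fam that s
      by (intro real_rooted_smult real_rooted_pcompose_linear hyperbolic_imp_real_rooted)
        (auto simp: Ck1_hyperbolic_family_def)
    have hroot: "poly (P_fam n b z) (h z) = 0" if "z \<in> U" for z
      using root that s by (simp add: P_b h_def poly_pcompose continuous_root_def)
    have hcont: "continuous_on U h"
      unfolding h_def using root s by (intro continuous_intros) (auto simp: continuous_root_def)
    have hb: "\<bar>h z\<bar> \<le> real n" if "z \<in> K" for z
    proof (rule abs_root_le[of "P_fam n b z"])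
      fix i assume i: "i < n"
      have "\<bar>a (n - i) z\<bar> \<le> Ck1_rnorm k K (a (n - i))"
        using bd(1)[of "n - i" "[]" z] i that by simp
      also have "\<dots> \<le> s ^ (n - i)" using norms i by (simp add: k_def K_def)
      finally show "\<bar>coeff (P_fam n b z) i\<bar> \<le> 1"
        using i s by (simp add: coeff_P_fam b_def)
    qed (use that K hroot n in \<open>auto simp: degree_P_fam coeff_P_fam\<close>)
    have "\<bar>h y - h x\<bar> \<le> C * norm (y - x)"
    proof (cases "norm (y - x) \<le> \<epsilon> * \<delta>")
      case True
      have "\<bar>h y - h x\<bar> \<le> (real n + 1) / (\<epsilon> * \<delta>) * norm (y - x)"
      proof (rule est[THEN spec, of b, THEN spec, of h, THEN spec, of x, THEN spec, of \<delta>, THEN mp, THEN mp, THEN mp, THEN mp, THEN mp, THEN mp, THEN spec, of y, THEN mp])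
        show "0 < \<delta>" "norm (y - x) \<le> \<epsilon> * \<delta>" by (fact \<delta>(1) True)+
        have xK: "cball x \<delta> \<subseteq> K" "cball x \<delta> \<subseteq> U" using ball_U1[OF x] U1K K by auto
        show "\<forall>y\<in>cball x \<delta>. real_rooted (P_fam n b y) \<and> poly (P_fam n b y) (h y) = 0"
          using xK rr hroot by blast
        show "continuous_on (cball x \<delta>) h" using hcont xK continuous_on_subset by blast
        show "\<bar>h x\<bar> \<le> M" using hb[of x] xK \<delta> M(2) by force
        have "coeff (pcompose (P_fam n b x) [:h x, 1:]) n = lead_coeff (pcompose (P_fam n b x) [:h x, 1:])"
          by (simp add: degree_pcompose degree_P_fam)
        also have "\<dots> = 1"
          by (subst lead_coeff_comp) (simp_all add: degree_P_fam coeff_P_fam)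
        finally show "1 \<le> \<bar>coeff (pcompose (P_fam n b x) [:h x, 1:]) n\<bar>" by simp
        show "\<forall>w. norm w = \<delta> \<longrightarrow> (\<forall>i\<in>{1..n}. taylor_expansion n M (\<lambda>\<tau>. b i (x + \<tau> *\<^sub>R w)))"
        proof (intro allI impI ballI)
          fix w :: "real^'m" and i assume w: "norm w = \<delta>" and i: "i \<in> {1..n}"
          let ?N = "Ck1_rnorm k K (a i)"
          have "taylor_expansion (Suc k) (real CARD('m) ^ k * ?N) (\<lambda>\<tau>. a i (x + \<tau> *\<^sub>R w))"
            by (rule taylor_expansion_along_segment[OF _ U(1) K(2) bd(1)[OF i] bd(2)[OF i]])
              (use fam i xK w \<delta> in \<open>auto simp: Ck1_hyperbolic_family_def Ck1_on_def k_def\<close>)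
          then have "taylor_expansion n ((\<Sum>j\<in>{i}. \<bar>1 / s ^ j\<bar>) * (real CARD('m) ^ k * ?N))
              (\<lambda>\<tau>. \<Sum>j\<in>{i}. 1 / s ^ j * a j (x + \<tau> *\<^sub>R w))"
            unfolding k by (intro taylor_expansion_sum) auto
          moreover have "(\<Sum>j\<in>{i}. \<bar>1 / s ^ j\<bar>) * (real CARD('m) ^ k * ?N) \<le> M"
          proof -
            have "?N / s ^ i \<le> 1" using norms i s by (simp add: k_def K_def)
            then have "real CARD('m) ^ k * (?N / s ^ i) \<le> real CARD('m) ^ k * 1"
              by (intro mult_left_mono) auto
            then show ?thesis using M(3) s by simp
          qed
          ultimately show "taylor_expansion n M (\<lambda>\<tau>. b i (x + \<tau> *\<^sub>R w))"
            using taylor_expansion_mono by (fastforce simp: b_def)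
        qed
      qed
      also have "\<dots> \<le> C * norm (y - x)"
        unfolding C_def using \<epsilon> \<delta> by (intro mult_right_mono divide_right_mono) auto
      finally show ?thesis .
    next
      case False
      have "\<bar>h y - h x\<bar> \<le> \<bar>h y\<bar> + \<bar>h x\<bar>" by simp
      also have "\<dots> \<le> (2 * real n + 1) * 1"
        using hb[of x] hb[of y] ball_U1[OF x] ball_U1[OF y] U1K \<delta> by force
      also have "\<dots> \<le> (2 * real n + 1) * (norm (y - x) / (\<epsilon> * \<delta>))"
        using False \<epsilon> \<delta> by (intro mult_left_mono) auto
      also have "\<dots> = C * norm (y - x)" by (simp add: C_def)
      finally show ?thesis .
    qed
    moreover have "\<bar>h y - h x\<bar> = \<bar>l x - l y\<bar> / s"
      using s by (simp add: h_def diff_divide_distrib[symmetric] abs_minus_commute)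
    ultimately have "\<bar>l x - l y\<bar> \<le> C * norm (y - x) * s"
      using s by (simp add: field_simps)
    then show "\<bar>l x - l y\<bar> \<le> C * s * norm (x - y)"
      by (simp add: norm_minus_commute mult_ac)
  qed
qed

theorem theorem2p2:
  fixes n :: nat
  assumes "n \<ge> 1"
  shows "(\<forall>(U :: (real^'m::finite) set) a p l.
            open U \<longrightarrow> p = max_multiplicity n U a \<longrightarrow>
            Ck1_hyperbolic_family (p - 1) n U a \<longrightarrow> continuous_root n U a l \<longrightarrow>
            locally_lipschitz_on U l) \<and>
         (\<forall>(U0 :: (real^'m) set) U1. open U1 \<longrightarrow> U0 \<Subset> U1 \<longrightarrow>
            (\<exists>C C' :: real. 0 \<le> C \<and> 0 \<le> C' \<and>
              (\<forall>U a p l.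
                open U \<longrightarrow> U1 \<Subset> U \<longrightarrow> p = max_multiplicity n U a \<longrightarrow> p = n \<longrightarrow>
                Ck1_hyperbolic_family (p - 1) n U a \<longrightarrow> continuous_root n U a l \<longrightarrow>
                Lip U0 l \<le> ennreal
                  (C * (MAX i\<in>{1..n}. Ck1_rnorm (n - 1) (closure U1) (a i) powr (1 / real i))) \<and>
                C * (MAX i\<in>{1..n}. Ck1_rnorm (n - 1) (closure U1) (a i) powr (1 / real i))
                  \<le> C' * (1 + (MAX i\<in>{1..n}. Ck1_rnorm (n - 1) (closure U1) (a i))))))"
proof (intro conjI allI impI)
  fix U :: "(real^'m) set" and a p l
  assume "open U" "p = max_multiplicity n U a" "Ck1_hyperbolic_family (p - 1) n U a" "continuous_root n U a l"
  then show "locally_lipschitz_on U l"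
    using continuous_root_locally_lipschitz by blast
next
  fix U0 U1 :: "(real^'m) set"
  assume U1: "open U1" and U0: "U0 \<Subset> U1"
  obtain C where C: "0 < C" and lip: "\<forall>U a l s x y. open U \<longrightarrow> U1 \<Subset> U \<longrightarrow>
    Ck1_hyperbolic_family (n - 1) n U a \<longrightarrow> continuous_root n U a l \<longrightarrow> 0 < s \<longrightarrow>
    (\<forall>i\<in>{1..n}. Ck1_rnorm (n - 1) (closure U1) (a i) \<le> s ^ i) \<longrightarrow> x \<in> U0 \<longrightarrow> y \<in> U0 \<longrightarrow>
    \<bar>l x - l y\<bar> \<le> C * s * norm (x - y)"
    using continuous_root_uniform_lipschitz[OF assms U1 U0] by (elim exE conjE) (rule that; assumption)
  show "\<exists>C C' :: real. 0 \<le> C \<and> 0 \<le> C' \<and>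
              (\<forall>U a p l.
                open U \<longrightarrow> U1 \<Subset> U \<longrightarrow> p = max_multiplicity n U a \<longrightarrow> p = n \<longrightarrow>
                Ck1_hyperbolic_family (p - 1) n U a \<longrightarrow> continuous_root n U a l \<longrightarrow>
                Lip U0 l \<le> ennreal
                  (C * (MAX i\<in>{1..n}. Ck1_rnorm (n - 1) (closure U1) (a i) powr (1 / real i))) \<and>
                C * (MAX i\<in>{1..n}. Ck1_rnorm (n - 1) (closure U1) (a i) powr (1 / real i))
                  \<le> C' * (1 + (MAX i\<in>{1..n}. Ck1_rnorm (n - 1) (closure U1) (a i))))"
  proof (intro exI[of _ C] conjI allI impI)
    fix U a p l
    assume U: "open U" "U1 \<Subset> U" and p: "p = n"
      and fam: "Ck1_hyperbolic_family (p - 1) n U a" and root: "continuous_root n U a l"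
    let ?N = "\<lambda>i. Ck1_rnorm (n - 1) (closure U1) (a i)"
    define S where "S = (MAX i\<in>{1..n}. ?N i powr (1 / real i))"
    have N0: "0 \<le> ?N i" for i by (simp add: Ck1_rnorm_def)
    have le_S: "?N i powr (1 / real i) \<le> S" if "i \<in> {1..n}" for i
      unfolding S_def using that by (intro Max_ge) auto
    have S0: "0 \<le> S"
      using le_S[of 1] assms powr_ge_zero[of "?N 1" "1 / real 1"] by (meson atLeastAtMost_iff order_refl order_trans)
    \<comment> \<open>The scaling factor must be positive, so it is taken slightly above \<open>S\<close>, which may be \<open>0\<close>.\<close>
    have close: "\<bar>l x - l y\<bar> \<le> C * S * norm (x - y)" if xy: "x \<in> U0" "y \<in> U0" for x y
    proof (rule field_le_epsilon)
      fix e :: real assume e: "0 < e"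
      define s where "s = S + e / (C * (norm (x - y) + 1))"
      have pos: "0 < C * (norm (x - y) + 1)" using C by (intro mult_pos_pos add_nonneg_pos) auto
      have s: "S < s" "0 < s" using S0 e pos by (auto simp: s_def intro: add_nonneg_pos)
      have "\<forall>i\<in>{1..n}. ?N i \<le> s ^ i"
      proof
        fix i assume i: "i \<in> {1..n}"
        have "?N i = (?N i powr (1 / real i)) ^ i"
        proof (cases "?N i = 0")
          case False
          then have "0 < ?N i" using N0[of i] by simp
          then show ?thesis using i by (simp add: powr_powr flip: powr_realpow)
        qed (use i in auto)
        also have "\<dots> \<le> s ^ i" using le_S[OF i] s by (intro power_mono) auto
        finally show "?N i \<le> s ^ i" .
      qed
      then have "\<bar>l x - l y\<bar> \<le> C * s * norm (x - y)"
        using lip U root s(2) xy fam p by blast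
      also have "\<dots> = C * S * norm (x - y) + e * (norm (x - y) / (norm (x - y) + 1))"
      proof -
        have cancel: "C * (e / (C * (norm (x - y) + 1))) = e / (norm (x - y) + 1)"
          using C by simp
        show ?thesis
          unfolding s_def distrib_left[of C S] cancel distrib_right[of "C * S"] by simp
      qed
      also have "\<dots> \<le> C * S * norm (x - y) + e * 1"
      proof (intro add_left_mono mult_left_mono)
        have "0 < norm (x - y) + 1" by (intro add_nonneg_pos) auto
        then show "norm (x - y) / (norm (x - y) + 1) \<le> 1" by simp
      qed (use e in auto)
      finally show "\<bar>l x - l y\<bar> \<le> C * S * norm (x - y) + e" by simp
    qed
    show "Lip U0 l \<le> ennreal (C * (MAX i\<in>{1..n}. ?N i powr (1 / real i)))"
      unfolding Lip_def S_def[symmetric]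
    proof (rule SUP_least, clarify)
      fix x y assume "x \<in> U0" "y \<in> U0" "x \<noteq> y"
      then show "ennreal (\<bar>l x - l y\<bar> / norm (x - y)) \<le> ennreal (C * S)"
        using close[of x y] by (intro ennreal_leI) (simp add: divide_le_eq)
    qed
    have "S \<in> (\<lambda>i. ?N i powr (1 / real i)) ` {1..n}"
      unfolding S_def using assms by (intro Max_in) auto
    then obtain i where i: "i \<in> {1..n}" "S = ?N i powr (1 / real i)" by blast
    \<comment> \<open>The second inequality, with \<open>C' = C\<close>, from \<open>t\<^bsup>1/i\<^esup> \<le> 1 + t\<close>.\<close>
    have "?N i powr (1 / real i) \<le> (1 + ?N i) powr (1 / real i)"
      using N0[of i] by (intro powr_mono2) auto
    also have "\<dots> \<le> (1 + ?N i) powr 1"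
      using N0[of i] i by (intro powr_mono) auto
    also have "\<dots> = 1 + ?N i" using N0[of i] by simp
    also have "?N i \<le> (MAX i\<in>{1..n}. ?N i)"
      using i by (intro Max_ge) auto
    finally have "S \<le> 1 + (MAX i\<in>{1..n}. ?N i)"
      using i(2) by simp
    then show "C * (MAX i\<in>{1..n}. ?N i powr (1 / real i)) \<le> C * (1 + (MAX i\<in>{1..n}. ?N i))"
      unfolding S_def[symmetric] using C by (intro mult_left_mono) auto
  qed (use C in auto)
qed

end
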